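(* Let $(X,\gamma,H)$ be an abstract Wiener space, let $\Delta_\gamma$ be the Ornstein–Uhlenbeck operator on $X$, and let $s\in(0,1)$. Let $\varphi:\mathbb{R}\to\mathbb{R}$ be a convex function of class $C^2$. Let $u:X\to\mathbb{R}$ be such that $(-\Delta_\gamma)^su$ and $(-\Delta_\gamma)^s\varphi(u)$ exist, i.e. $u$ and $\varphi(u)=\varphi\circ u$ both belong to the domain of $(-\Delta_\gamma)^s$ in $L^2_\gamma(X)$. Then $$(-\Delta_\gamma)^s\varphi(u)\;\le\;\varphi'(u)\,(-\Delta_\gamma)^su\qquad\gamma\text{-a.e. on }X.$$
   Context: An abstract Wiener space $(X,\gamma,H)$ consists of a separable Banach space $X$, a nondegenerate centred Gaussian measure $\gamma$ on $X$, and its Cameron–Martin space $H$. Let $Q:X^*\to X$ be the covariance operator, $\langle Qx^*,y^*\rangle=\int_X\langle x,x^*\rangle\langle x,y^*\rangle\,d\gamma(x)$. Let $\mathcal{H}$ be the closure in $L^2_\gamma(X)$ of the set of functions $x\mapsto\langle x,x^*\rangle$, $x^*\in X^*$, and let $R:\mathcal{H}\to X$, $R\hat h=\int_X\hat h(x)\,x\,d\gamma(x)$; then $H=R\mathcal{H}$ with the inner product $[\cdot,\cdot]_H$ and norm $|\cdot|_H$ induced from $\mathcal{H}$ via $R$. Choose $x_j^*\in X^*$ such that $h_j=Qx_j^*$, $j\in\mathbb{N}$, form an orthonormal basis of $H$. A function $u:X\to\mathbb{R}$ is $C^k_b$ cylindrical if $u(x)=v(\langle x,x_1^*\rangle,\dots,\langle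 x,x_m^*\rangle)$ for some $m$ and some $v\in C^k(\mathbb{R}^m)$ with continuous and bounded derivatives up to order $k$. For $C^1_b$ cylindrical $u$ put $\nabla_\gamma u=\sum_j\partial_ju\,h_j$ with $\partial_j=\partial_{h_j}$; $\nabla_\gamma$ is closable in $L^2_\gamma(X)$ and $W^{1,2}_\gamma(X)$ denotes the domain of its closure. The Ornstein–Uhlenbeck operator is $\Delta_\gamma=\mathrm{div}_\gamma\nabla_\gamma$, where $-\mathrm{div}_\gamma$ is the adjoint of $\nabla_\gamma$ in $L^2_\gamma$; on $C^2_b$ cylindrical functions $\Delta_\gamma u=\sum_{j=1}^m\left(\partial_{jj}u-\langle x,x_j^*\rangle\,\partial_ju\right)$. Thus $-\Delta_\gamma$ is the nonnegative self-adjoint operator in $L^2_\gamma(X)$ associated with the closed form $u\mapsto\int_X|\nabla_\gamma u|_H^2\,d\gamma$ on $W^{1,2}_\gamma(X)$. For $s\in(0,1)$, $(-\Delta_\gamma)^s$ is defined by the spectral theorem, equivalently $$(-\Delta_\gamma)^su=\frac{1}{\Gamma(-s)}\int_0^\infty\left(e^{t\Delta_\gamma}u-u\right)\frac{dt}{t^{1+s}}.$$ *)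

theory Defs
  imports "HOL-Probability.Probability"
begin

section \<open>Square-integrable functions and spectral calculus\<close>

text \<open>
  Elements of \<open>L\<^sup>2(M)\<close> are represented by square-integrable functions and identified when they
  agree almost everywhere. Unbounded operators in \<open>L\<^sup>2(M)\<close> are represented by their graphs: a
  relation \<open>A u g\<close> means that \<open>u\<close> is in the domain of \<open>A\<close> and that \<open>g\<close> represents \<open>A u\<close>.
\<close>

definition L2 :: "'a measure \<Rightarrow> ('a \<Rightarrow> real) set" where
  "L2 M = {f \<in> borel_measurable M. integrable M (\<lambda>x. (f x)\<^sup>2)}"

definition L2_inner :: "'a measure \<Rightarrow> ('a \<Rightarrow> real) \<Rightarrow> ('a \<Rightarrow> real) \<Rightarrow> real" where
  "L2_inner M f g = (\<integral>x. f x * g x \<partial>M)"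

definition orthogonal_projection ::
    "'a measure \<Rightarrow> (('a \<Rightarrow> real) \<Rightarrow> ('a \<Rightarrow> real)) \<Rightarrow> bool" where
  "orthogonal_projection M P \<longleftrightarrow>
     (\<forall>f\<in>L2 M. P f \<in> L2 M) \<and>
     (\<forall>f\<in>L2 M. \<forall>g\<in>L2 M. \<forall>a b.
        AE x in M. P (\<lambda>y. a * f y + b * g y) x = a * P f x + b * P g x) \<and>
     (\<forall>f\<in>L2 M. AE x in M. P (P f) x = P f x) \<and>
     (\<forall>f\<in>L2 M. \<forall>g\<in>L2 M. L2_inner M (P f) g = L2_inner M f (P g))"

definition projection_valued_measure ::
    "'a measure \<Rightarrow> (real set \<Rightarrow> ('a \<Rightarrow> real) \<Rightarrow> ('a \<Rightarrow> real)) \<Rightarrow> bool" where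
  "projection_valued_measure M E \<longleftrightarrow>
     (\<forall>B\<in>sets borel. orthogonal_projection M (E B)) \<and>
     (\<forall>f\<in>L2 M. AE x in M. E UNIV f x = f x) \<and>
     (\<forall>B :: nat \<Rightarrow> real set. range B \<subseteq> sets borel \<longrightarrow> disjoint_family B \<longrightarrow>
        (\<forall>f\<in>L2 M.
           (\<lambda>n. \<integral>x. (E (\<Union>i. B i) f x - (\<Sum>i<n. E (B i) f x))\<^sup>2 \<partial>M) \<longlonglongrightarrow> 0))"

text \<open>The scalar spectral measure \<open>B \<mapsto> \<langle>E B f, f\<rangle>\<close>.\<close>

definition spectral_distribution ::
    "'a measure \<Rightarrow> (real set \<Rightarrow> ('a \<Rightarrow> real) \<Rightarrow> ('a \<Rightarrow> real)) \<Rightarrow> ('a \<Rightarrow> real) \<Rightarrow> real measure" where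
  "spectral_distribution M E f =
     measure_of UNIV (sets borel) (\<lambda>B. ennreal (L2_inner M (E B f) f))"

definition spectral_domain ::
    "'a measure \<Rightarrow> (real set \<Rightarrow> ('a \<Rightarrow> real) \<Rightarrow> ('a \<Rightarrow> real)) \<Rightarrow> (real \<Rightarrow> real) \<Rightarrow> ('a \<Rightarrow> real) set" where
  "spectral_domain M E g =
     {f \<in> L2 M. integrable (spectral_distribution M E f) (\<lambda>t. (g t)\<^sup>2)}"

text \<open>
  The graph of \<open>\<integral> g dE\<close>. The image \<open>w\<close> of \<open>f\<close> is determined by
  \<open>\<langle>w, f'\<rangle> = \<integral> g d\<langle>E f, f'\<rangle>\<close> for \<open>f'\<close> in the (dense) domain, where the signed measure
  \<open>\<langle>E f, f'\<rangle>\<close> is written by polarization as a difference of two finite measures.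
\<close>

definition spectral_integral ::
    "'a measure \<Rightarrow> (real set \<Rightarrow> ('a \<Rightarrow> real) \<Rightarrow> ('a \<Rightarrow> real)) \<Rightarrow> (real \<Rightarrow> real) \<Rightarrow>
     ('a \<Rightarrow> real) \<Rightarrow> ('a \<Rightarrow> real) \<Rightarrow> bool" where
  "spectral_integral M E g f w \<longleftrightarrow>
     f \<in> spectral_domain M E g \<and> w \<in> L2 M \<and>
     (\<forall>f'\<in>spectral_domain M E g.
        L2_inner M w f' =
          ((\<integral>t. g t \<partial>spectral_distribution M E (\<lambda>x. f x + f' x))
           - (\<integral>t. g t \<partial>spectral_distribution M E (\<lambda>x. f x - f' x))) / 4)"

definition spectral_measure_of ::
    "'a measure \<Rightarrow> (('a \<Rightarrow> real) \<Rightarrow> ('a \<Rightarrow> real) \<Rightarrow> bool) \<Rightarrow>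
     (real set \<Rightarrow> ('a \<Rightarrow> real) \<Rightarrow> ('a \<Rightarrow> real)) \<Rightarrow> bool" where
  "spectral_measure_of M A E \<longleftrightarrow>
     projection_valued_measure M E \<and>
     (\<forall>u g. A u g \<longleftrightarrow> spectral_integral M E (\<lambda>t. t) u g)"

text \<open>
  The graph of \<open>A\<^sup>s\<close> for a nonnegative self-adjoint operator \<open>A\<close> and \<open>s > 0\<close>. By the spectral
  theorem \<open>E\<close> exists and is unique up to null sets; it is carried by \<open>[0, \<infinity>)\<close>, so the values of
  \<open>t powr s\<close> at negative \<open>t\<close> are irrelevant.
\<close>

definition fractional_power ::
    "'a measure \<Rightarrow> (('a \<Rightarrow> real) \<Rightarrow> ('a \<Rightarrow> real) \<Rightarrow> bool) \<Rightarrow> real \<Rightarrow>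
     ('a \<Rightarrow> real) \<Rightarrow> ('a \<Rightarrow> real) \<Rightarrow> bool" where
  "fractional_power M A s u w \<longleftrightarrow>
     (\<exists>E. spectral_measure_of M A E \<and> spectral_integral M E (\<lambda>t. t powr s) u w)"

section \<open>Abstract Wiener spaces\<close>

text \<open>A Dirac mass at the origin counts as a (degenerate) centred Gaussian law on the line.\<close>

definition centred_gaussian_measure :: "'a::real_normed_vector measure \<Rightarrow> bool" where
  "centred_gaussian_measure \<gamma> \<longleftrightarrow>
     prob_space \<gamma> \<and> sets \<gamma> = sets borel \<and>
     (\<forall>\<xi> :: 'a \<Rightarrow>\<^sub>L real.
        (\<exists>\<sigma>>0. distributed \<gamma> lborel (blinfun_apply \<xi>) (\<lambda>t. ennreal (normal_density 0 \<sigma> t))) \<or>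
        (AE x in \<gamma>. blinfun_apply \<xi> x = 0))"

definition nondegenerate_measure :: "'a::real_normed_vector measure \<Rightarrow> bool" where
  "nondegenerate_measure \<gamma> \<longleftrightarrow>
     (\<forall>\<xi> :: 'a \<Rightarrow>\<^sub>L real. \<xi> \<noteq> 0 \<longrightarrow> \<not> (AE x in \<gamma>. blinfun_apply \<xi> x = 0))"

text \<open>
  A separable Banach space is a type of class \<^class>\<open>banach\<close> and
  \<^class>\<open>second_countable_topology\<close>. The Cameron-Martin space is determined by \<open>\<gamma>\<close> and is
  defined below as a subset of the ambient space.
\<close>

definition abstract_wiener_space :: "'a::{banach, second_countable_topology} measure \<Rightarrow> bool" where
  "abstract_wiener_space \<gamma> \<longleftrightarrow> centred_gaussian_measure \<gamma> \<and> nondegenerate_measure \<gamma>"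

definition covariance_operator ::
    "'a::{banach, second_countable_topology} measure \<Rightarrow> (('a \<Rightarrow>\<^sub>L real) \<Rightarrow> 'a) \<Rightarrow> bool" where
  "covariance_operator \<gamma> Q \<longleftrightarrow>
     (\<forall>\<xi> \<eta>. blinfun_apply \<eta> (Q \<xi>) = (\<integral>x. blinfun_apply \<xi> x * blinfun_apply \<eta> x \<partial>\<gamma>))"

text \<open>The closure of the dual space in \<open>L\<^sup>2(\<gamma>)\<close>.\<close>

definition dual_closure :: "'a::{banach, second_countable_topology} measure \<Rightarrow> ('a \<Rightarrow> real) set" where
  "dual_closure \<gamma> =
     {f \<in> L2 \<gamma>. \<exists>\<xi> :: nat \<Rightarrow> 'a \<Rightarrow>\<^sub>L real.
        (\<lambda>n. \<integral>x. (blinfun_apply (\<xi> n) x - f x)\<^sup>2 \<partial>\<gamma>) \<longlonglongrightarrow> 0}"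

definition cm_map :: "'a::{banach, second_countable_topology} measure \<Rightarrow> ('a \<Rightarrow> real) \<Rightarrow> 'a" where
  "cm_map \<gamma> f = (\<integral>x. f x *\<^sub>R x \<partial>\<gamma>)"

definition cm_space :: "'a::{banach, second_countable_topology} measure \<Rightarrow> 'a set" where
  "cm_space \<gamma> = cm_map \<gamma> ` dual_closure \<gamma>"

text \<open>The preimage of \<open>h\<close> under \<^const>\<open>cm_map\<close>, which is unique up to null sets.\<close>

definition cm_hat :: "'a::{banach, second_countable_topology} measure \<Rightarrow> 'a \<Rightarrow> 'a \<Rightarrow> real" where
  "cm_hat \<gamma> h = (SOME f. f \<in> dual_closure \<gamma> \<and> cm_map \<gamma> f = h)"

definition cm_inner :: "'a::{banach, second_countable_topology} measure \<Rightarrow> 'a \<Rightarrow> 'a \<Rightarrow> real" where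
  "cm_inner \<gamma> h k = L2_inner \<gamma> (cm_hat \<gamma> h) (cm_hat \<gamma> k)"

definition cm_norm :: "'a::{banach, second_countable_topology} measure \<Rightarrow> 'a \<Rightarrow> real" where
  "cm_norm \<gamma> h = sqrt (cm_inner \<gamma> h h)"

definition cm_orthonormal_basis ::
    "'a::{banach, second_countable_topology} measure \<Rightarrow> nat set \<Rightarrow> (nat \<Rightarrow> 'a) \<Rightarrow> bool" where
  "cm_orthonormal_basis \<gamma> J h \<longleftrightarrow>
     (\<forall>j\<in>J. h j \<in> cm_space \<gamma>) \<and>
     (\<forall>i\<in>J. \<forall>j\<in>J. cm_inner \<gamma> (h i) (h j) = (if i = j then 1 else 0)) \<and>
     (\<forall>k\<in>cm_space \<gamma>. \<forall>\<epsilon>>0. \<exists>F c. finite F \<and> F \<subseteq> J \<and>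
        cm_norm \<gamma> (k - (\<Sum>j\<in>F. c j *\<^sub>R h j)) < \<epsilon>)"

text \<open>
  The standing choice of functionals \<open>\<xi>\<^sub>j\<close> such that \<open>h\<^sub>j = Q \<xi>\<^sub>j\<close> is an orthonormal basis of the
  Cameron-Martin space. The index set is \<open>\<nat>\<close>, or an initial segment of it when the space is
  finite-dimensional.
\<close>

definition wiener_basis ::
    "'a::{banach, second_countable_topology} measure \<Rightarrow> (('a \<Rightarrow>\<^sub>L real) \<Rightarrow> 'a) \<Rightarrow>
     nat set \<Rightarrow> (nat \<Rightarrow> 'a \<Rightarrow>\<^sub>L real) \<Rightarrow> bool" where
  "wiener_basis \<gamma> Q J \<xi> \<longleftrightarrow>
     covariance_operator \<gamma> Q \<and>
     (J = UNIV \<or> (\<exists>d. J = {..<d})) \<and>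
     cm_orthonormal_basis \<gamma> J (\<lambda>j. Q (\<xi> j))"

section \<open>The Ornstein-Uhlenbeck operator\<close>

text \<open>
  A function of \<open>m\<close> real variables is represented by a function on \<open>nat \<Rightarrow> real\<close> that depends on
  the first \<open>m\<close> coordinates only; for such functions continuity in the product topology is
  continuity on \<open>\<real>\<^sup>m\<close>.
\<close>

definition C1b :: "nat \<Rightarrow> ((nat \<Rightarrow> real) \<Rightarrow> real) \<Rightarrow> bool" where
  "C1b m v \<longleftrightarrow>
     (\<forall>y z. (\<forall>i<m. y i = z i) \<longrightarrow> v y = v z) \<and>
     continuous_on UNIV v \<and> bounded (range v) \<and>
     (\<forall>i<m. \<exists>d. (\<forall>y. ((\<lambda>t. v (y(i := t))) has_real_derivative d y) (at (y i))) \<and>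
        continuous_on UNIV d \<and> bounded (range d))"

definition C1b_cylindrical ::
    "nat set \<Rightarrow> (nat \<Rightarrow> 'a::real_normed_vector \<Rightarrow>\<^sub>L real) \<Rightarrow> ('a \<Rightarrow> real) \<Rightarrow> bool" where
  "C1b_cylindrical J \<xi> u \<longleftrightarrow>
     (\<exists>m v. {..<m} \<subseteq> J \<and> C1b m v \<and> u = (\<lambda>x. v (\<lambda>i. blinfun_apply (\<xi> i) x)))"

definition dir_deriv :: "'a::real_normed_vector \<Rightarrow> ('a \<Rightarrow> real) \<Rightarrow> 'a \<Rightarrow> real" where
  "dir_deriv h u x = deriv (\<lambda>t. u (x + t *\<^sub>R h)) 0"

text \<open>For cylindrical functions only finitely many terms of the sum are nonzero.\<close>

definition cyl_gradient ::
    "(('a \<Rightarrow>\<^sub>L real) \<Rightarrow> 'a) \<Rightarrow> nat set \<Rightarrow> (nat \<Rightarrow> 'a::real_normed_vector \<Rightarrow>\<^sub>L real) \<Rightarrow>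
     ('a \<Rightarrow> real) \<Rightarrow> 'a \<Rightarrow> 'a" where
  "cyl_gradient Q J \<xi> u x = (\<Sum>\<^sub>\<infinity>j\<in>J. dir_deriv (Q (\<xi> j)) u x *\<^sub>R Q (\<xi> j))"

text \<open>
  Square-integrable fields with values in the Cameron-Martin space. As that space is a separable
  Hilbert space continuously embedded in the ambient space, a map into it is measurable iff it is
  Borel measurable as a map into the ambient space.
\<close>

definition L2_field ::
    "'a::{banach, second_countable_topology} measure \<Rightarrow> ('a \<Rightarrow> 'a) set" where
  "L2_field \<gamma> =
     {F \<in> borel_measurable \<gamma>. (\<forall>x. F x \<in> cm_space \<gamma>) \<and>
        integrable \<gamma> (\<lambda>x. (cm_norm \<gamma> (F x))\<^sup>2)}"

text \<open>
  The graph of the closure in \<open>L\<^sup>2(\<gamma>)\<close> of the gradient on \<open>C\<^sup>1\<^sub>b\<close> cylindrical functions; its domain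
  is \<open>W\<^sup>1\<^sup>,\<^sup>2(\<gamma>)\<close>.
\<close>

definition wiener_gradient ::
    "'a::{banach, second_countable_topology} measure \<Rightarrow> (('a \<Rightarrow>\<^sub>L real) \<Rightarrow> 'a) \<Rightarrow>
     nat set \<Rightarrow> (nat \<Rightarrow> 'a \<Rightarrow>\<^sub>L real) \<Rightarrow> ('a \<Rightarrow> real) \<Rightarrow> ('a \<Rightarrow> 'a) \<Rightarrow> bool" where
  "wiener_gradient \<gamma> Q J \<xi> u F \<longleftrightarrow>
     u \<in> L2 \<gamma> \<and> F \<in> L2_field \<gamma> \<and>
     (\<exists>U :: nat \<Rightarrow> 'a \<Rightarrow> real.
        (\<forall>n. C1b_cylindrical J \<xi> (U n)) \<and>
        (\<lambda>n. \<integral>x. (U n x - u x)\<^sup>2 \<partial>\<gamma>) \<longlonglongrightarrow> 0 \<and>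
        (\<lambda>n. \<integral>x. (cm_norm \<gamma> (cyl_gradient Q J \<xi> (U n) x - F x))\<^sup>2 \<partial>\<gamma>) \<longlonglongrightarrow> 0)"

text \<open>The graph of minus the adjoint of the (closed) gradient.\<close>

definition wiener_divergence ::
    "'a::{banach, second_countable_topology} measure \<Rightarrow> (('a \<Rightarrow>\<^sub>L real) \<Rightarrow> 'a) \<Rightarrow>
     nat set \<Rightarrow> (nat \<Rightarrow> 'a \<Rightarrow>\<^sub>L real) \<Rightarrow> ('a \<Rightarrow> 'a) \<Rightarrow> ('a \<Rightarrow> real) \<Rightarrow> bool" where
  "wiener_divergence \<gamma> Q J \<xi> G g \<longleftrightarrow>
     G \<in> L2_field \<gamma> \<and> g \<in> L2 \<gamma> \<and>
     (\<forall>u F. wiener_gradient \<gamma> Q J \<xi> u F \<longrightarrow>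
        (\<integral>x. cm_inner \<gamma> (F x) (G x) \<partial>\<gamma>) = - L2_inner \<gamma> u g)"

definition ornstein_uhlenbeck ::
    "'a::{banach, second_countable_topology} measure \<Rightarrow> (('a \<Rightarrow>\<^sub>L real) \<Rightarrow> 'a) \<Rightarrow>
     nat set \<Rightarrow> (nat \<Rightarrow> 'a \<Rightarrow>\<^sub>L real) \<Rightarrow> ('a \<Rightarrow> real) \<Rightarrow> ('a \<Rightarrow> real) \<Rightarrow> bool" where
  "ornstein_uhlenbeck \<gamma> Q J \<xi> u g \<longleftrightarrow>
     (\<exists>F. wiener_gradient \<gamma> Q J \<xi> u F \<and> wiener_divergence \<gamma> Q J \<xi> F g)"

text \<open>\<open>frac_ornstein_uhlenbeck \<gamma> Q J \<xi> s u v\<close> means that \<open>u\<close> is in the domain of the \<open>s\<close>-th power of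
  minus the Ornstein-Uhlenbeck operator and that \<open>v\<close> is its image.\<close>

definition frac_ornstein_uhlenbeck ::
    "'a::{banach, second_countable_topology} measure \<Rightarrow> (('a \<Rightarrow>\<^sub>L real) \<Rightarrow> 'a) \<Rightarrow>
     nat set \<Rightarrow> (nat \<Rightarrow> 'a \<Rightarrow>\<^sub>L real) \<Rightarrow> real \<Rightarrow> ('a \<Rightarrow> real) \<Rightarrow> ('a \<Rightarrow> real) \<Rightarrow> bool" where
  "frac_ornstein_uhlenbeck \<gamma> Q J \<xi> =
     fractional_power \<gamma> (\<lambda>u g. ornstein_uhlenbeck \<gamma> Q J \<xi> u (\<lambda>x. - g x))"

end

theory Submission
  imports Defs
begin

text \<open>
  Put \<open>A = -\<Delta>\<^sub>\<gamma>\<close>. Testing \<open>l z + A z = l f\<close> with a smooth nondecreasing function of \<open>z\<close> shows that the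
  resolvents \<open>J\<^sub>l = l (l + A)\<^sup>-\<^sup>1\<close> are positive, and they fix constants. Applying \<open>J\<^sub>l\<close> to the tangent lines
  \<open>\<phi> (a) + \<phi>' (a) (u - a) \<le> \<phi> (u)\<close> for rational \<open>a\<close> and then letting \<open>a\<close> tend to \<open>u (x)\<close> gives the
  inequality of Cordoba and Cordoba for the resolvents,
  \<open>\<phi> (u) - J\<^sub>l \<phi> (u) \<le> \<phi>' (u) (u - J\<^sub>l u)\<close> almost everywhere. Since \<open>t\<^sup>s\<close> is a constant multiple of
  \<open>\<integral> l\<^sup>s\<^sup>-\<^sup>1 t / (l + t) dl\<close> over \<open>l > 0\<close>, lower Riemann sums exhibit \<open>A\<^sup>s f\<close> as a weak limit of positive
  combinations of \<open>f - J\<^sub>l f\<close>, and the inequality passes to the limit.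

  The resolvents depend only on \<open>A\<close>, so no uniqueness of the spectral measure is needed, although the
  two hypotheses on \<open>u\<close> and \<open>\<phi> (u)\<close> may come with different spectral measures.
\<close>

section \<open>The space of square-integrable functions\<close>

text \<open>The operator is given only as a graph, through the gradient and its adjoint, so no
  kernel of its semigroup is at hand. A resolvent, by contrast, is the solution of an equation in
  that graph, and the equation can be tested. In the formula for \<open>t powr s\<close> the factor
  \<open>t / (l + t)\<close> is the multiplier of \<open>I - J\<^sub>l\<close>. Lower sums are taken
  because they stay below \<open>t powr s\<close>: this bounds the norms of the approximants, and a
  norm bound together with convergence against a dense set of test functions gives weak convergence.
  A weak limit suffices, since an inequality between two functions can be tested on indicators. The
  factor \<open>\<phi>' (u)\<close> may be unbounded, so it is moved onto the test function, which
  is supported where \<open>\<bar>\<phi>' (u)\<bar> \<le> k\<close>. As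
  \<open>spectral_integral\<close> is defined weakly and by polarization, and multiplicativity of a
  projection-valued measure has to be derived, the functional calculus is built from scalar
  identities that are checked on indicators of Borel sets.\<close>

lemma L2_measurable [measurable_dest]: "f \<in> L2 M \<Longrightarrow> f \<in> borel_measurable M"
  by (simp add: L2_def)

lemma L2_integrable_square: "f \<in> L2 M \<Longrightarrow> integrable M (\<lambda>x. (f x)\<^sup>2)"
  by (simp add: L2_def)

lemma L2_integrable_mult:
  assumes "f \<in> L2 M" "g \<in> L2 M"
  shows "integrable M (\<lambda>x. f x * g x)"
proof (rule Bochner_Integration.integrable_bound)
  show "integrable M (\<lambda>x. (f x)\<^sup>2 + (g x)\<^sup>2)"
    using assms by (auto intro: L2_integrable_square)
  show "(\<lambda>x. f x * g x) \<in> borel_measurable M"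
    using assms by measurable
  have "\<bar>a * b\<bar> \<le> a\<^sup>2 + b\<^sup>2" for a b :: real
    using sum_squares_bound[of a b] sum_squares_bound[of a "-b"] zero_le_power2[of a] zero_le_power2[of b]
    by (simp add: abs_if)
  then show "AE x in M. norm (f x * g x) \<le> norm ((f x)\<^sup>2 + (g x)\<^sup>2)"
    by simp
qed

lemma L2_lincomb:
  assumes "f \<in> L2 M" "g \<in> L2 M"
  shows "(\<lambda>x. a * f x + b * g x) \<in> L2 M"
proof -
  have "(a * f x + b * g x)\<^sup>2 = a\<^sup>2 * (f x)\<^sup>2 + b\<^sup>2 * (g x)\<^sup>2 + (2 * a * b) * (f x * g x)" for x
    by (simp add: power2_eq_square algebra_simps)
  moreover have "integrable M (\<lambda>x. a\<^sup>2 * (f x)\<^sup>2 + b\<^sup>2 * (g x)\<^sup>2 + (2 * a * b) * (f x * g x))"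
    using assms by (intro Bochner_Integration.integrable_add Bochner_Integration.integrable_mult_right
        L2_integrable_square L2_integrable_mult)
  ultimately have "integrable M (\<lambda>x. (a * f x + b * g x)\<^sup>2)"
    by presburger
  moreover have "(\<lambda>x. a * f x + b * g x) \<in> borel_measurable M"
    using assms by measurable
  ultimately show ?thesis
    by (simp add: L2_def)
qed

lemma L2_scale: "f \<in> L2 M \<Longrightarrow> (\<lambda>x. c * f x) \<in> L2 M"
  using L2_lincomb[of f M f c 0] by simp

lemma L2_add: "f \<in> L2 M \<Longrightarrow> g \<in> L2 M \<Longrightarrow> (\<lambda>x. f x + g x) \<in> L2 M"
  using L2_lincomb[of f M g 1 1] by simp

lemma L2_diff: "f \<in> L2 M \<Longrightarrow> g \<in> L2 M \<Longrightarrow> (\<lambda>x. f x - g x) \<in> L2 M"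
  using L2_lincomb[of f M g 1 "-1"] by simp

lemma L2_zero [simp]: "(\<lambda>x. 0) \<in> L2 M"
  by (simp add: L2_def)

lemma L2_sum: "(\<And>i. i \<in> I \<Longrightarrow> f i \<in> L2 M) \<Longrightarrow> (\<lambda>x. \<Sum>i\<in>I. f i x) \<in> L2 M"
  by (induction I rule: infinite_finite_induct) (auto intro: L2_add)

lemma (in finite_measure) L2_const [simp]: "(\<lambda>x. c) \<in> L2 M"
  by (simp add: L2_def)

lemma L2_bounded_mult:
  assumes "f \<in> L2 M" and [measurable]: "k \<in> borel_measurable M" and "\<And>x. \<bar>k x\<bar> \<le> K"
  shows "(\<lambda>x. k x * f x) \<in> L2 M"
proof -
  have "integrable M (\<lambda>x. (k x * f x)\<^sup>2)"
  proof (rule Bochner_Integration.integrable_bound)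
    show "integrable M (\<lambda>x. K\<^sup>2 * (f x)\<^sup>2)"
      using assms by (auto intro: L2_integrable_square)
    show "(\<lambda>x. (k x * f x)\<^sup>2) \<in> borel_measurable M"
      using assms(1) by measurable
    have "(k x)\<^sup>2 \<le> K\<^sup>2" for x
      using assms(3)[of x] by (simp add: abs_le_square_iff[symmetric])
    then show "AE x in M. norm ((k x * f x)\<^sup>2) \<le> norm (K\<^sup>2 * (f x)\<^sup>2)"
      by (simp add: power_mult_distrib mult_right_mono)
  qed
  moreover have "(\<lambda>x. k x * f x) \<in> borel_measurable M"
    using assms(1) by measurable
  ultimately show ?thesis
    by (simp add: L2_def)
qed

lemma L2_inner_commute: "L2_inner M f g = L2_inner M g f"
  by (simp add: L2_inner_def mult.commute)

lemma L2_inner_lincomb_left: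
  assumes "f \<in> L2 M" "g \<in> L2 M" "h \<in> L2 M"
  shows "L2_inner M (\<lambda>x. a * f x + b * g x) h = a * L2_inner M f h + b * L2_inner M g h"
proof -
  have "L2_inner M (\<lambda>x. a * f x + b * g x) h = (\<integral>x. a * (f x * h x) + b * (g x * h x) \<partial>M)"
    unfolding L2_inner_def by (intro Bochner_Integration.integral_cong) (simp_all add: algebra_simps)
  also have "\<dots> = a * L2_inner M f h + b * L2_inner M g h"
    unfolding L2_inner_def using assms
    by (subst Bochner_Integration.integral_add) (auto intro: L2_integrable_mult)
  finally show ?thesis .
qed

lemma L2_inner_lincomb_right:
  assumes "f \<in> L2 M" "g \<in> L2 M" "h \<in> L2 M"
  shows "L2_inner M h (\<lambda>x. a * f x + b * g x) = a * L2_inner M h f + b * L2_inner M h g"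
  using L2_inner_lincomb_left[OF assms] by (simp add: L2_inner_commute)

lemma L2_inner_scale_left: "L2_inner M (\<lambda>x. c * f x) h = c * L2_inner M f h"
  unfolding L2_inner_def by (simp add: mult.assoc)

lemma L2_inner_scale_right: "L2_inner M h (\<lambda>x. c * f x) = c * L2_inner M h f"
  using L2_inner_scale_left by (metis L2_inner_commute)

lemma L2_inner_add_left:
  "f \<in> L2 M \<Longrightarrow> g \<in> L2 M \<Longrightarrow> h \<in> L2 M \<Longrightarrow>
    L2_inner M (\<lambda>x. f x + g x) h = L2_inner M f h + L2_inner M g h"
  using L2_inner_lincomb_left[of f M g h 1 1] by simp

lemma L2_inner_diff_left:
  "f \<in> L2 M \<Longrightarrow> g \<in> L2 M \<Longrightarrow> h \<in> L2 M \<Longrightarrow>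
    L2_inner M (\<lambda>x. f x - g x) h = L2_inner M f h - L2_inner M g h"
  using L2_inner_lincomb_left[of f M g h 1 "-1"] by simp

lemma L2_inner_diff_right:
  "f \<in> L2 M \<Longrightarrow> g \<in> L2 M \<Longrightarrow> h \<in> L2 M \<Longrightarrow>
    L2_inner M h (\<lambda>x. f x - g x) = L2_inner M h f - L2_inner M h g"
  using L2_inner_diff_left[of f M g h] by (simp add: L2_inner_commute)

lemma L2_inner_zero_left [simp]: "L2_inner M (\<lambda>x. 0) h = 0"
  by (simp add: L2_inner_def)

lemma L2_inner_sum_left:
  assumes "h \<in> L2 M" "\<And>i. i \<in> I \<Longrightarrow> f i \<in> L2 M"
  shows "L2_inner M (\<lambda>x. \<Sum>i\<in>I. f i x) h = (\<Sum>i\<in>I. L2_inner M (f i) h)"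
  using assms(2)
  by (induction I rule: infinite_finite_induct) (simp_all add: L2_inner_add_left L2_sum assms(1))

lemma L2_inner_self: "L2_inner M f f = (\<integral>x. (f x)\<^sup>2 \<partial>M)"
  by (simp add: L2_inner_def power2_eq_square)

lemma L2_inner_self_nonneg: "0 \<le> L2_inner M f f"
  unfolding L2_inner_self by simp

lemma L2_inner_self_eq_0:
  assumes "f \<in> L2 M"
  shows "L2_inner M f f = 0 \<longleftrightarrow> (AE x in M. f x = 0)"
  unfolding L2_inner_self
  by (subst integral_nonneg_eq_0_iff_AE) (use assms in \<open>auto intro: L2_integrable_square\<close>)

lemma L2_inner_cong_AE:
  assumes "f \<in> L2 M" "f' \<in> L2 M" "g \<in> L2 M" "g' \<in> L2 M"
    and "AE x in M. f x = f' x" "AE x in M. g x = g' x"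
  shows "L2_inner M f g = L2_inner M f' g'"
  unfolding L2_inner_def
  by (rule integral_cong_AE) (use assms in \<open>auto elim: AE_mp\<close>)

text \<open>The quadratic form of \<open>s * f + t * g\<close> is nonnegative. Functions are not
  identified almost everywhere, so \<open>L2_inner\<close> is only a semi-inner product and the case
  of a null \<open>g\<close> is treated directly.\<close>

lemma L2_inner_Cauchy_Schwarz:
  assumes "f \<in> L2 M" "g \<in> L2 M"
  shows "(L2_inner M f g)\<^sup>2 \<le> L2_inner M f f * L2_inner M g g"
proof -
  let ?a = "L2_inner M f f" and ?b = "L2_inner M f g" and ?c = "L2_inner M g g"
  have quad: "0 \<le> s\<^sup>2 * ?a + 2 * s * t * ?b + t\<^sup>2 * ?c" for s t
  proof -
    have "0 \<le> L2_inner M (\<lambda>x. s * f x + t * g x) (\<lambda>x. s * f x + t * g x)"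
      by (rule L2_inner_self_nonneg)
    also have "\<dots> = s\<^sup>2 * ?a + 2 * s * t * ?b + t\<^sup>2 * ?c"
      using assms
      by (simp add: L2_inner_lincomb_left L2_inner_lincomb_right L2_lincomb
          L2_inner_commute[of M g f] power2_eq_square algebra_simps)
    finally show ?thesis .
  qed
  show ?thesis
  proof (cases "?c = 0")
    case True
    have "?b = 0"
    proof (rule ccontr)
      assume "?b \<noteq> 0"
      \<comment> \<open>For \<open>?c = 0\<close> and \<open>s = 1\<close> the quadratic form is
        affine in \<open>t\<close>; this \<open>t\<close> makes its value -1.\<close>
      have "0 \<le> ?a + 2 * (- (?a + 1) / (2 * ?b)) * ?b"
        using quad[of 1 "- (?a + 1) / (2 * ?b)"] True by simp
      also have "\<dots> = -1"
        using \<open>?b \<noteq> 0\<close> by (simp add: field_simps)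
      finally show False by simp
    qed
    then show ?thesis using True by simp
  next
    case False
    then have "0 < ?c"
      using L2_inner_self_nonneg[of M g] by simp
    \<comment> \<open>Up to the common factor \<open>?c\<close>, this is the minimizer
      \<open>t = - ?b / ?c\<close> for \<open>s = 1\<close>.\<close>
    moreover have "0 \<le> ?c * (?a * ?c - ?b\<^sup>2)"
      using quad[of ?c "- ?b"] by (simp add: power2_eq_square algebra_simps)
    ultimately show ?thesis
      by (simp add: zero_le_mult_iff)
  qed
qed

section \<open>Convergence and completeness in L2\<close>

lemma tendsto_zero_if_le_lincomb:
  fixes x a b :: "nat \<Rightarrow> real"
  assumes "\<And>n. 0 \<le> x n" "\<And>n. x n \<le> C * a n + D * b n" "a \<longlonglongrightarrow> 0" "b \<longlonglongrightarrow> 0"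
  shows "x \<longlonglongrightarrow> 0"
proof (rule tendsto_sandwich[OF _ _ tendsto_const])
  have "(\<lambda>n. C * a n + D * b n) \<longlonglongrightarrow> C * 0 + D * 0"
    by (intro tendsto_intros assms)
  then show "(\<lambda>n. C * a n + D * b n) \<longlonglongrightarrow> 0" by simp
qed (use assms in auto)

text \<open>The right-hand side minus the left-hand side is
  \<open>(a + b - 2 * c)\<^sup>2\<close>.\<close>

lemma square_diff_le: "(a - b)\<^sup>2 \<le> 2 * (a - c)\<^sup>2 + 2 * (b - c)\<^sup>2" for a b c :: real
  using zero_le_power2[of "a + b - 2 * c"] by (simp add: power2_eq_square algebra_simps)

lemma L2_square_dist_le:
  assumes "f \<in> L2 M" "g \<in> L2 M" "h \<in> L2 M"
  shows "(\<integral>x. (f x - g x)\<^sup>2 \<partial>M) \<le> 2 * (\<integral>x. (f x - h x)\<^sup>2 \<partial>M) + 2 * (\<integral>x. (g x - h x)\<^sup>2 \<partial>M)"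
proof -
  have i: "integrable M (\<lambda>x. (f x - g x)\<^sup>2)" "integrable M (\<lambda>x. (f x - h x)\<^sup>2)" "integrable M (\<lambda>x. (g x - h x)\<^sup>2)"
    using assms by (auto intro!: L2_integrable_square L2_diff)
  then have "(\<integral>x. (f x - g x)\<^sup>2 \<partial>M) \<le> (\<integral>x. 2 * (f x - h x)\<^sup>2 + 2 * (g x - h x)\<^sup>2 \<partial>M)"
    by (intro integral_mono) (auto simp: square_diff_le)
  also have "\<dots> = 2 * (\<integral>x. (f x - h x)\<^sup>2 \<partial>M) + 2 * (\<integral>x. (g x - h x)\<^sup>2 \<partial>M)"
    using i by simp
  finally show ?thesis .
qed

lemma L2_tendsto_lincomb:
  assumes f: "\<And>n. f n \<in> L2 M" "f' \<in> L2 M" "(\<lambda>n. \<integral>x. (f n x - f' x)\<^sup>2 \<partial>M) \<longlonglongrightarrow> 0"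
    and g: "\<And>n. g n \<in> L2 M" "g' \<in> L2 M" "(\<lambda>n. \<integral>x. (g n x - g' x)\<^sup>2 \<partial>M) \<longlonglongrightarrow> 0"
  shows "(\<lambda>n. \<integral>x. ((a * f n x + b * g n x) - (a * f' x + b * g' x))\<^sup>2 \<partial>M) \<longlonglongrightarrow> 0"
proof (rule tendsto_zero_if_le_lincomb[OF _ _ f(3) g(3)])
  fix n
  have i: "integrable M (\<lambda>x. (f n x - f' x)\<^sup>2)" "integrable M (\<lambda>x. (g n x - g' x)\<^sup>2)"
    using f g by (auto intro!: L2_integrable_square L2_diff)
  have "(\<integral>x. ((a * f n x + b * g n x) - (a * f' x + b * g' x))\<^sup>2 \<partial>M)
      \<le> (\<integral>x. 2 * a\<^sup>2 * (f n x - f' x)\<^sup>2 + 2 * b\<^sup>2 * (g n x - g' x)\<^sup>2 \<partial>M)"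
  proof (rule integral_mono')
    fix x
    have "((a * f n x + b * g n x) - (a * f' x + b * g' x))\<^sup>2
        = (a * (f n x - f' x) - (- b) * (g n x - g' x))\<^sup>2"
      by (simp add: algebra_simps)
    also have "\<dots> \<le> 2 * (a * (f n x - f' x) - 0)\<^sup>2 + 2 * ((- b) * (g n x - g' x) - 0)\<^sup>2"
      by (rule square_diff_le)
    finally show "((a * f n x + b * g n x) - (a * f' x + b * g' x))\<^sup>2
        \<le> 2 * a\<^sup>2 * (f n x - f' x)\<^sup>2 + 2 * b\<^sup>2 * (g n x - g' x)\<^sup>2"
      by (simp add: power_mult_distrib)
  qed (use i in auto)
  then show "(\<integral>x. ((a * f n x + b * g n x) - (a * f' x + b * g' x))\<^sup>2 \<partial>M)
      \<le> (2 * a\<^sup>2) * (\<integral>x. (f n x - f' x)\<^sup>2 \<partial>M) + (2 * b\<^sup>2) * (\<integral>x. (g n x - g' x)\<^sup>2 \<partial>M)"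
    using i by simp
qed simp

lemma L2_tendsto_inner:
  assumes "\<And>n. f n \<in> L2 M" "g \<in> L2 M" "h \<in> L2 M"
    and lim: "(\<lambda>n. \<integral>x. (f n x - g x)\<^sup>2 \<partial>M) \<longlonglongrightarrow> 0"
  shows "(\<lambda>n. L2_inner M (f n) h) \<longlonglongrightarrow> L2_inner M g h"
proof (rule LIM_zero_cancel, rule tendsto_rabs_zero_cancel, rule real_tendsto_sandwich)
  show "\<forall>\<^sub>F n in sequentially. 0 \<le> \<bar>L2_inner M (f n) h - L2_inner M g h\<bar>"
    by simp
  have "\<bar>L2_inner M (f n) h - L2_inner M g h\<bar>
      \<le> sqrt ((\<integral>x. (f n x - g x)\<^sup>2 \<partial>M) * L2_inner M h h)" for n
  proof (rule real_le_rsqrt)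
    have "(L2_inner M (f n) h - L2_inner M g h)\<^sup>2 = (L2_inner M (\<lambda>x. f n x - g x) h)\<^sup>2"
      using assms by (simp add: L2_inner_diff_left)
    also have "\<dots> \<le> (\<integral>x. (f n x - g x)\<^sup>2 \<partial>M) * L2_inner M h h"
      unfolding L2_inner_self[symmetric] using assms by (intro L2_inner_Cauchy_Schwarz L2_diff) auto
    finally show "\<bar>L2_inner M (f n) h - L2_inner M g h\<bar>\<^sup>2
        \<le> (\<integral>x. (f n x - g x)\<^sup>2 \<partial>M) * L2_inner M h h"
      by simp
  qed
  then show "\<forall>\<^sub>F n in sequentially. \<bar>L2_inner M (f n) h - L2_inner M g h\<bar>
      \<le> sqrt ((\<integral>x. (f n x - g x)\<^sup>2 \<partial>M) * L2_inner M h h)"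
    by simp
  have "(\<lambda>n. sqrt ((\<integral>x. (f n x - g x)\<^sup>2 \<partial>M) * L2_inner M h h)) \<longlonglongrightarrow> sqrt (0 * L2_inner M h h)"
    by (intro tendsto_intros lim)
  then show "(\<lambda>n. sqrt ((\<integral>x. (f n x - g x)\<^sup>2 \<partial>M) * L2_inner M h h)) \<longlonglongrightarrow> 0"
    by simp
qed simp

lemma (in finite_measure) L2_integrable:
  assumes "f \<in> L2 M"
  shows "integrable M f"
  using L2_integrable_mult[OF assms L2_const[of 1]] by simp

lemma (in prob_space) L2_abs_integral_le:
  assumes "f \<in> L2 M"
  shows "(\<integral>x. \<bar>f x\<bar> \<partial>M)\<^sup>2 \<le> (\<integral>x. (f x)\<^sup>2 \<partial>M)"
proof -
  have a: "(\<lambda>x. \<bar>f x\<bar>) \<in> L2 M"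
    using assms by (auto simp: L2_def)
  have "(L2_inner M (\<lambda>x. \<bar>f x\<bar>) (\<lambda>x. 1))\<^sup>2 \<le> L2_inner M (\<lambda>x. \<bar>f x\<bar>) (\<lambda>x. \<bar>f x\<bar>) * L2_inner M (\<lambda>x. 1) (\<lambda>x. 1)"
    by (rule L2_inner_Cauchy_Schwarz[OF a]) simp
  then show ?thesis
    by (simp add: L2_inner_def prob_space power2_eq_square)
qed

text \<open>On a probability space the L1 norm is at most the L2 norm, so a subsequence converges
  almost everywhere; Fatou's lemma along that subsequence carries the L2 Cauchy estimate over to the
  limit.\<close>

lemma (in prob_space) L2_complete:
  assumes f: "\<And>n. f n \<in> L2 M"
    and Cauchy: "\<And>e. e > 0 \<Longrightarrow> \<exists>N. \<forall>m\<ge>N. \<forall>n\<ge>N. (\<integral>x. (f m x - f n x)\<^sup>2 \<partial>M) < e"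
  shows "\<exists>g\<in>L2 M. (\<lambda>n. \<integral>x. (f n x - g x)\<^sup>2 \<partial>M) \<longlonglongrightarrow> 0"
proof -
  have [measurable]: "f n \<in> borel_measurable M" for n
    using f by (rule L2_measurable)
  have i: "integrable M (\<lambda>x. (f m x - f n x)\<^sup>2)" for m n
    by (intro L2_integrable_square L2_diff f)
  have C1: "\<exists>N. \<forall>m\<ge>N. \<forall>n\<ge>N. (\<integral>x. norm (f m x - f n x) \<partial>M) < e" if "e > 0" for e
  proof -
    from that have "e\<^sup>2 > 0" by simp
    from Cauchy[OF this] obtain N where N: "\<And>m n. m \<ge> N \<Longrightarrow> n \<ge> N \<Longrightarrow> (\<integral>x. (f m x - f n x)\<^sup>2 \<partial>M) < e\<^sup>2"
      by blast
    show ?thesis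
    proof (intro exI[of _ N] allI impI)
      fix m n assume "N \<le> m" "N \<le> n"
      have "(\<integral>x. \<bar>f m x - f n x\<bar> \<partial>M)\<^sup>2 < e\<^sup>2"
        using L2_abs_integral_le[OF L2_diff[OF f f], of m n] N[OF \<open>N \<le> m\<close> \<open>N \<le> n\<close>] by simp
      then show "(\<integral>x. norm (f m x - f n x) \<partial>M) < e"
        using that by (auto intro: power2_less_imp_less)
    qed
  qed
  obtain r :: "nat \<Rightarrow> nat" where r: "strict_mono r" and ae: "AE x in M. Cauchy (\<lambda>i. f (r i) x)"
    using cauchy_L1_AE_cauchy_subseq[OF L2_integrable[OF f] C1] by metis
  define g where "g = (\<lambda>x. lim (\<lambda>i. f (r i) x))"
  have [measurable]: "g \<in> borel_measurable M"
    unfolding g_def by measurable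
  have lim: "AE x in M. (\<lambda>i. f (r i) x) \<longlonglongrightarrow> g x"
    using ae by eventually_elim (simp add: g_def Cauchy_convergent convergent_LIMSEQ_iff[symmetric])
  have fatou: "(\<integral>\<^sup>+x. ennreal ((f n x - g x)\<^sup>2) \<partial>M) \<le> ennreal e"
    if "e > 0" "\<And>m n. m \<ge> N \<Longrightarrow> n \<ge> N \<Longrightarrow> (\<integral>x. (f m x - f n x)\<^sup>2 \<partial>M) < e" "n \<ge> N" for e N n
  proof -
    have "(\<integral>\<^sup>+x. ennreal ((f n x - g x)\<^sup>2) \<partial>M) = (\<integral>\<^sup>+x. liminf (\<lambda>i. ennreal ((f n x - f (r i) x)\<^sup>2)) \<partial>M)"
    proof (rule nn_integral_cong_AE)
      show "AE x in M. ennreal ((f n x - g x)\<^sup>2) = liminf (\<lambda>i. ennreal ((f n x - f (r i) x)\<^sup>2))"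
        using lim
      proof eventually_elim
        case (elim x)
        then have "(\<lambda>i. ennreal ((f n x - f (r i) x)\<^sup>2)) \<longlonglongrightarrow> ennreal ((f n x - g x)\<^sup>2)"
          by (intro tendsto_intros)
        then show ?case
          by (rule lim_imp_Liminf[OF trivial_limit_sequentially, symmetric])
      qed
    qed
    also have "\<dots> \<le> liminf (\<lambda>i. \<integral>\<^sup>+x. ennreal ((f n x - f (r i) x)\<^sup>2) \<partial>M)"
      by (rule nn_integral_liminf) simp
    also have "\<dots> \<le> limsup (\<lambda>i. \<integral>\<^sup>+x. ennreal ((f n x - f (r i) x)\<^sup>2) \<partial>M)"
      by (rule Liminf_le_Limsup) simp
    also have "\<dots> \<le> ennreal e"
    proof (rule Limsup_bounded, rule eventually_sequentiallyI)
      fix k assume "N \<le> k"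
      then have "N \<le> r k"
        using seq_suble[OF r, of k] by simp
      then show "(\<integral>\<^sup>+x. ennreal ((f n x - f (r k) x)\<^sup>2) \<partial>M) \<le> ennreal e"
        using that(2)[OF \<open>n \<ge> N\<close>, of "r k"] by (subst nn_integral_eq_integral[OF i]) (auto intro: ennreal_leI)
    qed
    finally show ?thesis .
  qed
  have diff: "integrable M (\<lambda>x. (f n x - g x)\<^sup>2) \<and> (\<integral>x. (f n x - g x)\<^sup>2 \<partial>M) \<le> e"
    if "e > 0" "\<And>m n. m \<ge> N \<Longrightarrow> n \<ge> N \<Longrightarrow> (\<integral>x. (f m x - f n x)\<^sup>2 \<partial>M) < e" "n \<ge> N" for e N n
  proof
    show int: "integrable M (\<lambda>x. (f n x - g x)\<^sup>2)"
      by (rule integrableI_bounded)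
        (use fatou[OF that] in \<open>auto simp: le_less_trans[OF _ ennreal_less_top]\<close>)
    show "(\<integral>x. (f n x - g x)\<^sup>2 \<partial>M) \<le> e"
      using fatou[OF that] \<open>e > 0\<close> by (simp add: nn_integral_eq_integral[OF int])
  qed
  obtain N where N: "\<And>m n. m \<ge> N \<Longrightarrow> n \<ge> N \<Longrightarrow> (\<integral>x. (f m x - f n x)\<^sup>2 \<partial>M) < 1"
    using Cauchy[of 1] by auto
  have "(\<lambda>x. f N x - g x) \<in> L2 M"
    using diff[OF _ N, of N] by (simp add: L2_def)
  from L2_diff[OF f[of N] this] have gL: "g \<in> L2 M"
    by simp
  have "(\<lambda>n. \<integral>x. (f n x - g x)\<^sup>2 \<partial>M) \<longlonglongrightarrow> 0"
  proof (rule LIMSEQ_I)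
    fix e :: real assume "e > 0"
    then obtain N where N: "\<And>m n. m \<ge> N \<Longrightarrow> n \<ge> N \<Longrightarrow> (\<integral>x. (f m x - f n x)\<^sup>2 \<partial>M) < e / 2"
      using Cauchy[of "e / 2"] by auto
    show "\<exists>N. \<forall>n\<ge>N. norm ((\<integral>x. (f n x - g x)\<^sup>2 \<partial>M) - 0) < e"
    proof (intro exI[of _ N] allI impI)
      fix n assume "n \<ge> N"
      then have "(\<integral>x. (f n x - g x)\<^sup>2 \<partial>M) \<le> e / 2"
        using diff[OF _ N] \<open>e > 0\<close> by simp
      then show "norm ((\<integral>x. (f n x - g x)\<^sup>2 \<partial>M) - 0) < e"
        using \<open>e > 0\<close> by simp
    qed
  qed
  with gL show ?thesis by blast
qed

text \<open>The induction rule for nonnegative measurable functions knows no bounds, so boundedness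
  is put into the predicate. It is inherited downwards: a summand is at most the sum, and a member
  of an increasing sequence at most the limit. Signed functions are split into positive and negative
  part.\<close>

lemma bounded_borel_induct [consumes 2, case_names set lincomb seq]:
  fixes P :: "('b::topological_space \<Rightarrow> real) \<Rightarrow> bool"
  assumes g: "g \<in> borel_measurable borel" "\<And>t. \<bar>g t\<bar> \<le> K"
    and set: "\<And>A. A \<in> sets borel \<Longrightarrow> P (indicator A)"
    and lincomb: "\<And>f h a b C. f \<in> borel_measurable borel \<Longrightarrow> h \<in> borel_measurable borel \<Longrightarrow>
      (\<And>t. \<bar>f t\<bar> \<le> C) \<Longrightarrow> (\<And>t. \<bar>h t\<bar> \<le> C) \<Longrightarrow> P f \<Longrightarrow> P h \<Longrightarrow> P (\<lambda>t. a * f t + b * h t)"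
    and seq: "\<And>U f C. (\<And>i. U i \<in> borel_measurable borel) \<Longrightarrow> f \<in> borel_measurable borel \<Longrightarrow>
      (\<And>i t. \<bar>U i t\<bar> \<le> C) \<Longrightarrow> (\<And>t. \<bar>f t\<bar> \<le> C) \<Longrightarrow> (\<And>t. (\<lambda>i. U i t) \<longlonglongrightarrow> f t) \<Longrightarrow>
      (\<And>i. P (U i)) \<Longrightarrow> P f"
  shows "P g"
proof -
  have zero: "P (\<lambda>t. 0)"
    using set[of "{}"] by (simp add: indicator_def[abs_def])
  have pos: "(\<exists>C. \<forall>t. \<bar>f t\<bar> \<le> C) \<longrightarrow> P f" if "f \<in> borel_measurable borel" "\<And>t. 0 \<le> f t" for f
    using that
  proof (induction f rule: borel_measurable_induct_real)
    case (set A)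
    then show ?case using assms(3) by simp
  next
    case (mult u c)
    show ?case
    \<comment> \<open>For \<open>c = 0\<close> a bound on \<open>c * u\<close> gives none on
      \<open>u\<close>, so the induction hypothesis cannot be used.\<close>
    proof (cases "c = 0")
      case True
      then show ?thesis using zero by simp
    next
      case False
      then have "c > 0" using mult by simp
      show ?thesis
      proof
        assume "\<exists>C. \<forall>t. \<bar>c * u t\<bar> \<le> C"
        then obtain C where "\<And>t. \<bar>c * u t\<bar> \<le> C" by auto
        then have b: "\<bar>u t\<bar> \<le> C / c" for t
          using \<open>c > 0\<close> by (simp add: field_simps abs_mult)
        then have "P u" using mult.IH by blast
        then have "P (\<lambda>t. c * u t + 0 * u t)"
          using mult b by (intro lincomb)
        then show "P (\<lambda>x. c * u x)" by simp
      qed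
    qed
  next
    case (add u v)
    show ?case
    proof
      assume "\<exists>C. \<forall>t. \<bar>v t + u t\<bar> \<le> C"
      then obtain C where C: "\<And>t. \<bar>v t + u t\<bar> \<le> C" by auto
      have b: "\<bar>u t\<bar> \<le> C" "\<bar>v t\<bar> \<le> C" for t
        using C[of t] add(2,5)[of t] by auto
      then have "P u" "P v" using add.IH by blast+
      then have "P (\<lambda>t. 1 * v t + 1 * u t)"
        using add b by (intro lincomb)
      then show "P (\<lambda>x. v x + u x)" by simp
    qed
  next
    case (seq U)
    show ?case
    proof
      assume "\<exists>C. \<forall>t. \<bar>f t\<bar> \<le> C"
      then obtain C where C: "\<And>t. \<bar>f t\<bar> \<le> C" by auto
      have b: "\<bar>U i t\<bar> \<le> C" for i t
      proof -
        have "U i t \<le> f t"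
          by (rule incseq_le) (use seq in \<open>auto simp: incseq_def le_fun_def\<close>)
        then show ?thesis using C[of t] seq(2)[of i t] by simp
      qed
      then have "P (U i)" for i
        using seq.IH by blast
      then show "P f"
        using seq b C borel_measurable_LIMSEQ_real[of borel U f] by (intro assms(5)[of U f C]) auto
    qed
  qed
  have b: "\<bar>max (g t) 0\<bar> \<le> K" "\<bar>max (- g t) 0\<bar> \<le> K" for t
    using g(2)[of t] by auto
  have "P (\<lambda>t. max (g t) 0)" "P (\<lambda>t. max (- g t) 0)"
    using pos[of "\<lambda>t. max (g t) 0"] pos[of "\<lambda>t. max (- g t) 0"] g(1) b by auto
  then have "P (\<lambda>t. 1 * max (g t) 0 + (- 1) * max (- g t) 0)"
    using g(1) b by (intro lincomb) auto
  moreover have "(\<lambda>t. 1 * max (g t) 0 + (- 1) * max (- g t) 0) = g"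
    by (auto simp: max_def)
  ultimately show ?thesis by simp
qed

section \<open>Integration against a projection-valued measure\<close>

text \<open>The functionals \<open>k \<mapsto> \<integral> k d\<nu>\<close> on bounded Borel functions; they replace finite signed
  measures \<open>\<nu>\<close>, such as \<open>B \<mapsto> \<langle>E B f, h\<rangle>\<close>.\<close>

definition sigma_linear :: "(('b::topological_space \<Rightarrow> real) \<Rightarrow> real) \<Rightarrow> bool" where
  "sigma_linear \<Phi> \<longleftrightarrow>
     (\<forall>f h a b C. f \<in> borel_measurable borel \<longrightarrow> h \<in> borel_measurable borel \<longrightarrow>
        (\<forall>t. \<bar>f t\<bar> \<le> C) \<longrightarrow> (\<forall>t. \<bar>h t\<bar> \<le> C) \<longrightarrow> \<Phi> (\<lambda>t. a * f t + b * h t) = a * \<Phi> f + b * \<Phi> h) \<and>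
     (\<forall>U f C. (\<forall>i. U i \<in> borel_measurable borel) \<longrightarrow> f \<in> borel_measurable borel \<longrightarrow>
        (\<forall>i t. \<bar>U i t\<bar> \<le> C) \<longrightarrow> (\<forall>t. \<bar>f t\<bar> \<le> C) \<longrightarrow> (\<forall>t. (\<lambda>i. U i t) \<longlonglongrightarrow> f t) \<longrightarrow>
        (\<lambda>i. \<Phi> (U i)) \<longlonglongrightarrow> \<Phi> f)"

lemma sigma_linearI:
  assumes "\<And>f h a b C. f \<in> borel_measurable borel \<Longrightarrow> h \<in> borel_measurable borel \<Longrightarrow>
      (\<And>t. \<bar>f t\<bar> \<le> C) \<Longrightarrow> (\<And>t. \<bar>h t\<bar> \<le> C) \<Longrightarrow> \<Phi> (\<lambda>t. a * f t + b * h t) = a * \<Phi> f + b * \<Phi> h"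
    and "\<And>U f C. (\<And>i. U i \<in> borel_measurable borel) \<Longrightarrow> f \<in> borel_measurable borel \<Longrightarrow>
      (\<And>i t. \<bar>U i t\<bar> \<le> C) \<Longrightarrow> (\<And>t. \<bar>f t\<bar> \<le> C) \<Longrightarrow> (\<And>t. (\<lambda>i. U i t) \<longlonglongrightarrow> f t) \<Longrightarrow>
      (\<lambda>i. \<Phi> (U i)) \<longlonglongrightarrow> \<Phi> f"
  shows "sigma_linear \<Phi>"
  unfolding sigma_linear_def
proof (intro conjI allI impI, goal_cases)
  case (1 f h a b C)
  then show ?case by (intro assms(1)) auto
next
  case (2 U f C)
  then show ?case by (intro assms(2)) auto
qed

lemma sigma_linear_lincomb:
  assumes "sigma_linear \<Phi>" "f \<in> borel_measurable borel" "h \<in> borel_measurable borel"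
    "\<And>t. \<bar>f t\<bar> \<le> C" "\<And>t. \<bar>h t\<bar> \<le> D"
  shows "\<Phi> (\<lambda>t. a * f t + b * h t) = a * \<Phi> f + b * \<Phi> h"
proof -
  have "\<bar>f t\<bar> \<le> max C D" "\<bar>h t\<bar> \<le> max C D" for t
    using assms(4,5)[of t] by auto
  then show ?thesis
    using assms(1-3) unfolding sigma_linear_def by blast
qed

lemma sigma_linear_tendsto:
  assumes "sigma_linear \<Phi>" "\<And>i. U i \<in> borel_measurable borel" "f \<in> borel_measurable borel"
    "\<And>i t. \<bar>U i t\<bar> \<le> C" "\<And>t. (\<lambda>i. U i t) \<longlonglongrightarrow> f t"
  shows "(\<lambda>i. \<Phi> (U i)) \<longlonglongrightarrow> \<Phi> f"
proof -
  have "\<bar>f t\<bar> \<le> C" for t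
    by (rule LIMSEQ_le_const2[OF tendsto_rabs[OF assms(5)]]) (use assms(4) in auto)
  then show ?thesis
    using assms unfolding sigma_linear_def by blast
qed

text \<open>The counterpart of the fact that a finite signed measure is determined by its values on
  Borel sets. The identities of the functional calculus below are reduced in this way to a check on
  indicators.\<close>

lemma sigma_linear_eq:
  assumes "sigma_linear \<Phi>" "sigma_linear \<Psi>" "\<And>B. B \<in> sets borel \<Longrightarrow> \<Phi> (indicator B) = \<Psi> (indicator B)"
    and "k \<in> borel_measurable borel" "\<And>t. \<bar>k t\<bar> \<le> K"
  shows "\<Phi> k = \<Psi> k"
  using assms(4,5)
proof (induction k rule: bounded_borel_induct)
  case (set A)
  then show ?case by (rule assms(3))
next
  case (lincomb f h a b C)
  then show ?case
    using sigma_linear_lincomb[OF assms(1), of f h C C a b] sigma_linear_lincomb[OF assms(2), of f h C C a b]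
    by simp
next
  case (seq U f C)
  have "(\<lambda>i. \<Phi> (U i)) \<longlonglongrightarrow> \<Phi> f" "(\<lambda>i. \<Psi> (U i)) \<longlonglongrightarrow> \<Psi> f"
    using sigma_linear_tendsto[OF assms(1) seq(1,2,3,5)] sigma_linear_tendsto[OF assms(2) seq(1,2,3,5)]
    by simp_all
  then show ?case
    using seq.IH by (auto intro: LIMSEQ_unique)
qed

lemma sigma_linear_combine:
  assumes "sigma_linear \<Phi>" "sigma_linear \<Psi>"
  shows "sigma_linear (\<lambda>k. a * \<Phi> k + b * \<Psi> k)"
proof (rule sigma_linearI)
  fix f h :: "'a \<Rightarrow> real" and c d C
  assume "f \<in> borel_measurable borel" "h \<in> borel_measurable borel" "\<And>t. \<bar>f t\<bar> \<le> C" "\<And>t. \<bar>h t\<bar> \<le> C"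
  then show "a * \<Phi> (\<lambda>t. c * f t + d * h t) + b * \<Psi> (\<lambda>t. c * f t + d * h t) =
      c * (a * \<Phi> f + b * \<Psi> f) + d * (a * \<Phi> h + b * \<Psi> h)"
    using sigma_linear_lincomb[OF assms(1), of f h C C c d] sigma_linear_lincomb[OF assms(2), of f h C C c d]
    by (simp add: algebra_simps)
next
  fix U :: "nat \<Rightarrow> 'a \<Rightarrow> real" and f C
  assume U: "\<And>i. U i \<in> borel_measurable borel" "f \<in> borel_measurable borel"
    "\<And>i t. \<bar>U i t\<bar> \<le> C" "\<And>t. (\<lambda>i. U i t) \<longlonglongrightarrow> f t"
  show "(\<lambda>i. a * \<Phi> (U i) + b * \<Psi> (U i)) \<longlonglongrightarrow> a * \<Phi> f + b * \<Psi> f"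
    using sigma_linear_tendsto[OF assms(1) U] sigma_linear_tendsto[OF assms(2) U]
    by (intro tendsto_add tendsto_mult tendsto_const)
qed

text \<open>If \<open>\<Phi>\<close> stands for a signed measure, the new functional stands for the
  same measure with density \<open>g\<close>.\<close>

lemma sigma_linear_mult:
  assumes "sigma_linear \<Phi>" and [measurable]: "g \<in> borel_measurable borel" and K: "\<And>t. \<bar>g t\<bar> \<le> K"
  shows "sigma_linear (\<lambda>k. \<Phi> (\<lambda>t. k t * g t))"
proof -
  have b: "\<bar>f t * g t\<bar> \<le> C * K" if "\<And>t. \<bar>f t\<bar> \<le> C" for f :: "'a \<Rightarrow> real" and C t
    unfolding abs_mult using that[of t] K[of t] by (intro mult_mono) auto
  show ?thesis
  proof (rule sigma_linearI)
    fix f h :: "'a \<Rightarrow> real" and a b C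
    assume [measurable]: "f \<in> borel_measurable borel" "h \<in> borel_measurable borel"
      and C: "\<And>t. \<bar>f t\<bar> \<le> C" "\<And>t. \<bar>h t\<bar> \<le> C"
    have "\<Phi> (\<lambda>t. a * (f t * g t) + b * (h t * g t)) = a * \<Phi> (\<lambda>t. f t * g t) + b * \<Phi> (\<lambda>t. h t * g t)"
      by (rule sigma_linear_lincomb[OF assms(1) _ _ b[OF C(1)] b[OF C(2)]]) auto
    then show "\<Phi> (\<lambda>t. (a * f t + b * h t) * g t) = a * \<Phi> (\<lambda>t. f t * g t) + b * \<Phi> (\<lambda>t. h t * g t)"
      by (simp add: algebra_simps)
  next
    fix U :: "nat \<Rightarrow> 'a \<Rightarrow> real" and f C
    assume [measurable]: "\<And>i. U i \<in> borel_measurable borel" "f \<in> borel_measurable borel"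
      and C: "\<And>i t. \<bar>U i t\<bar> \<le> C" and lim: "\<And>t. (\<lambda>i. U i t) \<longlonglongrightarrow> f t"
    show "(\<lambda>i. \<Phi> (\<lambda>t. U i t * g t)) \<longlonglongrightarrow> \<Phi> (\<lambda>t. f t * g t)"
    proof (rule sigma_linear_tendsto[OF assms(1), where U = "\<lambda>i t. U i t * g t"])
      show "\<bar>U i t * g t\<bar> \<le> C * K" for i t
        by (rule b[OF C])
      show "(\<lambda>i. U i t * g t) \<longlonglongrightarrow> f t * g t" for t
        by (intro tendsto_mult lim tendsto_const)
    qed auto
  qed
qed

lemma integrable_bounded_borel:
  assumes "finite_measure N" "sets N = sets borel" "k \<in> borel_measurable borel" "\<And>t. \<bar>k t\<bar> \<le> K"
  shows "integrable N (k :: 'b :: topological_space \<Rightarrow> real)"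
  by (rule finite_measure.integrable_const_bound[OF assms(1), where B = K])
    (use assms measurable_cong_sets[OF assms(2) refl] in auto)

lemma sigma_linear_integral:
  assumes N: "finite_measure N" "sets N = sets borel"
  shows "sigma_linear (\<lambda>k. \<integral>t. k t \<partial>N)"
proof (rule sigma_linearI)
  fix f h :: "'a \<Rightarrow> real" and a b C
  assume f: "f \<in> borel_measurable borel" "\<And>t. \<bar>f t\<bar> \<le> C"
    and h: "h \<in> borel_measurable borel" "\<And>t. \<bar>h t\<bar> \<le> C"
  have "integrable N f" "integrable N h"
    by (rule integrable_bounded_borel[OF N f], rule integrable_bounded_borel[OF N h])
  then show "(\<integral>t. a * f t + b * h t \<partial>N) = a * (\<integral>t. f t \<partial>N) + b * (\<integral>t. h t \<partial>N)"
    by simp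
next
  fix U :: "nat \<Rightarrow> 'a \<Rightarrow> real" and f C
  assume U: "\<And>i. U i \<in> borel_measurable borel" "f \<in> borel_measurable borel"
    and C: "\<And>i t. \<bar>U i t\<bar> \<le> C" and lim: "\<And>t. (\<lambda>i. U i t) \<longlonglongrightarrow> f t"
  show "(\<lambda>i. \<integral>t. U i t \<partial>N) \<longlonglongrightarrow> (\<integral>t. f t \<partial>N)"
  proof (rule integral_dominated_convergence)
    show "integrable N (\<lambda>_. C)"
      by (rule finite_measure.integrable_const[OF N(1)])
    show "f \<in> borel_measurable N" "U i \<in> borel_measurable N" for i
      using U measurable_cong_sets[OF N(2) refl] by auto
  qed (use C lim in auto)
qed

section \<open>Elementary properties of a projection-valued measure\<close>

locale spectral_family = prob_space M for M :: "'a measure" +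
  fixes E :: "real set \<Rightarrow> ('a \<Rightarrow> real) \<Rightarrow> 'a \<Rightarrow> real"
  assumes pvm: "projection_valued_measure M E"
begin

abbreviation \<mu> :: "('a \<Rightarrow> real) \<Rightarrow> real measure" where
  "\<mu> \<equiv> spectral_distribution M E"

text \<open>\<open>form k f h\<close> is \<open>\<integral> k d\<langle>E f, h\<rangle>\<close>, written by polarization.\<close>

definition form :: "(real \<Rightarrow> real) \<Rightarrow> ('a \<Rightarrow> real) \<Rightarrow> ('a \<Rightarrow> real) \<Rightarrow> real" where
  "form k f h = ((\<integral>t. k t \<partial>\<mu> (\<lambda>x. f x + h x)) - (\<integral>t. k t \<partial>\<mu> (\<lambda>x. f x - h x))) / 4"

lemma E_projection: "B \<in> sets borel \<Longrightarrow> orthogonal_projection M (E B)"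
  using pvm by (simp add: projection_valued_measure_def)

lemma E_L2: "B \<in> sets borel \<Longrightarrow> f \<in> L2 M \<Longrightarrow> E B f \<in> L2 M"
  using E_projection by (simp add: orthogonal_projection_def)

lemma E_symmetric:
  "B \<in> sets borel \<Longrightarrow> f \<in> L2 M \<Longrightarrow> g \<in> L2 M \<Longrightarrow> L2_inner M (E B f) g = L2_inner M f (E B g)"
  using E_projection by (simp add: orthogonal_projection_def)

lemma E_idem: "B \<in> sets borel \<Longrightarrow> f \<in> L2 M \<Longrightarrow> AE x in M. E B (E B f) x = E B f x"
  using E_projection by (simp add: orthogonal_projection_def)

lemma E_UNIV: "f \<in> L2 M \<Longrightarrow> AE x in M. E UNIV f x = f x"
  using pvm by (simp add: projection_valued_measure_def)

lemma E_inner_commute: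
  "B \<in> sets borel \<Longrightarrow> f \<in> L2 M \<Longrightarrow> g \<in> L2 M \<Longrightarrow> L2_inner M (E B f) g = L2_inner M (E B g) f"
  using E_symmetric L2_inner_commute by metis

lemma E_inner_idem:
  assumes "B \<in> sets borel" "f \<in> L2 M" "g \<in> L2 M"
  shows "L2_inner M (E B f) (E B g) = L2_inner M (E B f) g"
proof -
  have "L2_inner M (E B f) (E B g) = L2_inner M (E B (E B f)) g"
    using assms by (simp add: E_symmetric E_L2)
  also have "\<dots> = L2_inner M (E B f) g"
    using assms E_idem[OF assms(1,2)] by (intro L2_inner_cong_AE) (auto intro: E_L2)
  finally show ?thesis .
qed

lemma E_inner_lincomb:
  assumes "B \<in> sets borel" "f \<in> L2 M" "g \<in> L2 M" "h \<in> L2 M"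
  shows "L2_inner M (E B (\<lambda>x. a * f x + b * g x)) h = a * L2_inner M (E B f) h + b * L2_inner M (E B g) h"
  using assms by (simp add: E_symmetric L2_lincomb L2_inner_lincomb_left E_L2)

lemma E_inner_UNIV: "f \<in> L2 M \<Longrightarrow> g \<in> L2 M \<Longrightarrow> L2_inner M (E UNIV f) g = L2_inner M f g"
  using E_UNIV[of f] by (intro L2_inner_cong_AE) (auto intro: E_L2)

lemma E_inner_self_nonneg: "B \<in> sets borel \<Longrightarrow> f \<in> L2 M \<Longrightarrow> 0 \<le> L2_inner M (E B f) f"
  using E_inner_idem[of B f f] L2_inner_self_nonneg by metis

lemma E_inner_sums:
  assumes B: "range B \<subseteq> sets borel" "disjoint_family B" and f: "f \<in> L2 M" and h: "h \<in> L2 M"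
  shows "(\<lambda>i. L2_inner M (E (B i) f) h) sums L2_inner M (E (\<Union>i. B i) f) h"
proof -
  have Bi: "B i \<in> sets borel" for i using B by auto
  then have U: "(\<Union>i. B i) \<in> sets borel" by auto
  have "(\<lambda>n. \<integral>x. (E (\<Union>i. B i) f x - (\<Sum>i<n. E (B i) f x))\<^sup>2 \<partial>M) \<longlonglongrightarrow> 0"
    using pvm B f by (simp add: projection_valued_measure_def)
  then have "(\<lambda>n. \<integral>x. ((\<Sum>i<n. E (B i) f x) - E (\<Union>i. B i) f x)\<^sup>2 \<partial>M) \<longlonglongrightarrow> 0"
    by (simp add: power2_commute)
  then have "(\<lambda>n. L2_inner M (\<lambda>x. \<Sum>i<n. E (B i) f x) h) \<longlonglongrightarrow> L2_inner M (E (\<Union>i. B i) f) h"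
    using Bi U f h by (intro L2_tendsto_inner L2_sum E_L2) auto
  then show ?thesis
    using Bi f h by (simp add: sums_def L2_inner_sum_left E_L2)
qed

text \<open>The empty set is the disjoint union of countably many copies of itself, and a constant
  series converges only if its term is 0.\<close>

lemma E_inner_empty:
  assumes "f \<in> L2 M" "h \<in> L2 M"
  shows "L2_inner M (E {} f) h = 0"
proof -
  have "(\<lambda>i::nat. L2_inner M (E {} f) h) sums L2_inner M (E (\<Union>i::nat. {}) f) h"
    using E_inner_sums[of "\<lambda>_. {}" f h] assms by (auto simp: disjoint_family_on_def)
  then show ?thesis
    using sums_summable summable_const_iff by blast
qed

lemma E_inner_Un:
  assumes "A \<in> sets borel" "B \<in> sets borel" "A \<inter> B = {}" "f \<in> L2 M" "h \<in> L2 M"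
  shows "L2_inner M (E (A \<union> B) f) h = L2_inner M (E A f) h + L2_inner M (E B f) h"
proof -
  have "(\<lambda>i. L2_inner M (E (binaryset A B i) f) h) sums L2_inner M (E (\<Union>i. binaryset A B i) f) h"
    using assms by (intro E_inner_sums)
      (auto simp: range_binaryset_eq disjoint_family_on_def binaryset_def)
  moreover have "(\<lambda>i. L2_inner M (E (binaryset A B i) f) h) sums (L2_inner M (E A f) h + L2_inner M (E B f) h)"
    by (rule binaryset_sums) (rule E_inner_empty[OF assms(4,5)])
  ultimately show ?thesis
    by (simp add: UN_binaryset_eq sums_unique2)
qed

lemma sets_\<mu> [simp, measurable_cong]: "sets (\<mu> f) = sets borel"
  unfolding spectral_distribution_def by (metis sets.sets_measure_of_eq space_borel)

lemma space_\<mu> [simp]: "space (\<mu> f) = UNIV"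
  unfolding spectral_distribution_def by (simp add: space_measure_of)

lemma emeasure_\<mu>:
  assumes "f \<in> L2 M" "B \<in> sets borel"
  shows "emeasure (\<mu> f) B = ennreal (L2_inner M (E B f) f)"
  unfolding spectral_distribution_def
proof (rule emeasure_measure_of_sigma)
  show "sigma_algebra UNIV (sets (borel :: real measure))"
    using sets.sigma_algebra_axioms[of "borel :: real measure"] by simp
  show "positive (sets borel) (\<lambda>B. ennreal (L2_inner M (E B f) f))"
    using assms by (simp add: positive_def E_inner_empty)
  show "countably_additive (sets borel) (\<lambda>B. ennreal (L2_inner M (E B f) f))"
  proof (rule countably_additiveI)
    fix A :: "nat \<Rightarrow> real set"
    assume "range A \<subseteq> sets borel" "disjoint_family A"
    moreover from this have "0 \<le> L2_inner M (E (A i) f) f" for i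
      using E_inner_self_nonneg assms by auto
    ultimately show "(\<Sum>i. ennreal (L2_inner M (E (A i) f) f)) = ennreal (L2_inner M (E (\<Union> (range A)) f) f)"
      using assms by (intro suminf_ennreal_eq E_inner_sums) auto
  qed
qed (use assms in auto)

lemma measure_\<mu>: "f \<in> L2 M \<Longrightarrow> B \<in> sets borel \<Longrightarrow> measure (\<mu> f) B = L2_inner M (E B f) f"
  by (simp add: measure_def emeasure_\<mu> E_inner_self_nonneg)

lemma finite_\<mu>: "f \<in> L2 M \<Longrightarrow> finite_measure (\<mu> f)"
  by (rule finite_measureI) (simp add: emeasure_\<mu>)

text \<open>Orthogonality is not part of \<open>projection_valued_measure\<close>. The vector
  \<open>y = E A f\<close> is fixed by \<open>E A\<close>, so additivity and monotonicity of its
  spectral measure leave no mass on \<open>B\<close>: the squared norms of \<open>y\<close> and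
  \<open>E B y\<close> add up to at most the squared norm of \<open>y\<close>.\<close>

lemma E_inner_disjoint:
  assumes A: "A \<in> sets borel" and B: "B \<in> sets borel" and AB: "A \<inter> B = {}" and f: "f \<in> L2 M" and g: "g \<in> L2 M"
  shows "L2_inner M (E A f) (E B g) = 0"
proof -
  define y where "y = E A f"
  have y: "y \<in> L2 M" unfolding y_def by (rule E_L2[OF A f])
  have 1: "L2_inner M (E A y) y = L2_inner M y y"
    using E_idem[OF A f] y A unfolding y_def by (intro L2_inner_cong_AE) (auto intro: E_L2)
  have "L2_inner M (E (A \<union> B) y) y \<le> L2_inner M (E UNIV y) y"
    using finite_measure.finite_measure_mono[OF finite_\<mu>[OF y], of "A \<union> B" UNIV] A B y
    by (simp add: measure_\<mu>)
  then have "L2_inner M (E B y) (E B y) \<le> 0"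
    using 1 E_inner_Un[OF A B AB y y] y B by (simp add: E_inner_UNIV E_inner_idem)
  then have "L2_inner M (E B y) (E B y) = 0"
    using L2_inner_self_nonneg[of M "E B y"] by simp
  then have "(L2_inner M (E B y) g)\<^sup>2 \<le> 0"
    using L2_inner_Cauchy_Schwarz[OF E_L2[OF B y] g] by simp
  then show ?thesis
    using E_symmetric[OF B y g] by (simp add: y_def)
qed

text \<open>The weak form of \<open>E A (E B h) = E (A \<inter> B) h\<close>: both sets are split
  along \<open>A \<inter> B\<close>, and the cross terms vanish by
  \<open>E_inner_disjoint\<close>.\<close>

lemma E_inner_Int:
  assumes A: "A \<in> sets borel" and B: "B \<in> sets borel" and f: "f \<in> L2 M" and h: "h \<in> L2 M"
  shows "L2_inner M (E A f) (E B h) = L2_inner M (E (A \<inter> B) f) h"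
proof -
  have "L2_inner M (E ((A \<inter> B) \<union> (A - B)) f) (E B h)
      = L2_inner M (E (A \<inter> B) f) (E B h) + L2_inner M (E (A - B) f) (E B h)"
    using assms by (intro E_inner_Un) (auto intro: E_L2)
  also have "L2_inner M (E (A - B) f) (E B h) = 0"
    using assms by (intro E_inner_disjoint) auto
  also have "(A \<inter> B) \<union> (A - B) = A" by auto
  finally have 1: "L2_inner M (E A f) (E B h) = L2_inner M (E B h) (E (A \<inter> B) f)"
    by (simp add: L2_inner_commute)
  have "L2_inner M (E ((A \<inter> B) \<union> (B - A)) h) (E (A \<inter> B) f)
      = L2_inner M (E (A \<inter> B) h) (E (A \<inter> B) f) + L2_inner M (E (B - A) h) (E (A \<inter> B) f)"
    using assms by (intro E_inner_Un) (auto intro: E_L2)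
  also have "L2_inner M (E (B - A) h) (E (A \<inter> B) f) = 0"
    using assms by (intro E_inner_disjoint) auto
  also have "(A \<inter> B) \<union> (B - A) = B" by auto
  finally have "L2_inner M (E B h) (E (A \<inter> B) f) = L2_inner M (E (A \<inter> B) h) (E (A \<inter> B) f)" by simp
  also have "\<dots> = L2_inner M (E (A \<inter> B) h) f"
    using assms by (intro E_inner_idem) auto
  also have "\<dots> = L2_inner M (E (A \<inter> B) f) h"
    using assms by (intro E_inner_commute) auto
  finally show ?thesis using 1 by simp
qed

section \<open>The bilinear forms of bounded Borel functions\<close>

lemma sigma_linear_\<mu>: "f \<in> L2 M \<Longrightarrow> sigma_linear (\<lambda>k. \<integral>t. k t \<partial>\<mu> f)"
  by (intro sigma_linear_integral finite_\<mu>) simp_all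

lemma integrable_\<mu>:
  fixes k :: "real \<Rightarrow> real"
  shows "f \<in> L2 M \<Longrightarrow> k \<in> borel_measurable borel \<Longrightarrow> (\<And>t. \<bar>k t\<bar> \<le> K) \<Longrightarrow> integrable (\<mu> f) k"
  by (rule integrable_bounded_borel[OF finite_\<mu>]) simp_all

lemma integral_\<mu>_indicator: "f \<in> L2 M \<Longrightarrow> B \<in> sets borel \<Longrightarrow> (\<integral>t. indicator B t \<partial>\<mu> f) = L2_inner M (E B f) f"
  by (simp add: measure_\<mu>)

lemma E_inner_quadratic:
  assumes "f \<in> L2 M" "h \<in> L2 M" "B \<in> sets borel"
  shows "L2_inner M (E B (\<lambda>x. a * f x + b * h x)) (\<lambda>x. a * f x + b * h x)
    = a\<^sup>2 * L2_inner M (E B f) f + 2 * a * b * L2_inner M (E B f) h + b\<^sup>2 * L2_inner M (E B h) h"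
  using assms
  by (simp add: E_inner_lincomb L2_inner_lincomb_right L2_lincomb E_L2 E_inner_commute[of B h f]
      power2_eq_square algebra_simps)

text \<open>Polarization: in the difference of the two quadratic expansions the square terms cancel,
  and the mixed term survives with the factor 4.\<close>

lemma form_indicator:
  assumes "f \<in> L2 M" "h \<in> L2 M" "B \<in> sets borel"
  shows "form (indicator B) f h = L2_inner M (E B f) h"
  using E_inner_quadratic[OF assms, of 1 1] E_inner_quadratic[OF assms, of 1 "-1"] assms
  by (simp add: form_def measure_\<mu> L2_add L2_diff)

lemma sigma_linear_form:
  assumes "f \<in> L2 M" "h \<in> L2 M"
  shows "sigma_linear (\<lambda>k. form k f h)"
  using sigma_linear_combine[OF sigma_linear_\<mu>[OF L2_add[OF assms]] sigma_linear_\<mu>[OF L2_diff[OF assms]],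
      of "1/4" "-1/4"]
  by (simp add: form_def diff_divide_distrib)

context
  fixes k :: "real \<Rightarrow> real" and K :: real
  assumes k: "k \<in> borel_measurable borel" "\<And>t. \<bar>k t\<bar> \<le> K"
begin

lemma form_commute:
  assumes "f \<in> L2 M" "h \<in> L2 M"
  shows "form k f h = form k h f"
  using sigma_linear_form[of f h] sigma_linear_form[of h f] _ k
  by (rule sigma_linear_eq) (use assms in \<open>auto simp: form_indicator E_inner_commute\<close>)

lemma form_self:
  assumes "f \<in> L2 M"
  shows "form k f f = (\<integral>t. k t \<partial>\<mu> f)"
  using sigma_linear_form[of f f] sigma_linear_\<mu>[of f] _ k
  by (rule sigma_linear_eq) (use assms in \<open>auto simp: form_indicator measure_\<mu>\<close>)

text \<open>For \<open>k\<close> the indicator of \<open>A\<close>, both sides are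
  \<open>L2_inner M (E (A \<inter> B) f) h\<close>. Applying a projection to the test function thus
  restricts the spectral measure to \<open>B\<close>.\<close>

lemma form_E:
  assumes "f \<in> L2 M" "h \<in> L2 M" "B \<in> sets borel"
  shows "form k f (E B h) = form (\<lambda>t. k t * indicator B t) f h"
  using sigma_linear_form[of f "E B h"]
    sigma_linear_mult[OF sigma_linear_form[of f h], of "indicator B" 1] _ k
  by (rule sigma_linear_eq)
    (use assms in \<open>auto simp: form_indicator E_L2 E_inner_Int indicator_inter_arith[symmetric]\<close>)

end

text \<open>For bounded \<open>g\<close>, \<open>represents g f w\<close> says that \<open>w\<close> is \<open>\<integral> g dE\<close> applied to \<open>f\<close>.\<close>

definition represents :: "(real \<Rightarrow> real) \<Rightarrow> ('a \<Rightarrow> real) \<Rightarrow> ('a \<Rightarrow> real) \<Rightarrow> bool" where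
  "represents g f w \<longleftrightarrow> w \<in> L2 M \<and> (\<forall>h\<in>L2 M. L2_inner M w h = form g f h)"

section \<open>Bounded functional calculus\<close>

lemma represents_L2: "represents g f w \<Longrightarrow> w \<in> L2 M"
  by (simp add: represents_def)

lemma represents_indicator: "f \<in> L2 M \<Longrightarrow> B \<in> sets borel \<Longrightarrow> represents (indicator B) f (E B f)"
  by (simp add: represents_def E_L2 form_indicator)

lemma represents_lincomb:
  assumes f: "f \<in> L2 M" and "g \<in> borel_measurable borel" "h \<in> borel_measurable borel"
    "\<And>t. \<bar>g t\<bar> \<le> C" "\<And>t. \<bar>h t\<bar> \<le> D" and v: "represents g f v" and w: "represents h f w"
  shows "represents (\<lambda>t. a * g t + b * h t) f (\<lambda>x. a * v x + b * w x)"
  using v w sigma_linear_lincomb[OF sigma_linear_form[OF f] assms(2-5)]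
  by (auto simp: represents_def L2_lincomb L2_inner_lincomb_left)

context
  fixes g :: "real \<Rightarrow> real" and K :: real
  assumes g [measurable]: "g \<in> borel_measurable borel" and gK: "\<And>t. \<bar>g t\<bar> \<le> K"
begin

text \<open>Multiplicativity of the calculus in weak form. For the indicator of \<open>B\<close>,
  symmetry moves \<open>E B\<close> from \<open>w\<close> onto \<open>h\<close>, where
  \<open>represents\<close> applies, and \<open>form_E\<close> then moves it into the
  integrand.\<close>

lemma form_represents:
  assumes w: "represents g f w" and f: "f \<in> L2 M" and h: "h \<in> L2 M"
    and k: "k \<in> borel_measurable borel" "\<And>t. \<bar>k t\<bar> \<le> C"
  shows "form k w h = form (\<lambda>t. k t * g t) f h"
  using sigma_linear_form[OF represents_L2[OF w] h] sigma_linear_mult[OF sigma_linear_form[OF f h] g gK] _ k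
proof (rule sigma_linear_eq)
  fix B :: "real set" assume B: "B \<in> sets borel"
  have "form (indicator B) w h = L2_inner M w (E B h)"
    using w h B by (simp add: form_indicator E_symmetric represents_L2)
  also have "\<dots> = form g f (E B h)"
    using w E_L2[OF B h] by (simp add: represents_def)
  also have "\<dots> = form (\<lambda>t. g t * indicator B t) f h"
    by (rule form_E[OF g gK f h B])
  finally show "form (indicator B) w h = form (\<lambda>t. indicator B t * g t) f h"
    by (simp add: mult.commute)
qed

text \<open>Both arguments of \<open>form k w w\<close> are replaced by \<open>f\<close>, one after
  the other, and \<open>form_commute\<close> brings the second one into first position. Each
  replacement contributes a factor \<open>g\<close>.\<close>

lemma integral_\<mu>_represents:
  assumes w: "represents g f w" and f: "f \<in> L2 M"
    and k [measurable]: "k \<in> borel_measurable borel" and kC: "\<And>t. \<bar>k t\<bar> \<le> C"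
  shows "(\<integral>t. k t \<partial>\<mu> w) = (\<integral>t. k t * (g t)\<^sup>2 \<partial>\<mu> f)"
proof -
  note wL = represents_L2[OF w]
  have b: "\<bar>k t * g t\<bar> \<le> C * K" for t
    unfolding abs_mult using kC[of t] gK[of t] by (intro mult_mono) auto
  have b2: "\<bar>k t * g t * g t\<bar> \<le> C * K * K" for t
    unfolding abs_mult[of "k t * g t"] using b[of t] gK[of t] by (intro mult_mono) auto
  have "(\<integral>t. k t \<partial>\<mu> w) = form k w w"
    using form_self[OF k kC wL] by simp
  also have "\<dots> = form (\<lambda>t. k t * g t) f w"
    by (rule form_represents[OF w f wL k kC])
  also have "\<dots> = form (\<lambda>t. k t * g t) w f"
    by (rule form_commute[OF _ b f wL]) simp
  also have "\<dots> = form (\<lambda>t. k t * g t * g t) f f"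
    by (rule form_represents[OF w f f _ b]) simp
  also have "\<dots> = (\<integral>t. k t * g t * g t \<partial>\<mu> f)"
    by (rule form_self[OF _ b2 f]) simp
  finally show ?thesis by (simp add: power2_eq_square mult.assoc)
qed

text \<open>The case \<open>k = 1\<close> of the preceding identity: the calculus is isometric for
  the L2 norm of \<open>\<mu> f\<close>, which turns convergence of multipliers into convergence of
  vectors.\<close>

lemma represents_norm:
  assumes w: "represents g f w" and f: "f \<in> L2 M"
  shows "L2_inner M w w = (\<integral>t. (g t)\<^sup>2 \<partial>\<mu> f)"
proof -
  have "L2_inner M w w = (\<integral>t. indicator UNIV t \<partial>\<mu> w)"
    using integral_\<mu>_indicator[of w UNIV] represents_L2[OF w] E_inner_UNIV[of w w] by simp
  also have "\<dots> = (\<integral>t. indicator UNIV t * (g t)\<^sup>2 \<partial>\<mu> f)"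
    by (rule integral_\<mu>_represents[OF w f, where C = 1]) auto
  finally show ?thesis by simp
qed

text \<open>An equality of measures, and not only of integrals of bounded functions, allows
  integrability of unbounded functions against \<open>\<mu> w\<close> to be decided on
  \<open>\<mu> f\<close>.\<close>

lemma \<mu>_represents:
  assumes w: "represents g f w" and f: "f \<in> L2 M"
  shows "\<mu> w = density (\<mu> f) (\<lambda>t. ennreal ((g t)\<^sup>2))"
proof (rule measure_eqI)
  fix B assume "B \<in> sets (\<mu> w)"
  then have B [measurable]: "B \<in> sets borel" by simp
  interpret W: finite_measure "\<mu> w" by (rule finite_\<mu>[OF represents_L2[OF w]])
  have b: "\<bar>indicator B t * (g t)\<^sup>2\<bar> \<le> K\<^sup>2" for t
    using gK[of t] by (auto simp: indicator_def abs_le_square_iff[symmetric])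
  have "emeasure (\<mu> w) B = ennreal (\<integral>t. indicator B t \<partial>\<mu> w)"
    by (simp add: W.emeasure_eq_measure)
  also have "\<dots> = ennreal (\<integral>t. indicator B t * (g t)\<^sup>2 \<partial>\<mu> f)"
    by (subst integral_\<mu>_represents[OF w f, where C = 1]) (auto simp: indicator_def)
  also have "\<dots> = (\<integral>\<^sup>+t. ennreal (indicator B t * (g t)\<^sup>2) \<partial>\<mu> f)"
    by (rule nn_integral_eq_integral[symmetric]) (auto intro!: integrable_\<mu>[OF f _ b])
  also have "\<dots> = (\<integral>\<^sup>+t. ennreal ((g t)\<^sup>2) * indicator B t \<partial>\<mu> f)"
    by (intro nn_integral_cong) (simp add: indicator_def)
  also have "\<dots> = emeasure (density (\<mu> f) (\<lambda>t. ennreal ((g t)\<^sup>2))) B"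
    by (subst emeasure_density) auto
  finally show "emeasure (\<mu> w) B = emeasure (density (\<mu> f) (\<lambda>t. ennreal ((g t)\<^sup>2))) B" .
qed simp

end

text \<open>In the limit step \<open>represents_norm\<close> identifies the distances between the
  representing vectors with the distances of the multipliers in L2 of \<open>\<mu> f\<close>. The
  vectors therefore form a Cauchy sequence, and \<open>L2_complete\<close> supplies the new
  vector.\<close>

lemma represents_exists:
  assumes f: "f \<in> L2 M" and "g \<in> borel_measurable borel" "\<And>t. \<bar>g t\<bar> \<le> K"
  shows "\<exists>w. represents g f w"
  using assms(2,3)
proof (induction g rule: bounded_borel_induct)
  case (set A)
  then show ?case using represents_indicator[OF f] by blast
next
  case (lincomb g h a b C)
  then show ?case using represents_lincomb[OF f] by blast
next
  case (seq U g C)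
  note [measurable] = seq(1,2)
  from seq.IH obtain w where w: "\<And>i. represents (U i) f (w i)" by metis
  have wL: "w i \<in> L2 M" for i by (rule represents_L2[OF w])
  have b: "\<bar>1 * U m t + (-1) * U n t\<bar> \<le> 2 * C" for m n t
    using seq(3)[of m t] seq(3)[of n t] by auto
  have b': "\<bar>(U m t - g t)\<^sup>2\<bar> \<le> (2 * C)\<^sup>2" for m t
  proof -
    have "\<bar>U m t - g t\<bar> \<le> \<bar>2 * C\<bar>"
      using seq(3)[of m t] seq(4)[of t] by simp
    then show ?thesis
      by (simp only: abs_le_square_iff abs_power2)
  qed
  have dist: "(\<integral>x. (w m x - w n x)\<^sup>2 \<partial>M) = (\<integral>t. (U m t - U n t)\<^sup>2 \<partial>\<mu> f)" for m n
    using represents_norm[OF _ b represents_lincomb[OF f seq(1) seq(1) seq(3) seq(3) w w, of 1 m "-1" n] f]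
    by (simp add: L2_inner_self)
  have lim0: "(\<lambda>n. \<integral>t. (U n t - g t)\<^sup>2 \<partial>\<mu> f) \<longlonglongrightarrow> 0"
  proof -
    have "(\<lambda>n. \<integral>t. (U n t - g t)\<^sup>2 \<partial>\<mu> f) \<longlonglongrightarrow> (\<integral>t. 0 \<partial>\<mu> f)"
    proof (rule sigma_linear_tendsto[OF sigma_linear_\<mu>[OF f] _ _ b'])
      show "(\<lambda>i. (U i t - g t)\<^sup>2) \<longlonglongrightarrow> 0" for t
        using tendsto_power[OF LIM_zero[OF seq(5)[of t]], of 2] by simp
    qed auto
    then show ?thesis by simp
  qed
  have "\<exists>v\<in>L2 M. (\<lambda>n. \<integral>x. (w n x - v x)\<^sup>2 \<partial>M) \<longlonglongrightarrow> 0"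
  proof (rule L2_complete[OF wL])
    fix e :: real assume "e > 0"
    then have "\<forall>\<^sub>F n in sequentially. (\<integral>t. (U n t - g t)\<^sup>2 \<partial>\<mu> f) < e / 4"
      using lim0 by (intro order_tendstoD) auto
    then obtain N where N: "\<And>n. n \<ge> N \<Longrightarrow> (\<integral>t. (U n t - g t)\<^sup>2 \<partial>\<mu> f) < e / 4"
      by (auto simp: eventually_sequentially)
    show "\<exists>N. \<forall>m\<ge>N. \<forall>n\<ge>N. (\<integral>x. (w m x - w n x)\<^sup>2 \<partial>M) < e"
    proof (intro exI allI impI)
      fix m n assume "m \<ge> N" "n \<ge> N"
      have L: "U i \<in> L2 (\<mu> f)" "g \<in> L2 (\<mu> f)" for i
      proof -
        have "(U i t)\<^sup>2 \<le> C\<^sup>2" "(g t)\<^sup>2 \<le> C\<^sup>2" for t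
          using seq(3)[of i t] seq(4)[of t] by (auto simp: abs_le_square_iff[symmetric])
        then show "U i \<in> L2 (\<mu> f)" "g \<in> L2 (\<mu> f)"
          by (auto simp: L2_def intro!: integrable_\<mu>[OF f, where K = "C\<^sup>2"])
      qed
      show "(\<integral>x. (w m x - w n x)\<^sup>2 \<partial>M) < e"
        unfolding dist using L2_square_dist_le[OF L(1)[of m] L(1)[of n] L(2)] N[OF \<open>m \<ge> N\<close>] N[OF \<open>n \<ge> N\<close>]
        by simp
    qed
  qed
  then obtain v where v: "v \<in> L2 M" and lim: "(\<lambda>n. \<integral>x. (w n x - v x)\<^sup>2 \<partial>M) \<longlonglongrightarrow> 0"
    by blast
  have "L2_inner M v h = form g f h" if h: "h \<in> L2 M" for h
  proof (rule LIMSEQ_unique)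
    show "(\<lambda>n. L2_inner M (w n) h) \<longlonglongrightarrow> L2_inner M v h"
      by (rule L2_tendsto_inner[OF wL v h lim])
    have "(\<lambda>n. form (U n) f h) \<longlonglongrightarrow> form g f h"
      by (rule sigma_linear_tendsto[OF sigma_linear_form[OF f h] seq(1,2,3,5)])
    then show "(\<lambda>n. L2_inner M (w n) h) \<longlonglongrightarrow> form g f h"
      using w h by (simp add: represents_def)
  qed
  then show ?case
    using v by (auto simp: represents_def)
qed

end

section \<open>Weak limits and unbounded functions of the operator\<close>

lemma L2_inner_abs_le:
  assumes "f \<in> L2 M" "g \<in> L2 M"
  shows "\<bar>L2_inner M f g\<bar> \<le> sqrt (L2_inner M f f) * sqrt (L2_inner M g g)"
  unfolding real_sqrt_mult[symmetric]
  by (rule real_le_rsqrt) (use L2_inner_Cauchy_Schwarz[OF assms] in simp)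

text \<open>The norm bound makes the functionals \<open>L2_inner M (S n)\<close> equicontinuous, so
  convergence on the approximants \<open>hk k\<close> passes to \<open>h\<close>.\<close>

lemma L2_weak_limit_of_dense:
  assumes S: "\<And>n. S n \<in> L2 M" and SC: "\<And>n. L2_inner M (S n) (S n) \<le> C"
    and v: "v \<in> L2 M" and h: "h \<in> L2 M" and hk: "\<And>k. hk k \<in> L2 M"
    and dense: "(\<lambda>k. \<integral>x. (hk k x - h x)\<^sup>2 \<partial>M) \<longlonglongrightarrow> 0"
    and weak: "\<And>k::nat. (\<lambda>n. L2_inner M (S n) (hk k)) \<longlonglongrightarrow> L2_inner M v (hk k)"
  shows "(\<lambda>n. L2_inner M (S n) h) \<longlonglongrightarrow> L2_inner M v h"
proof (rule LIMSEQ_I)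
  fix e :: real assume e: "e > 0"
  \<comment> \<open>Replacing \<open>h\<close> by \<open>hk k\<close> in both pairings costs at most
    \<open>K\<close> times the distance between the two functions, uniformly in
    \<open>n\<close>.\<close>
  define K where "K = sqrt C + sqrt (L2_inner M v v)"
  have "C \<ge> 0"
    using SC[of 0] L2_inner_self_nonneg[of M "S 0"] by simp
  then have K: "K \<ge> 0"
    unfolding K_def using L2_inner_self_nonneg[of M v] by simp
  have "(\<lambda>k. K * sqrt (\<integral>x. (hk k x - h x)\<^sup>2 \<partial>M)) \<longlonglongrightarrow> K * sqrt 0"
    by (intro tendsto_intros dense)
  then have "\<forall>\<^sub>F k in sequentially. K * sqrt (\<integral>x. (hk k x - h x)\<^sup>2 \<partial>M) < e / 2"
    using e by (intro order_tendstoD) auto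
  then obtain k where k: "K * sqrt (\<integral>x. (hk k x - h x)\<^sup>2 \<partial>M) < e / 2"
    by (auto simp: eventually_sequentially)
  obtain N where N: "\<And>n. n \<ge> N \<Longrightarrow> \<bar>L2_inner M (S n) (hk k) - L2_inner M v (hk k)\<bar> < e / 2"
    using LIMSEQ_D[OF weak[of k], of "e / 2"] e by auto
  let ?d = "\<lambda>x. hk k x - h x"
  have d: "?d \<in> L2 M" by (rule L2_diff[OF hk h])
  show "\<exists>N. \<forall>n\<ge>N. norm (L2_inner M (S n) h - L2_inner M v h) < e"
  proof (intro exI[of _ N] allI impI)
    fix n assume "n \<ge> N"
    have "\<bar>L2_inner M (S n) ?d\<bar> \<le> sqrt (L2_inner M (S n) (S n)) * sqrt (L2_inner M ?d ?d)"
      by (rule L2_inner_abs_le[OF S d])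
    also have "\<dots> \<le> sqrt C * sqrt (L2_inner M ?d ?d)"
      using SC[of n] by (intro mult_right_mono) (auto simp: L2_inner_self_nonneg)
    finally have 1: "\<bar>L2_inner M (S n) ?d\<bar> \<le> sqrt C * sqrt (L2_inner M ?d ?d)" .
    have 2: "\<bar>L2_inner M v ?d\<bar> \<le> sqrt (L2_inner M v v) * sqrt (L2_inner M ?d ?d)"
      by (rule L2_inner_abs_le[OF v d])
    have "sqrt C * sqrt (L2_inner M ?d ?d) + sqrt (L2_inner M v v) * sqrt (L2_inner M ?d ?d) < e / 2"
      using k by (simp add: K_def L2_inner_self distrib_right)
    moreover have "L2_inner M (S n) h - L2_inner M v h =
        (L2_inner M (S n) (hk k) - L2_inner M v (hk k)) - L2_inner M (S n) ?d + L2_inner M v ?d"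
      using S v hk h by (simp add: L2_inner_diff_right)
    ultimately show "norm (L2_inner M (S n) h - L2_inner M v h) < e"
      using 1 2 N[OF \<open>n \<ge> N\<close>] unfolding real_norm_def by linarith
  qed
qed

context spectral_family
begin

lemma integral_\<mu>_parallelogram:
  fixes k :: "real \<Rightarrow> real"
  assumes f: "f \<in> L2 M" and h: "h \<in> L2 M"
    and k: "k \<in> borel_measurable borel" "\<And>t. \<bar>k t\<bar> \<le> K"
  shows "(\<integral>t. k t \<partial>\<mu> (\<lambda>x. f x + h x)) + (\<integral>t. k t \<partial>\<mu> (\<lambda>x. f x - h x))
    = 2 * (\<integral>t. k t \<partial>\<mu> f) + 2 * (\<integral>t. k t \<partial>\<mu> h)"
proof -
  have "1 * (\<integral>t. k t \<partial>\<mu> (\<lambda>x. f x + h x)) + 1 * (\<integral>t. k t \<partial>\<mu> (\<lambda>x. f x - h x))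
      = 2 * (\<integral>t. k t \<partial>\<mu> f) + 2 * (\<integral>t. k t \<partial>\<mu> h)"
    using sigma_linear_combine[OF sigma_linear_\<mu>[OF L2_add[OF f h]] sigma_linear_\<mu>[OF L2_diff[OF f h]], of 1 1]
      sigma_linear_combine[OF sigma_linear_\<mu>[OF f] sigma_linear_\<mu>[OF h], of 2 2] _ k
  proof (rule sigma_linear_eq)
    fix B :: "real set" assume "B \<in> sets borel"
    then show "1 * (\<integral>t. indicat_real B t \<partial>\<mu> (\<lambda>x. f x + h x)) + 1 * (\<integral>t. indicat_real B t \<partial>\<mu> (\<lambda>x. f x - h x))
        = 2 * (\<integral>t. indicat_real B t \<partial>\<mu> f) + 2 * (\<integral>t. indicat_real B t \<partial>\<mu> h)"
      using E_inner_quadratic[OF f h, of B 1 1] E_inner_quadratic[OF f h, of B 1 "-1"] f h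
      by (simp add: measure_\<mu> L2_add L2_diff)
  qed
  then show ?thesis by simp
qed

text \<open>Needed for polarization on a spectral domain. The parallelogram identity bounds the two
  integrals but is available for bounded integrands only, hence the truncation at height
  \<open>n\<close> and monotone convergence. It controls only the sum of the integrals;
  \<open>k0\<close> lets each of them be bounded separately.\<close>

lemma integrable_\<mu>_add_diff:
  fixes k :: "real \<Rightarrow> real"
  assumes f: "f \<in> L2 M" and h: "h \<in> L2 M"
    and k [measurable]: "k \<in> borel_measurable borel" and k0: "\<And>t. 0 \<le> k t"
    and i: "integrable (\<mu> f) k" "integrable (\<mu> h) k"
  shows "integrable (\<mu> (\<lambda>x. f x + h x)) k" "integrable (\<mu> (\<lambda>x. f x - h x)) k"
proof -
  define U where "U n t = min (k t) (real n)" for n :: nat and t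
  define C where "C = 2 * (\<integral>t. k t \<partial>\<mu> f) + 2 * (\<integral>t. k t \<partial>\<mu> h)"
  have U [measurable]: "U n \<in> borel_measurable borel" for n
    unfolding U_def[abs_def] by measurable
  have Ub: "\<bar>U n t\<bar> \<le> real n" and U0: "0 \<le> U n t" and Uk: "U n t \<le> k t" for n t
    using k0[of t] by (auto simp: U_def)
  have iU: "integrable (\<mu> g) (U n)" if "g \<in> L2 M" for g n
    by (rule integrable_\<mu>[OF that U Ub])
  have UC: "(\<integral>t. U n t \<partial>\<mu> (\<lambda>x. f x + h x)) + (\<integral>t. U n t \<partial>\<mu> (\<lambda>x. f x - h x)) \<le> C" for n
  proof -
    have "(\<integral>t. U n t \<partial>\<mu> f) \<le> (\<integral>t. k t \<partial>\<mu> f)" "(\<integral>t. U n t \<partial>\<mu> h) \<le> (\<integral>t. k t \<partial>\<mu> h)"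
      using i f h by (auto intro!: integral_mono iU Uk)
    then show ?thesis
      unfolding integral_\<mu>_parallelogram[OF f h U Ub] C_def by simp
  qed
  have *: "integrable (\<mu> g) k" if g: "g \<in> L2 M" and gC: "\<And>n. (\<integral>t. U n t \<partial>\<mu> g) \<le> C" for g
  proof -
    have "incseq (\<lambda>n. \<integral>t. U n t \<partial>\<mu> g)"
      by (intro incseq_SucI integral_mono iU[OF g]) (auto simp: U_def)
    then obtain l where l: "(\<lambda>n. \<integral>t. U n t \<partial>\<mu> g) \<longlonglongrightarrow> l"
      using gC by (metis incseq_convergent)
    have lim: "(\<lambda>n. U n t) \<longlonglongrightarrow> k t" for t
    proof (rule tendsto_eventually, rule eventually_sequentiallyI)
      fix n assume "nat \<lceil>k t\<rceil> \<le> n"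
      then show "U n t = k t" unfolding U_def by linarith
    qed
    have mono: "mono (\<lambda>n. U n t)" for t
      by (rule monoI) (auto simp: U_def)
    show ?thesis
      by (rule integral_monotone_convergence_nonneg(1)[where f = U, OF iU[OF g] _ _ _ l])
        (auto simp: mono U0 lim)
  qed
  have "0 \<le> (\<integral>t. U n t \<partial>\<mu> g)" for g n
    by (simp add: U0)
  note nn = this[of "\<lambda>x. f x + h x"] this[of "\<lambda>x. f x - h x"]
  have "(\<integral>t. U n t \<partial>\<mu> (\<lambda>x. f x + h x)) \<le> C" "(\<integral>t. U n t \<partial>\<mu> (\<lambda>x. f x - h x)) \<le> C" for n
    using UC[of n] nn(1)[of n] nn(2)[of n] by linarith+
  then show "integrable (\<mu> (\<lambda>x. f x + h x)) k" "integrable (\<mu> (\<lambda>x. f x - h x)) k"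
    using * L2_add[OF f h] L2_diff[OF f h] by blast+
qed

lemma spectral_domain_L2: "f \<in> spectral_domain M E k \<Longrightarrow> f \<in> L2 M"
  by (simp add: spectral_domain_def)

lemma spectral_integral_iff:
  "spectral_integral M E k f w \<longleftrightarrow> f \<in> spectral_domain M E k \<and> w \<in> L2 M \<and>
    (\<forall>h\<in>spectral_domain M E k. L2_inner M w h = form k f h)"
  by (simp add: spectral_integral_def form_def)

text \<open>Dominated convergence in the two measures of the polarized form. The majorant
  \<open>\<bar>k t\<bar>\<close> is integrable there because its square is, by
  \<open>integrable_\<mu>_add_diff\<close>, and the measures are finite.\<close>

lemma form_tendsto:
  assumes f: "f \<in> spectral_domain M E k" and h: "h \<in> spectral_domain M E k"
    and [measurable]: "k \<in> borel_measurable borel" "\<And>n. U n \<in> borel_measurable borel"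
    and U: "\<And>n t. \<bar>U n t\<bar> \<le> \<bar>k t\<bar>" and lim: "\<And>t. (\<lambda>n. U n t) \<longlonglongrightarrow> k t"
  shows "(\<lambda>n. form (U n) f h) \<longlonglongrightarrow> form k f h"
proof -
  have L: "f \<in> L2 M" "h \<in> L2 M"
    using f h by (auto intro: spectral_domain_L2)
  have "integrable (\<mu> f) (\<lambda>t. (k t)\<^sup>2)" "integrable (\<mu> h) (\<lambda>t. (k t)\<^sup>2)"
    using f h by (auto simp: spectral_domain_def)
  note sq = integrable_\<mu>_add_diff[OF L _ _ this, simplified]
  have *: "(\<lambda>n. \<integral>t. U n t \<partial>\<mu> g) \<longlonglongrightarrow> (\<integral>t. k t \<partial>\<mu> g)"
    if "g \<in> L2 M" "integrable (\<mu> g) (\<lambda>t. (k t)\<^sup>2)" for g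
  proof (rule integral_dominated_convergence)
    have "k \<in> L2 (\<mu> g)"
      using that by (simp add: L2_def)
    then have "integrable (\<mu> g) k"
      by (rule finite_measure.L2_integrable[OF finite_\<mu>[OF that(1)]])
    then show "integrable (\<mu> g) (\<lambda>t. \<bar>k t\<bar>)" by simp
  qed (use U lim in auto)
  show ?thesis
    unfolding form_def using * sq L2_add[OF L] L2_diff[OF L] by (intro tendsto_intros) auto
qed

text \<open>The bridge from bounded to unbounded functions: applying \<open>k\<close> to the
  operator after \<open>g\<close> gives \<open>k * g\<close>. The vector \<open>p\<close> is in the
  domain because \<open>\<mu> p\<close> has density \<open>(g t)\<^sup>2\<close> with respect to
  \<open>\<mu> f\<close> and \<open>k * g\<close> is bounded.\<close>

lemma spectral_integral_of_represents:
  assumes [measurable]: "k \<in> borel_measurable borel" "g \<in> borel_measurable borel"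
    and gK: "\<And>t. \<bar>g t\<bar> \<le> K" and kgC: "\<And>t. \<bar>k t * g t\<bar> \<le> C"
    and f: "f \<in> L2 M" and p: "represents g f p" and q: "represents (\<lambda>t. k t * g t) f q"
  shows "spectral_integral M E k p q"
proof -
  have "integrable (\<mu> p) (\<lambda>t. (k t)\<^sup>2)"
  proof -
    have "\<bar>(k t * g t)\<^sup>2\<bar> \<le> C\<^sup>2" for t
    proof -
      have "\<bar>k t * g t\<bar> \<le> \<bar>C\<bar>" using kgC[of t] by simp
      then show ?thesis by (simp only: abs_le_square_iff abs_power2)
    qed
    then have "integrable (\<mu> f) (\<lambda>t. (k t * g t)\<^sup>2)"
      by (intro integrable_\<mu>[OF f]) auto
    then show ?thesis
      unfolding \<mu>_represents[OF assms(2) gK p f]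
      by (subst integrable_density) (auto simp: power_mult_distrib mult.commute)
  qed
  then have pd: "p \<in> spectral_domain M E k"
    using p by (simp add: spectral_domain_def represents_L2)
  have "L2_inner M q h = form k p h" if h: "h \<in> spectral_domain M E k" for h
  proof (rule LIMSEQ_unique)
    \<comment> \<open>\<open>form_represents\<close> applies to bounded functions only, so
      \<open>k\<close> is replaced by 0 where it exceeds \<open>n\<close> in absolute value.\<close>
    define U where "U n t = k t * indicator {t. \<bar>k t\<bar> \<le> real n} t" for n :: nat and t
    have [measurable]: "U n \<in> borel_measurable borel" for n
      unfolding U_def[abs_def] by measurable
    have lim: "(\<lambda>n. U n t) \<longlonglongrightarrow> k t" for t
    proof (rule tendsto_eventually, rule eventually_sequentiallyI)
      fix n assume "nat \<lceil>\<bar>k t\<bar>\<rceil> \<le> n"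
      then have "\<bar>k t\<bar> \<le> real n" by linarith
      then show "U n t = k t" by (simp add: U_def)
    qed
    show "(\<lambda>n. form (U n) p h) \<longlonglongrightarrow> form k p h"
    proof (rule form_tendsto[OF pd h])
      show "(\<lambda>n. U n t) \<longlonglongrightarrow> k t" for t by (rule lim)
      show "\<bar>U n t\<bar> \<le> \<bar>k t\<bar>" for n t by (simp add: U_def indicator_def)
    qed auto
    note hL = spectral_domain_L2[OF h]
    have "\<bar>U n t\<bar> \<le> real n" for n t
      by (simp add: U_def indicator_def)
    then have "form (U n) p h = form (\<lambda>t. U n t * g t) f h" for n
      by (intro form_represents[OF assms(2) gK p f hL]) auto
    moreover have "(\<lambda>n. form (\<lambda>t. U n t * g t) f h) \<longlonglongrightarrow> form (\<lambda>t. k t * g t) f h"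
    proof (rule sigma_linear_tendsto[OF sigma_linear_form[OF f hL], where U = "\<lambda>n t. U n t * g t"])
      have "\<bar>U n t * g t\<bar> \<le> \<bar>k t * g t\<bar>" for n t
        by (simp add: U_def indicator_def)
      then show "\<bar>U n t * g t\<bar> \<le> C" for n t
        using kgC order_trans by blast
      show "(\<lambda>n. U n t * g t) \<longlonglongrightarrow> k t * g t" for t
        by (intro tendsto_mult lim tendsto_const)
    qed auto
    moreover have "L2_inner M q h = form (\<lambda>t. k t * g t) f h"
      using q hL by (simp add: represents_def)
    ultimately show "(\<lambda>n. form (U n) p h) \<longlonglongrightarrow> L2_inner M q h"
      by simp
  qed
  then show ?thesis
    using pd q by (auto simp: spectral_integral_iff represents_L2)
qed

text \<open>The form at the zero vector compares \<open>\<mu> h\<close> with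
  \<open>\<mu> (\<lambda>x. - h x)\<close>, and these coincide since a spectral measure is quadratic
  in the vector. The result provides a first pair in the graph of the Ornstein-Uhlenbeck
  operator.\<close>

lemma spectral_integral_zero:
  assumes [measurable]: "k \<in> borel_measurable borel"
  shows "spectral_integral M E k (\<lambda>x. 0) (\<lambda>x. 0)"
proof -
  have m: "measure (\<mu> (\<lambda>x. - h x)) B = measure (\<mu> h) B" if "h \<in> L2 M" "B \<in> sets borel" for h B
    using E_inner_quadratic[OF that(1,1,2), of "-1" 0] that L2_scale[of h M "-1"] by (simp add: measure_\<mu>)
  have "\<mu> (\<lambda>x. - h x) = \<mu> h" if h: "h \<in> L2 M" for h
  proof (rule measure_eqI)
    fix B assume "B \<in> sets (\<mu> (\<lambda>x. - h x))"
    moreover have "(\<lambda>x. - h x) \<in> L2 M" using L2_scale[OF h, of "-1"] by simp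
    ultimately show "emeasure (\<mu> (\<lambda>x. - h x)) B = emeasure (\<mu> h) B"
      using m[OF h, of B] h by (simp add: finite_measure.emeasure_eq_measure[OF finite_\<mu>])
  qed simp
  moreover have "\<mu> (\<lambda>x. 0) = null_measure borel"
    by (rule measure_eqI) (auto simp: emeasure_\<mu> L2_inner_commute[of M _ "\<lambda>x. 0"])
  then have "(\<lambda>x. 0) \<in> spectral_domain M E k"
    by (auto simp: spectral_domain_def integrable_iff_bounded nn_integral_null_measure)
  ultimately show ?thesis
    by (auto simp: spectral_integral_iff form_def dest: spectral_domain_L2)
qed

end

text \<open>For \<open>p = E {- n..<0} f\<close> the pairing of the image of \<open>p\<close> with
  \<open>p\<close> is the integral of \<open>t\<close> over \<open>{- n..<0}\<close> against
  \<open>\<mu> f\<close>; it is at most 0, and at least 0 by \<open>pos\<close>. The interval is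
  bounded so that \<open>p\<close> lies in the domain.\<close>

lemma (in spectral_family) nonneg_support:
  assumes pos: "\<And>p q. spectral_integral M E (\<lambda>t. t) p q \<Longrightarrow> 0 \<le> L2_inner M q p"
    and f: "f \<in> L2 M"
  shows "AE t in \<mu> f. 0 \<le> t"
proof -
  have "AE t in \<mu> f. t \<notin> {- real n..<0}" for n
  proof -
    define g :: "real \<Rightarrow> real" where "g = indicator {- real n..<0}"
    have [measurable]: "g \<in> borel_measurable borel"
      unfolding g_def by measurable
    have g1: "\<bar>g t\<bar> \<le> 1" for t
      by (simp add: g_def indicator_def)
    have tg: "\<bar>t * g t\<bar> \<le> real n" and tgg: "t * g t * g t = t * g t" and neg: "t * g t \<le> 0" for t
      by (auto simp: g_def indicator_def)
    obtain p where p: "represents g f p"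
      using represents_exists[where g = g, OF f _ g1] by auto
    obtain q where q: "represents (\<lambda>t. t * g t) f q"
      using represents_exists[where g = "\<lambda>t. t * g t", OF f _ tg] by auto
    note L = represents_L2[OF p] represents_L2[OF q]
    have "0 \<le> L2_inner M q p"
      by (rule pos, rule spectral_integral_of_represents[OF _ _ g1 tg f p q]) auto
    also have "\<dots> = form (\<lambda>t. t * g t) f p"
      using q L by (simp add: represents_def)
    also have "\<dots> = form (\<lambda>t. t * g t) p f"
      by (rule form_commute[OF _ tg f L(1)]) simp
    also have "\<dots> = form (\<lambda>t. t * g t * g t) f f"
      by (rule form_represents[OF _ g1 p f f _ tg]) auto
    also have "\<dots> = (\<integral>t. t * g t \<partial>\<mu> f)"
      unfolding tgg by (rule form_self[OF _ tg f]) simp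
    finally have "0 \<le> (\<integral>t. t * g t \<partial>\<mu> f)" .
    moreover have "0 \<le> (\<integral>t. - (t * g t) \<partial>\<mu> f)"
      using neg by (intro Bochner_Integration.integral_nonneg) simp
    ultimately have "(\<integral>t. - (t * g t) \<partial>\<mu> f) = 0"
      by simp
    moreover have "integrable (\<mu> f) (\<lambda>t. t * g t)"
      by (rule integrable_\<mu>[OF f _ tg]) simp
    ultimately have "AE t in \<mu> f. - (t * g t) = 0"
      by (subst (asm) integral_nonneg_eq_0_iff_AE) (use neg in auto)
    then show ?thesis
      by eventually_elim (auto simp: g_def indicator_def)
  qed
  then have "AE t in \<mu> f. \<forall>n. t \<notin> {- real n..<0}"
    unfolding AE_all_countable by blast
  then show ?thesis
  proof eventually_elim
    case (elim t)
    obtain n where "- t \<le> real n"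
      using real_arch_simple by blast
    then show ?case
      using elim[rule_format, of n] by auto
  qed
qed

text \<open>The function of \<open>A\<close> that gives \<open>I - J\<^sub>l = A (l + A)\<^sup>-\<^sup>1\<close>.\<close>

definition resolvent_defect :: "real \<Rightarrow> real \<Rightarrow> real" where
  "resolvent_defect l t = (if 0 \<le> t then t / (l + t) else 0)"

lemma resolvent_defect_measurable [measurable]: "resolvent_defect l \<in> borel_measurable borel"
  unfolding resolvent_defect_def[abs_def] by measurable

lemma resolvent_defect_bounds:
  assumes "l > 0"
  shows "0 \<le> resolvent_defect l t" "resolvent_defect l t \<le> 1"
  using assms by (auto simp: resolvent_defect_def field_simps)

section \<open>Nonnegative operators: resolvents and fractional powers\<close>

locale nonneg_spectral_family = spectral_family +
  assumes nonneg: "f \<in> L2 M \<Longrightarrow> AE t in spectral_distribution M E f. 0 \<le> t"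
begin

lemma integral_\<mu>_cong_nonneg:
  fixes k k' :: "real \<Rightarrow> real"
  assumes "f \<in> L2 M" and [measurable]: "k \<in> borel_measurable borel" "k' \<in> borel_measurable borel"
    and eq: "\<And>t. 0 \<le> t \<Longrightarrow> k t = k' t"
  shows "(\<integral>t. k t \<partial>\<mu> f) = (\<integral>t. k' t \<partial>\<mu> f)" "integrable (\<mu> f) k \<longleftrightarrow> integrable (\<mu> f) k'"
proof -
  have "AE t in \<mu> f. k t = k' t"
    using nonneg[OF assms(1)] by eventually_elim (rule eq)
  then show "(\<integral>t. k t \<partial>\<mu> f) = (\<integral>t. k' t \<partial>\<mu> f)" "integrable (\<mu> f) k \<longleftrightarrow> integrable (\<mu> f) k'"
    using integral_cong_AE[of k _ k'] integrable_cong_AE[of k _ k'] by auto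
qed

lemma form_cong_nonneg:
  assumes "f \<in> L2 M" "h \<in> L2 M" "k \<in> borel_measurable borel" "k' \<in> borel_measurable borel"
    and eq: "\<And>t. 0 \<le> t \<Longrightarrow> k t = k' t"
  shows "form k f h = form k' f h"
  unfolding form_def
  using integral_\<mu>_cong_nonneg(1)[OF L2_add[OF assms(1,2)] assms(3,4) eq]
    integral_\<mu>_cong_nonneg(1)[OF L2_diff[OF assms(1,2)] assms(3,4) eq]
  by simp

lemma represents_cong_nonneg:
  assumes "represents k f w" "f \<in> L2 M" "k \<in> borel_measurable borel" "k' \<in> borel_measurable borel"
    and "\<And>t. 0 \<le> t \<Longrightarrow> k t = k' t"
  shows "represents k' f w"
  using assms(1) form_cong_nonneg[OF assms(2) _ assms(3-5)] by (simp add: represents_def)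

text \<open>The resolvent has the multiplier \<open>g t = l / (l + t)\<close>. For
  \<open>t \<ge> 0\<close>, the identity \<open>t * g t = l * (1 - g t)\<close> says that the
  operator maps \<open>p\<close> to \<open>l * (f - p)\<close>, and \<open>1 - g t\<close> is
  \<open>resolvent_defect l t\<close>.\<close>

lemma resolvent_exists:
  assumes f: "f \<in> L2 M" and l: "l > 0"
  shows "\<exists>p. spectral_integral M E (\<lambda>t. t) p (\<lambda>x. l * (f x - p x)) \<and>
    represents (resolvent_defect l) f (\<lambda>x. f x - p x)"
proof -
  \<comment> \<open>The cut at 0 keeps \<open>g\<close> bounded, as \<open>l + t\<close> vanishes at
    \<open>t = - l\<close>; spectral measures have no mass on negative \<open>t\<close>.\<close>
  define g where "g t = (if 0 \<le> t then l / (l + t) else 0)" for t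
  have [measurable]: "g \<in> borel_measurable borel"
    unfolding g_def[abs_def] by measurable
  have g1: "\<bar>g t\<bar> \<le> 1" for t
    using l by (auto simp: g_def field_simps)
  have tg: "\<bar>t * g t\<bar> \<le> l" for t
  proof (cases "0 \<le> t")
    case True
    then have "t * l \<le> l * (l + t)" using l by (simp add: field_simps)
    then show ?thesis using True l by (simp add: g_def field_simps)
  qed (use l in \<open>simp add: g_def\<close>)
  obtain p where p: "represents g f p"
    using represents_exists[where g = g, OF f _ g1] by auto
  have u: "represents (indicator UNIV) f f"
  proof -
    have "L2_inner M f h = form (indicator UNIV) f h" if "h \<in> L2 M" for h
      using form_indicator[OF f that, of UNIV] E_inner_UNIV[OF f that] by simp
    then show ?thesis
      using f unfolding represents_def by blast
  qed
  have i1: "\<bar>indicator UNIV t\<bar> \<le> (1::real)" for t :: real by simp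
  have "represents (\<lambda>t. l * indicator UNIV t + (- l) * g t) f (\<lambda>x. l * f x + (- l) * p x)"
    by (rule represents_lincomb[OF f _ _ i1 g1 u p]) auto
  then have "represents (\<lambda>t. t * g t) f (\<lambda>x. l * f x + (- l) * p x)"
    by (rule represents_cong_nonneg[OF _ f]) (use l in \<open>auto simp: g_def field_simps\<close>)
  then have "represents (\<lambda>t. t * g t) f (\<lambda>x. l * (f x - p x))"
    by (simp add: algebra_simps)
  then have "spectral_integral M E (\<lambda>t. t) p (\<lambda>x. l * (f x - p x))"
    by (intro spectral_integral_of_represents[OF _ _ g1 tg f p]) auto
  moreover have "represents (\<lambda>t. 1 * indicator UNIV t + (- 1) * g t) f (\<lambda>x. 1 * f x + (- 1) * p x)"
    by (rule represents_lincomb[OF f _ _ i1 g1 u p]) auto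
  then have "represents (resolvent_defect l) f (\<lambda>x. 1 * f x + (- 1) * p x)"
    by (rule represents_cong_nonneg[OF _ f])
      (use l in \<open>auto simp: g_def resolvent_defect_def field_simps\<close>)
  ultimately show ?thesis
    by (auto intro!: exI[of _ p])
qed

lemma represents_sum:
  assumes f: "f \<in> L2 M" and "finite I"
    and "\<And>i. i \<in> I \<Longrightarrow> g i \<in> borel_measurable borel" "\<And>i t. i \<in> I \<Longrightarrow> \<bar>g i t\<bar> \<le> 1"
    and "\<And>i. i \<in> I \<Longrightarrow> represents (g i) f (w i)"
  shows "represents (\<lambda>t. \<Sum>i\<in>I. c i * g i t) f (\<lambda>x. \<Sum>i\<in>I. c i * w i x)"
  using assms(2-)
proof (induction I rule: finite_induct)
  case empty
  show ?case by (simp add: represents_def form_def)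
next
  case (insert i I)
  have b: "\<bar>\<Sum>j\<in>I. c j * g j t\<bar> \<le> (\<Sum>j\<in>I. \<bar>c j\<bar>)" for t
    by (rule order_trans[OF sum_abs], rule sum_mono)
      (use insert.prems(2) in \<open>auto simp: abs_mult mult_left_le\<close>)
  have "represents (\<lambda>t. c i * g i t + 1 * (\<Sum>j\<in>I. c j * g j t)) f (\<lambda>x. c i * w i x + 1 * (\<Sum>j\<in>I. c j * w j x))"
  proof (rule represents_lincomb[OF f])
    show "(\<lambda>t. \<Sum>j\<in>I. c j * g j t) \<in> borel_measurable borel"
      using insert.prems(1) by (intro borel_measurable_sum borel_measurable_times) auto
    show "\<bar>g i t\<bar> \<le> 1" for t using insert.prems(2) by auto
    show "\<bar>\<Sum>j\<in>I. c j * g j t\<bar> \<le> (\<Sum>j\<in>I. \<bar>c j\<bar>)" for t by (rule b)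
  qed (use insert in auto)
  then show ?case using insert.hyps by simp
qed

text \<open>Against test functions in the spectral domain, the definition of \<open>v\<close> and
  \<open>form_tendsto\<close> give the limit. Other test functions are reached by
  \<open>L2_weak_limit_of_dense\<close>: the bound of \<open>G n t\<close> by
  \<open>t powr s\<close>, with \<open>f\<close> in the domain, bounds the norms of
  \<open>S n\<close>.\<close>

lemma fractional_power_weak_limit:
  assumes s: "s > 0" and v: "spectral_integral M E (\<lambda>t. t powr s) f v" and h: "h \<in> L2 M"
    and [measurable]: "\<And>n. G n \<in> borel_measurable borel"
    and Gb: "\<And>n t. \<bar>G n t\<bar> \<le> K n" and Gneg: "\<And>n t. t < 0 \<Longrightarrow> G n t = 0"
    and G: "\<And>n t. 0 \<le> t \<Longrightarrow> 0 \<le> G n t" "\<And>n t. 0 \<le> t \<Longrightarrow> G n t \<le> t powr s"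
    and lim: "\<And>t. 0 \<le> t \<Longrightarrow> (\<lambda>n. G n t) \<longlonglongrightarrow> t powr s"
    and S: "\<And>n. represents (G n) f (S n)"
  shows "(\<lambda>n. L2_inner M (S n) h) \<longlonglongrightarrow> L2_inner M v h"
proof -
  \<comment> \<open>The version of \<open>t powr s\<close> that vanishes for negative
    \<open>t\<close>, as \<open>G n\<close> does, is limit and majorant on the whole line.\<close>
  define k where "k t = (if 0 \<le> t then t powr s else 0)" for t :: real
  have [measurable]: "k \<in> borel_measurable borel"
    unfolding k_def[abs_def] by measurable
  have Gk: "\<bar>G n t\<bar> \<le> \<bar>k t\<bar>" for n t
    using G[of t n] Gneg[of t n] by (auto simp: k_def)
  have Glim: "(\<lambda>n. G n t) \<longlonglongrightarrow> k t" for t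
    using lim[of t] Gneg[of t] by (cases "0 \<le> t") (auto simp: k_def)
  have dom: "g \<in> spectral_domain M E (\<lambda>t. t powr s) \<longleftrightarrow> g \<in> spectral_domain M E k" for g
    using integral_\<mu>_cong_nonneg(2)[of g "\<lambda>t. (t powr s)\<^sup>2" "\<lambda>t. (k t)\<^sup>2"]
    by (auto simp: spectral_domain_def k_def)
  have fd: "f \<in> spectral_domain M E k" and vL: "v \<in> L2 M"
    using v dom by (auto simp: spectral_integral_iff)
  note fL = spectral_domain_L2[OF fd]
  have vform: "L2_inner M v g = form k f g" if g: "g \<in> spectral_domain M E k" for g
  proof -
    have "L2_inner M v g = form (\<lambda>t. t powr s) f g"
      using v g dom by (auto simp: spectral_integral_iff)
    also have "\<dots> = form k f g"
      by (rule form_cong_nonneg[OF fL spectral_domain_L2[OF g]]) (auto simp: k_def)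
    finally show ?thesis .
  qed
  \<comment> \<open>Spectral truncations of \<open>h\<close>: they lie in the domain because
    \<open>k\<close> is bounded on \<open>{0..real n}\<close>, and they tend to \<open>h\<close>
    because \<open>\<mu> h\<close> is carried by the nonnegative half-line.\<close>
  define hk where "hk n = E {0..real n} h" for n :: nat
  have hkL: "hk n \<in> L2 M" for n
    unfolding hk_def by (rule E_L2) (use h in auto)
  have hkd: "hk n \<in> spectral_domain M E k" for n
  proof -
    have r: "represents (indicator {0..real n}) h (hk n)"
      unfolding hk_def by (rule represents_indicator[OF h]) simp
    have b: "\<bar>(indicator {0..real n} t)\<^sup>2 * (k t)\<^sup>2\<bar> \<le> (real n powr s)\<^sup>2" for t
      using s by (auto simp: indicator_def k_def intro!: power_mono powr_mono2)
    have "\<mu> (hk n) = density (\<mu> h) (\<lambda>t. ennreal ((indicator {0..real n} t)\<^sup>2))"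
      by (rule \<mu>_represents[OF _ _ r h, where K = 1]) auto
    moreover have "integrable (\<mu> h) (\<lambda>t. (indicator {0..real n} t)\<^sup>2 * (k t)\<^sup>2)"
      by (rule integrable_\<mu>[OF h _ b]) simp
    ultimately have "integrable (\<mu> (hk n)) (\<lambda>t. (k t)\<^sup>2)"
      by (simp only:) (subst integrable_density, auto)
    then show ?thesis
      using hkL by (simp add: spectral_domain_def)
  qed
  have dense: "(\<lambda>n. \<integral>x. (hk n x - h x)\<^sup>2 \<partial>M) \<longlonglongrightarrow> 0"
  proof -
    have "(\<integral>x. (hk n x - h x)\<^sup>2 \<partial>M) = L2_inner M h h - (\<integral>t. indicat_real {0..real n} t \<partial>\<mu> h)" for n
    proof -
      have "(\<integral>x. (hk n x - h x)\<^sup>2 \<partial>M) = L2_inner M (\<lambda>x. hk n x - h x) (\<lambda>x. hk n x - h x)"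
        by (simp add: L2_inner_self)
      also have "\<dots> = L2_inner M (hk n) (hk n) - 2 * L2_inner M (hk n) h + L2_inner M h h"
        using hkL h by (simp add: L2_inner_diff_left L2_inner_diff_right L2_diff L2_inner_commute[of M h "hk n"])
      also have "L2_inner M (hk n) (hk n) = L2_inner M (hk n) h"
        unfolding hk_def by (rule E_inner_idem) (use h in auto)
      finally show ?thesis
        using h by (simp add: hk_def measure_\<mu>)
    qed
    moreover have "(\<lambda>n. \<integral>t. indicat_real {0..real n} t \<partial>\<mu> h) \<longlonglongrightarrow> (\<integral>t. indicat_real {0..} t \<partial>\<mu> h)"
    proof (rule sigma_linear_tendsto[OF sigma_linear_\<mu>[OF h], where C = 1 and U = "\<lambda>n. indicator {0..real n}"])
      show "(\<lambda>n. indicator {0..real n} t) \<longlonglongrightarrow> (indicator {0..} t :: real)" for t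
      proof (rule tendsto_eventually, rule eventually_sequentiallyI)
        fix n assume "nat \<lceil>t\<rceil> \<le> n"
        then have "t \<le> real n" by linarith
        then show "indicator {0..real n} t = (indicator {0..} t :: real)"
          by (simp add: indicator_def)
      qed
    qed (auto simp: indicator_def)
    moreover have "(\<integral>t. indicat_real {0..} t \<partial>\<mu> h) = L2_inner M h h"
    proof -
      have "(\<integral>t. indicat_real {0..} t \<partial>\<mu> h) = (\<integral>t. indicat_real UNIV t \<partial>\<mu> h)"
        by (rule integral_\<mu>_cong_nonneg(1)[OF h]) auto
      also have "\<dots> = L2_inner M h h"
        using integral_\<mu>_indicator[OF h, of UNIV] E_inner_UNIV[OF h h] by simp
      finally show ?thesis .
    qed
    ultimately show ?thesis
      using tendsto_diff[OF tendsto_const[of "L2_inner M h h"]] by fastforce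
  qed
  have "L2_inner M (S n) (S n) \<le> (\<integral>t. (k t)\<^sup>2 \<partial>\<mu> f)" for n
  proof -
    have "L2_inner M (S n) (S n) = (\<integral>t. (G n t)\<^sup>2 \<partial>\<mu> f)"
      by (rule represents_norm[OF _ Gb S fL]) simp
    also have "\<dots> \<le> (\<integral>t. (k t)\<^sup>2 \<partial>\<mu> f)"
    proof (rule integral_mono')
      show "integrable (\<mu> f) (\<lambda>t. (k t)\<^sup>2)"
        using fd by (simp add: spectral_domain_def)
      show "(G n t)\<^sup>2 \<le> (k t)\<^sup>2" for t
        using Gk[of n t] by (simp add: abs_le_square_iff)
    qed auto
    finally show ?thesis .
  qed
  then show ?thesis
  proof (rule L2_weak_limit_of_dense[OF represents_L2[OF S] _ vL h hkL dense])
    fix m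
    have "(\<lambda>n. form (G n) f (hk m)) \<longlonglongrightarrow> form k f (hk m)"
      by (rule form_tendsto[OF fd hkd _ _ Gk Glim]) auto
    then show "(\<lambda>n. L2_inner M (S n) (hk m)) \<longlonglongrightarrow> L2_inner M v (hk m)"
      using S hkL vform[OF hkd] by (simp add: represents_def)
  qed
qed

end

section \<open>Riemann sums for fractional powers\<close>

text \<open>The integrand of Stieltjes' formula, in which \<open>t powr s\<close> is
  \<open>sin (pi * s) / pi\<close> times the integral over \<open>l > 0\<close>. It is extended by 0
  so that integrals run over the whole line.\<close>

definition stieltjes_kernel :: "real \<Rightarrow> real \<Rightarrow> real \<Rightarrow> real" where
  "stieltjes_kernel s t l = (if 0 < l then l powr (s - 1) * (t / (l + t)) else 0)"

lemma stieltjes_kernel_measurable [measurable]: "stieltjes_kernel s t \<in> borel_measurable borel"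
  unfolding stieltjes_kernel_def[abs_def] by measurable

lemma stieltjes_kernel_nonneg: "0 \<le> t \<Longrightarrow> 0 \<le> stieltjes_kernel s t l"
  by (simp add: stieltjes_kernel_def)

text \<open>Both factors decrease in \<open>l\<close>, the first because \<open>s < 1\<close>. The
  value at the right end of a cell is therefore a lower bound on the cell, which makes the Riemann
  sums below lower sums.\<close>

lemma stieltjes_kernel_antimono:
  assumes "s < 1" "0 \<le> t" "0 < l" "l \<le> l'"
  shows "stieltjes_kernel s t l' \<le> stieltjes_kernel s t l"
proof -
  have "l' powr (s - 1) \<le> l powr (s - 1)"
    using assms by (intro powr_mono2') auto
  moreover have "t / (l' + t) \<le> t / (l + t)"
    using assms by (intro divide_left_mono mult_pos_pos) auto
  ultimately have "l' powr (s - 1) * (t / (l' + t)) \<le> l powr (s - 1) * (t / (l + t))"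
    using assms by (intro mult_mono) auto
  then show ?thesis
    using assms by (simp add: stieltjes_kernel_def)
qed

text \<open>Near 0 the kernel is at most \<open>l powr (s - 1)\<close>, integrable since
  \<open>s > 0\<close>; for \<open>l \<ge> 1\<close> it is at most \<open>l powr (s - 2)\<close>,
  integrable since \<open>s < 1\<close>.\<close>

lemma integrable_stieltjes_kernel_1:
  assumes s: "0 < s" "s < 1"
  shows "integrable lborel (stieltjes_kernel s 1)"
proof -
  have "set_integrable lebesgue {0..1} (\<lambda>x. x powr (s - 1))"
    using s by (intro nonnegative_absolutely_integrable_1 integrable_on_powr_from_0) auto
  moreover have "set_integrable lebesgue {1..} (\<lambda>x. x powr (s - 2))"
    using has_integral_powr_to_inf[of "s - 2" 1] s
    by (intro nonnegative_absolutely_integrable_1) (auto simp: integrable_on_def)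
  ultimately have "integrable lborel (\<lambda>x. indicator {0..1} x * x powr (s - 1) + indicator {1..} x * x powr (s - 2))"
    by (simp add: set_integrable_def integrable_completion)
  then show ?thesis
  proof (rule Bochner_Integration.integrable_bound)
    show "AE x in lborel. norm (stieltjes_kernel s 1 x)
        \<le> norm (indicator {0..1} x * x powr (s - 1) + indicator {1..} x * x powr (s - 2))"
    proof (rule AE_I2)
      fix x :: real
      have 1: "x powr (s - 1) * (1 / (x + 1)) \<le> x powr (s - 1)" if "0 < x"
        using that by (simp add: field_simps)
      have 2: "x powr (s - 1) * (1 / (x + 1)) \<le> x powr (s - 2)" if "1 \<le> x"
      proof -
        have "x powr (s - 1) * (1 / (x + 1)) \<le> x powr (s - 1) * (1 / x)"
          using that by (intro mult_left_mono divide_left_mono) auto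
        also have "\<dots> = x powr (s - 2)"
          using that powr_diff[of x "s - 1" 1] by simp
        finally show ?thesis .
      qed
      consider "x \<le> 0" | "0 < x" "x < 1" | "x = 1" | "1 < x" by linarith
      then show "norm (stieltjes_kernel s 1 x)
        \<le> norm (indicator {0..1} x * x powr (s - 1) + indicator {1..} x * x powr (s - 2))"
        by cases (use 1 2 in \<open>auto simp: stieltjes_kernel_def abs_mult\<close>)
    qed
  qed simp
qed

text \<open>Homogeneity in \<open>t\<close> and \<open>l\<close> reduces every kernel to the one for
  \<open>t = 1\<close>. The summand 0 matches the affine substitution rule for
  \<open>lborel\<close>.\<close>

lemma stieltjes_kernel_scale:
  assumes "0 < t"
  shows "stieltjes_kernel s t (0 + t * l) = t powr (s - 1) * stieltjes_kernel s 1 l"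
proof (cases "0 < l")
  case True
  have "t / (t * l + t) = t / (t * (l + 1))"
    by (simp add: distrib_left)
  also have "\<dots> = 1 / (l + 1)"
    using assms by simp
  finally show ?thesis
    using True assms by (simp add: stieltjes_kernel_def powr_mult)
next
  case False
  then have "\<not> 0 < t * l"
    using assms by (simp add: zero_less_mult_iff)
  then show ?thesis
    using False by (simp add: stieltjes_kernel_def)
qed

lemma integral_stieltjes_kernel:
  assumes s: "0 < s" "s < 1" and t: "0 < t"
  shows "integrable lborel (stieltjes_kernel s t)"
    and "(\<integral>l. stieltjes_kernel s t l \<partial>lborel) = t powr s * (\<integral>l. stieltjes_kernel s 1 l \<partial>lborel)"
proof -
  have "integrable lborel (\<lambda>l. stieltjes_kernel s t (0 + t * l))"
    unfolding stieltjes_kernel_scale[OF t] using integrable_stieltjes_kernel_1[OF s] by simp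
  then show "integrable lborel (stieltjes_kernel s t)"
    using t by (subst (asm) lborel_integrable_real_affine_iff) auto
  have "(\<integral>l. stieltjes_kernel s t l \<partial>lborel) = \<bar>t\<bar> *\<^sub>R (\<integral>l. stieltjes_kernel s t (0 + t * l) \<partial>lborel)"
    using t by (intro lborel_integral_real_affine) auto
  also have "\<dots> = (t * t powr (s - 1)) * (\<integral>l. stieltjes_kernel s 1 l \<partial>lborel)"
    unfolding stieltjes_kernel_scale[OF t] using t by simp
  also have "t * t powr (s - 1) = t powr s"
    using t powr_add[of t 1 "s - 1"] by simp
  finally show "(\<integral>l. stieltjes_kernel s t l \<partial>lborel) = t powr s * (\<integral>l. stieltjes_kernel s 1 l \<partial>lborel)" .
qed

text \<open>On \<open>{1/2..1}\<close> the kernel is at least 1/2. Positivity matters because the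
  Riemann sums are divided by this integral.\<close>

lemma integral_stieltjes_kernel_1_pos:
  assumes s: "0 < s" "s < 1"
  shows "0 < (\<integral>l. stieltjes_kernel s 1 l \<partial>lborel)"
proof -
  have "(\<integral>l. 1/2 * indicator {1/2..1::real} l \<partial>lborel) \<le> (\<integral>l. stieltjes_kernel s 1 l \<partial>lborel)"
  proof (rule integral_mono)
    fix l :: real
    have "1/2 \<le> l powr (s - 1) * (1 / (l + 1))" if "1/2 \<le> l" "l \<le> 1"
    proof -
      have "1 powr (s - 1) \<le> l powr (s - 1)"
        using that s by (intro powr_mono2') auto
      moreover have "1/2 \<le> 1 / (l + 1)"
        using that by (simp add: field_simps)
      ultimately have "1 * (1/2) \<le> l powr (s - 1) * (1 / (l + 1))"
        by (intro mult_mono) auto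
      then show ?thesis by simp
    qed
    then show "1/2 * indicator {1/2..1} l \<le> stieltjes_kernel s 1 l"
      using stieltjes_kernel_nonneg[of 1 s l] by (auto simp: indicator_def stieltjes_kernel_def)
  next
    show "integrable lborel (\<lambda>l. 1/2 * indicator {1/2..1::real} l :: real)"
      by (intro Bochner_Integration.integrable_mult_right integrable_real_indicator emeasure_bounded_finite) auto
  qed (rule integrable_stieltjes_kernel_1[OF s])
  then show ?thesis by simp
qed

text \<open>The sums are integrals of step functions below the kernel, whose integral is
  \<open>K * t powr s\<close>. This gives the upper bound, and dominated convergence with the kernel
  as majorant gives the limit. Nodes and weights must not depend on \<open>t\<close>, so that each
  sum is a combination of multipliers of fixed resolvents.\<close>

lemma powr_eq_limit_of_resolvent_sums:
  assumes s: "0 < s" "s < 1"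
  shows "\<exists>c l :: nat \<Rightarrow> nat \<Rightarrow> real. \<exists>N :: nat \<Rightarrow> nat.
    (\<forall>n i. 0 \<le> c n i) \<and> (\<forall>n i. 0 < l n i) \<and>
    (\<forall>t\<ge>0. (\<forall>n. (\<Sum>i<N n. c n i * (t / (l n i + t))) \<le> t powr s) \<and>
      (\<lambda>n. \<Sum>i<N n. c n i * (t / (l n i + t))) \<longlonglongrightarrow> t powr s)"
proof -
  define K where "K = (\<integral>l. stieltjes_kernel s 1 l \<partial>lborel)"
  have K: "K > 0"
    unfolding K_def by (rule integral_stieltjes_kernel_1_pos[OF s])
  define d where "d n = 1 / real (Suc n)" for n
  \<comment> \<open>Mesh \<open>1 / (n + 1)\<close> on \<open>{0<..n + 1}\<close> makes
    \<open>(n + 1)\<^sup>2\<close> cells.\<close>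
  define N where "N n = Suc n * Suc n" for n
  define l where "l n i = real (Suc i) * d n" for n i
  \<comment> \<open>Cell length times the factor of the kernel that is free of \<open>t\<close>,
    normalized by the integral \<open>K\<close>.\<close>
  define c where "c n i = d n * l n i powr (s - 1) / K" for n i
  have d: "d n > 0" for n by (simp add: d_def)
  have l: "l n i > 0" for n i by (simp add: l_def d)
  define step where "step n t x = (\<Sum>i<N n. stieltjes_kernel s t (l n i) * indicator {real i * d n<..real (Suc i) * d n} x)"
    for n t x
  have int_step: "(\<integral>x. step n t x \<partial>lborel) = K * (\<Sum>i<N n. c n i * (t / (l n i + t)))" for n t
  proof -
    have "(\<integral>x. step n t x \<partial>lborel)
      = (\<Sum>i<N n. stieltjes_kernel s t (l n i) * measure lborel {real i * d n<..real (Suc i) * d n})"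
      unfolding step_def using d[of n]
      by (subst Bochner_Integration.integral_sum) (auto intro!: integrable_real_mult_indicator simp: mult_right_mono)
    also have "\<dots> = (\<Sum>i<N n. stieltjes_kernel s t (l n i) * d n)"
      using d[of n] by (intro sum.cong refl) (simp add: algebra_simps)
    also have "\<dots> = K * (\<Sum>i<N n. c n i * (t / (l n i + t)))"
      unfolding sum_distrib_left using K l by (intro sum.cong refl) (simp add: stieltjes_kernel_def c_def)
    finally show ?thesis .
  qed
  have step_cell: "step n t x = (if i < N n then stieltjes_kernel s t (l n i) else 0)"
    if "real i * d n < x" "x \<le> real (Suc i) * d n" for n t x i
  proof -
    have "indicator {real j * d n<..real (Suc j) * d n} x = (if j = i then 1 else 0 :: real)" for j
    proof -
      have ji: "j = i" if "real j * d n < x" "x \<le> real (Suc j) * d n"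
      proof -
        have "real j * d n < real (Suc i) * d n" "real i * d n < real (Suc j) * d n"
          using that \<open>real i * d n < x\<close> \<open>x \<le> real (Suc i) * d n\<close> by linarith+
        then have "real j < real (Suc i)" "real i < real (Suc j)"
          using d[of n] mult_less_cancel_right_pos by blast+
        then show "j = i" by linarith
      qed
      have "x \<in> {real j * d n<..real (Suc j) * d n} \<longleftrightarrow> j = i"
        using ji that unfolding greaterThanAtMost_iff by blast
      then show ?thesis
        by (simp only: indicator_def of_bool_def)
    qed
    then have "step n t x = (\<Sum>j<N n. stieltjes_kernel s t (l n j) * (if j = i then 1 else 0))"
      unfolding step_def by simp
    also have "\<dots> = (if i < N n then stieltjes_kernel s t (l n i) else 0)"
      by (auto simp: if_distrib sum.delta cong: if_cong)
    finally show ?thesis .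
  qed
  have cell: "\<exists>i. real i * d n < x \<and> x \<le> real (Suc i) * d n" if "x > 0" for n x
  proof -
    \<comment> \<open>Ceiling minus 1 and not floor: a cell contains its right end but not its left
      end.\<close>
    define i where "i = nat (\<lceil>x / d n\<rceil> - 1)"
    have "0 < x / d n" using that d[of n] by simp
    then have "real i < x / d n" "x / d n \<le> real (Suc i)"
      unfolding i_def by linarith+
    then show ?thesis
      using d[of n] by (auto simp: field_simps intro!: exI[of _ i])
  qed
  have step_neg: "step n t x = 0" if "x \<le> 0" for n t x
    unfolding step_def
  proof (rule sum.neutral, rule ballI)
    fix i
    have "0 \<le> real i * d n" using d[of n] by simp
    then have "x \<notin> {real i * d n<..real (Suc i) * d n}" using that by auto
    then show "stieltjes_kernel s t (l n i) * indicator {real i * d n<..real (Suc i) * d n} x = 0"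
      by simp
  qed
  have step_le: "step n t x \<le> stieltjes_kernel s t x" and step_nn: "0 \<le> step n t x" if "t \<ge> 0" for n t x
  proof -
    have "step n t x \<le> stieltjes_kernel s t x \<and> 0 \<le> step n t x"
    proof (cases "x > 0")
      case True
      obtain i where i: "real i * d n < x" "x \<le> real (Suc i) * d n"
        using cell[OF True] by blast
      show ?thesis
        using stieltjes_kernel_antimono[OF s(2) that True i(2)] stieltjes_kernel_nonneg[OF that]
        by (simp add: step_cell[OF i] l_def)
    next
      case False
      then show ?thesis
        using step_neg[of x n t] stieltjes_kernel_nonneg[OF that] by simp
    qed
    then show "step n t x \<le> stieltjes_kernel s t x" "0 \<le> step n t x" by auto
  qed
  have step_lim: "(\<lambda>n. step n t x) \<longlonglongrightarrow> stieltjes_kernel s t x" if t: "t > 0" for t x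
  proof (cases "x > 0")
    case True
    obtain i where i: "\<And>n. real (i n) * d n < x" "\<And>n. x \<le> real (Suc (i n)) * d n"
      using cell[OF True] by metis
    have d0: "d \<longlonglongrightarrow> 0"
      unfolding d_def[abs_def] by (rule LIMSEQ_Suc[OF lim_1_over_n])
    have xl: "(\<lambda>n. l n (i n)) \<longlonglongrightarrow> x"
    proof (rule real_tendsto_sandwich[where f = "\<lambda>_. x" and h = "\<lambda>n. x + d n"])
      show "(\<lambda>n. x + d n) \<longlonglongrightarrow> x"
        using tendsto_add[OF tendsto_const[of x] d0] by simp
      have "real (Suc (i n)) * d n \<le> x + d n" for n
        using i(1)[of n] by (simp add: algebra_simps)
      then show "\<forall>\<^sub>F n in sequentially. l n (i n) \<le> x + d n"
        by (simp add: l_def)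
      show "\<forall>\<^sub>F n in sequentially. x \<le> l n (i n)"
        using i(2) by (simp add: l_def)
    qed simp
    have "(\<lambda>n. l n (i n) powr (s - 1) * (t / (l n (i n) + t))) \<longlonglongrightarrow> x powr (s - 1) * (t / (x + t))"
      using True t by (intro tendsto_intros xl) auto
    then have "(\<lambda>n. stieltjes_kernel s t (l n (i n))) \<longlonglongrightarrow> stieltjes_kernel s t x"
      using True l by (simp add: stieltjes_kernel_def)
    moreover have "\<forall>\<^sub>F n in sequentially. stieltjes_kernel s t (l n (i n)) = step n t x"
    proof (rule eventually_sequentiallyI)
      fix n assume "nat \<lceil>x\<rceil> \<le> n"
      then have "x \<le> real (Suc n)" by linarith
      \<comment> \<open>The cells reach up to \<open>n + 1\<close>, so the cell of \<open>x\<close>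
        is among the first \<open>N n\<close> once \<open>n \<ge> x\<close>.\<close>
      moreover have "real (N n) * d n = real (Suc n)"
        unfolding N_def d_def of_nat_mult by simp
      ultimately have "real (i n) * d n < real (N n) * d n"
        using i(1)[of n] by linarith
      then have "i n < N n"
        using d[of n] by simp
      then show "stieltjes_kernel s t (l n (i n)) = step n t x"
        using step_cell[OF i] by simp
    qed
    ultimately show ?thesis
      by (rule Lim_transform_eventually)
  next
    case False
    then show ?thesis
      using step_neg[of x _ t] by (simp add: stieltjes_kernel_def)
  qed
  have meas: "step n t \<in> borel_measurable lborel" for n t
    unfolding step_def[abs_def] by measurable
  have int: "integrable lborel (step n t)" if "t > 0" for n t
    by (rule Bochner_Integration.integrable_bound[OF integral_stieltjes_kernel(1)[OF s that] meas])
      (use that step_le[of t n] step_nn[of t n] in \<open>auto intro!: order_trans[OF step_le]\<close>)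
  have le: "(\<Sum>i<N n. c n i * (t / (l n i + t))) \<le> t powr s" if t: "t > 0" for n t
  proof -
    have "K * (\<Sum>i<N n. c n i * (t / (l n i + t))) \<le> t powr s * K"
    proof -
      have "(\<integral>x. step n t x \<partial>lborel) \<le> (\<integral>x. stieltjes_kernel s t x \<partial>lborel)"
        using t by (intro integral_mono int step_le integral_stieltjes_kernel(1)[OF s]) auto
      then show ?thesis
        unfolding int_step integral_stieltjes_kernel(2)[OF s t] K_def .
    qed
    then show ?thesis using K by (simp add: mult.commute)
  qed
  have lim: "(\<lambda>n. \<Sum>i<N n. c n i * (t / (l n i + t))) \<longlonglongrightarrow> t powr s" if t: "t > 0" for t
  proof -
    have "(\<lambda>n. \<integral>x. step n t x \<partial>lborel) \<longlonglongrightarrow> (\<integral>x. stieltjes_kernel s t x \<partial>lborel)"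
      by (rule integral_dominated_convergence[where w = "stieltjes_kernel s t"])
        (use t step_le[of t] step_nn[of t] step_lim[of t] integral_stieltjes_kernel(1)[OF s t] meas in auto)
    then have "(\<lambda>n. K * (\<Sum>i<N n. c n i * (t / (l n i + t)))) \<longlonglongrightarrow> t powr s * K"
      unfolding int_step integral_stieltjes_kernel(2)[OF s t] K_def .
    then have "(\<lambda>n. inverse K * (K * (\<Sum>i<N n. c n i * (t / (l n i + t))))) \<longlonglongrightarrow> inverse K * (t powr s * K)"
      by (rule tendsto_mult_left)
    moreover have "inverse K * (K * y) = y" "inverse K * (y * K) = y" for y
      using K by simp_all
    ultimately show ?thesis by simp
  qed
  \<comment> \<open>The substitution behind the integral formula needs \<open>t > 0\<close>; for
    \<open>t = 0\<close> all terms and \<open>0 powr s\<close> are 0.\<close>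
  have "(\<forall>n. (\<Sum>i<N n. c n i * (t / (l n i + t))) \<le> t powr s) \<and>
      (\<lambda>n. \<Sum>i<N n. c n i * (t / (l n i + t))) \<longlonglongrightarrow> t powr s" if "t \<ge> 0" for t
    using le[of t] lim[of t] that by (cases "t = 0") auto
  moreover have "0 \<le> c n i" for n i
    using K d[of n] by (simp add: c_def)
  ultimately show ?thesis
    using l by blast
qed

section \<open>The Cameron-Martin space\<close>

text \<open>
  If \<open>x \<mapsto> f x *\<^sub>R x\<close> failed to be Bochner integrable for some \<open>f\<close> in the closure of the dual
  space, \<^const>\<open>cm_map\<close> would send \<open>f\<close> to \<open>0\<close> and the choice \<open>cm_hat \<gamma> 0\<close> could be a junk value.
  Fernique's theorem rules this out; here the weaker assumption \<open>cm_hat_zero\<close> suffices, which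
  follows below from the existence of a spectral measure.
\<close>

locale wiener_space =
  fixes \<gamma> :: "'a::{banach, second_countable_topology} measure"
    and Q :: "('a \<Rightarrow>\<^sub>L real) \<Rightarrow> 'a" and J :: "nat set" and \<xi> :: "nat \<Rightarrow> 'a \<Rightarrow>\<^sub>L real"
  assumes wiener: "abstract_wiener_space \<gamma>"
    and basis: "wiener_basis \<gamma> Q J \<xi>"
    and cm_hat_zero: "AE x in \<gamma>. cm_hat \<gamma> 0 x = 0"

sublocale wiener_space \<subseteq> prob_space \<gamma>
  using wiener by (simp add: abstract_wiener_space_def centred_gaussian_measure_def)

context wiener_space
begin

lemma sets_\<gamma> [measurable_cong, simp]: "sets \<gamma> = sets borel"
  using wiener by (simp add: abstract_wiener_space_def centred_gaussian_measure_def)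

lemma space_\<gamma> [simp]: "space \<gamma> = UNIV"
  using sets_eq_imp_space_eq[OF sets_\<gamma>] by simp

lemma borel_measurable_continuous: "continuous_on UNIV (f :: 'a \<Rightarrow> 'b::topological_space) \<Longrightarrow> f \<in> borel_measurable \<gamma>"
  using borel_measurable_continuous_onI[of f] measurable_cong_sets[OF sets_\<gamma> refl] by blast

lemma continuous_functional: "continuous_on UNIV (blinfun_apply (\<eta> :: 'a \<Rightarrow>\<^sub>L real))"
  by (intro continuous_intros)

lemma functional_measurable [measurable]: "blinfun_apply (\<eta> :: 'a \<Rightarrow>\<^sub>L real) \<in> borel_measurable \<gamma>"
  by (rule borel_measurable_continuous[OF continuous_functional])

lemma functional_L2: "blinfun_apply (\<eta> :: 'a \<Rightarrow>\<^sub>L real) \<in> L2 \<gamma>"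
proof -
  have "integrable \<gamma> (\<lambda>x. (blinfun_apply \<eta> x)\<^sup>2)"
  proof (cases "AE x in \<gamma>. blinfun_apply \<eta> x = 0")
    case True
    then have "AE x in \<gamma>. (blinfun_apply \<eta> x)\<^sup>2 = 0"
      by eventually_elim simp
    then show ?thesis
      using integrable_cong_AE[of "\<lambda>x. (blinfun_apply \<eta> x)\<^sup>2" \<gamma> "\<lambda>x. 0"] by simp
  next
    case False
    then obtain \<sigma> where \<sigma>: "\<sigma> > 0"
      and d: "distributed \<gamma> lborel (blinfun_apply \<eta>) (\<lambda>t. ennreal (normal_density 0 \<sigma> t))"
      using wiener by (auto simp: abstract_wiener_space_def centred_gaussian_measure_def)
    have "integrable lborel (\<lambda>t. normal_density 0 \<sigma> t * t\<^sup>2)"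
      using integrable_normal_moment[OF \<sigma>, of 0 2] by simp
    then show ?thesis
      using distributed_integrable[OF d, of "\<lambda>t. t\<^sup>2"] by simp
  qed
  then show ?thesis
    by (simp add: L2_def)
qed

lemma covariance: "blinfun_apply \<eta> (Q \<zeta>) = L2_inner \<gamma> (blinfun_apply \<zeta>) (blinfun_apply \<eta>)"
  using basis by (simp add: wiener_basis_def covariance_operator_def L2_inner_def)

lemma basis_mem: "j \<in> J \<Longrightarrow> Q (\<xi> j) \<in> cm_space \<gamma>"
  using basis by (simp add: wiener_basis_def cm_orthonormal_basis_def)

lemma basis_orthonormal: "i \<in> J \<Longrightarrow> j \<in> J \<Longrightarrow> cm_inner \<gamma> (Q (\<xi> i)) (Q (\<xi> j)) = (if i = j then 1 else 0)"
  using basis by (simp add: wiener_basis_def cm_orthonormal_basis_def)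

section \<open>Linear structure of the Cameron-Martin space\<close>

lemma dual_closure_L2: "f \<in> dual_closure \<gamma> \<Longrightarrow> f \<in> L2 \<gamma>"
  by (simp add: dual_closure_def)

lemma functional_dual_closure: "blinfun_apply \<eta> \<in> dual_closure \<gamma>"
  by (auto simp: dual_closure_def functional_L2 intro!: exI[of _ "\<lambda>_. \<eta>"])

lemma dual_closure_lincomb:
  assumes "f \<in> dual_closure \<gamma>" "g \<in> dual_closure \<gamma>"
  shows "(\<lambda>x. a * f x + b * g x) \<in> dual_closure \<gamma>"
proof -
  obtain \<zeta> \<eta> :: "nat \<Rightarrow> 'a \<Rightarrow>\<^sub>L real"
    where \<zeta>: "(\<lambda>n. \<integral>x. (\<zeta> n x - f x)\<^sup>2 \<partial>\<gamma>) \<longlonglongrightarrow> 0" and \<eta>: "(\<lambda>n. \<integral>x. (\<eta> n x - g x)\<^sup>2 \<partial>\<gamma>) \<longlonglongrightarrow> 0"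
    using assms by (auto simp: dual_closure_def)
  note L = dual_closure_L2[OF assms(1)] dual_closure_L2[OF assms(2)]
  have "(\<lambda>n. \<integral>x. ((a *\<^sub>R \<zeta> n + b *\<^sub>R \<eta> n) x - (a * f x + b * g x))\<^sup>2 \<partial>\<gamma>) \<longlonglongrightarrow> 0"
    using L2_tendsto_lincomb[OF functional_L2 L(1) \<zeta> functional_L2 L(2) \<eta>, of a b]
    by (simp add: blinfun.bilinear_simps)
  then have "\<exists>\<theta> :: nat \<Rightarrow> 'a \<Rightarrow>\<^sub>L real. (\<lambda>n. \<integral>x. (\<theta> n x - (a * f x + b * g x))\<^sup>2 \<partial>\<gamma>) \<longlonglongrightarrow> 0"
    by (rule exI[of _ "\<lambda>n. a *\<^sub>R \<zeta> n + b *\<^sub>R \<eta> n"])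
  then show ?thesis
    using L2_lincomb[OF L] by (simp add: dual_closure_def)
qed

text \<open>The difference is orthogonal to all functionals and is itself a limit of functionals,
  hence orthogonal to itself.\<close>

lemma dual_closure_eqI:
  assumes f: "f \<in> dual_closure \<gamma>" and g: "g \<in> dual_closure \<gamma>"
    and eq: "\<And>\<eta> :: 'a \<Rightarrow>\<^sub>L real. L2_inner \<gamma> f (blinfun_apply \<eta>) = L2_inner \<gamma> g (blinfun_apply \<eta>)"
  shows "AE x in \<gamma>. f x = g x"
proof -
  let ?d = "\<lambda>x. f x - g x"
  note L = dual_closure_L2[OF f] dual_closure_L2[OF g]
  have d: "?d \<in> dual_closure \<gamma>"
    using dual_closure_lincomb[OF f g, of 1 "-1"] by simp
  note dL = dual_closure_L2[OF d]
  obtain \<zeta> :: "nat \<Rightarrow> 'a \<Rightarrow>\<^sub>L real" where \<zeta>: "(\<lambda>n. \<integral>x. (\<zeta> n x - ?d x)\<^sup>2 \<partial>\<gamma>) \<longlonglongrightarrow> 0"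
    using d by (auto simp: dual_closure_def)
  have "L2_inner \<gamma> (blinfun_apply (\<zeta> n)) ?d = 0" for n
    using eq[of "\<zeta> n"] L
    by (simp add: L2_inner_commute[of \<gamma> "blinfun_apply (\<zeta> n)"] L2_inner_diff_left functional_L2)
  then have "L2_inner \<gamma> ?d ?d = 0"
    using L2_tendsto_inner[OF functional_L2 dL dL \<zeta>] by (simp add: LIMSEQ_const_iff)
  then have "AE x in \<gamma>. ?d x = 0"
    using L2_inner_self_eq_0[OF dL] by simp
  then show ?thesis
    by eventually_elim simp
qed

lemma cm_hat:
  assumes "h \<in> cm_space \<gamma>"
  shows "cm_hat \<gamma> h \<in> dual_closure \<gamma>" "cm_map \<gamma> (cm_hat \<gamma> h) = h"
  using someI_ex[of "\<lambda>f. f \<in> dual_closure \<gamma> \<and> cm_map \<gamma> f = h"] assms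
  by (auto simp: cm_space_def cm_hat_def)

lemma cm_hat_L2: "h \<in> cm_space \<gamma> \<Longrightarrow> cm_hat \<gamma> h \<in> L2 \<gamma>"
  by (intro dual_closure_L2 cm_hat)

lemma L2_scaleR_id_measurable: "f \<in> L2 \<gamma> \<Longrightarrow> (\<lambda>x. f x *\<^sub>R x) \<in> borel_measurable \<gamma>"
  by (intro borel_measurable_scaleR L2_measurable) (auto simp: borel_measurable_continuous continuous_on_id)

text \<open>If the integrand were not integrable, its integral would be the default value 0, so
  \<open>h = 0\<close>; but by \<open>cm_hat_zero\<close> the integrand then vanishes almost
  everywhere and is integrable after all.\<close>

lemma cm_hat_integrable:
  assumes h: "h \<in> cm_space \<gamma>"
  shows "integrable \<gamma> (\<lambda>x. cm_hat \<gamma> h x *\<^sub>R x)"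
proof (rule ccontr)
  assume not: "\<not> integrable \<gamma> (\<lambda>x. cm_hat \<gamma> h x *\<^sub>R x)"
  then have "h = 0"
    using cm_hat(2)[OF h] by (simp add: cm_map_def not_integrable_integral_eq)
  have "AE x in \<gamma>. cm_hat \<gamma> h x *\<^sub>R x = 0"
    using cm_hat_zero by eventually_elim (simp add: \<open>h = 0\<close>)
  then have "integrable \<gamma> (\<lambda>x. cm_hat \<gamma> h x *\<^sub>R x)"
    using integrable_cong_AE[of "\<lambda>x. cm_hat \<gamma> h x *\<^sub>R x" \<gamma> "\<lambda>x. 0"]
      L2_scaleR_id_measurable[OF cm_hat_L2[OF h]] by simp
  with not show False by simp
qed

lemma cm_hat_inner_functional:
  assumes h: "h \<in> cm_space \<gamma>"
  shows "L2_inner \<gamma> (cm_hat \<gamma> h) (blinfun_apply \<eta>) = blinfun_apply \<eta> h"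
proof -
  have "L2_inner \<gamma> (cm_hat \<gamma> h) (blinfun_apply \<eta>) = (\<integral>x. blinfun_apply \<eta> (cm_hat \<gamma> h x *\<^sub>R x) \<partial>\<gamma>)"
    by (simp add: L2_inner_def blinfun.scaleR_right)
  also have "\<dots> = blinfun_apply \<eta> (cm_map \<gamma> (cm_hat \<gamma> h))"
    unfolding cm_map_def
    by (rule integral_bounded_linear[OF blinfun.bounded_linear_right cm_hat_integrable[OF h]])
  finally show ?thesis
    by (simp add: cm_hat(2)[OF h])
qed

text \<open>As \<open>cm_hat\<close> is an arbitrary choice of preimage, its linearity and its
  values on the basis hold only almost everywhere; they are derived from this characterization by
  pairings with functionals.\<close>

lemma cm_hat_eqI:
  assumes "h \<in> cm_space \<gamma>" "f \<in> dual_closure \<gamma>"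
    and "\<And>\<eta> :: 'a \<Rightarrow>\<^sub>L real. L2_inner \<gamma> f (blinfun_apply \<eta>) = blinfun_apply \<eta> h"
  shows "AE x in \<gamma>. cm_hat \<gamma> h x = f x"
  by (rule dual_closure_eqI) (use assms in \<open>auto simp: cm_hat cm_hat_inner_functional\<close>)

lemma cm_space_lincomb:
  assumes "h \<in> cm_space \<gamma>" "k \<in> cm_space \<gamma>"
  shows "a *\<^sub>R h + b *\<^sub>R k \<in> cm_space \<gamma>"
proof -
  let ?f = "\<lambda>x. a * cm_hat \<gamma> h x + b * cm_hat \<gamma> k x"
  have "cm_map \<gamma> ?f = (\<integral>x. a *\<^sub>R (cm_hat \<gamma> h x *\<^sub>R x) + b *\<^sub>R (cm_hat \<gamma> k x *\<^sub>R x) \<partial>\<gamma>)"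
    by (simp add: cm_map_def scaleR_add_left)
  also have "\<dots> = a *\<^sub>R cm_map \<gamma> (cm_hat \<gamma> h) + b *\<^sub>R cm_map \<gamma> (cm_hat \<gamma> k)"
    unfolding cm_map_def integral_scaleR_right[symmetric]
    by (intro Bochner_Integration.integral_add integrable_scaleR_right cm_hat_integrable assms)
  finally have "cm_map \<gamma> ?f = a *\<^sub>R h + b *\<^sub>R k"
    using assms by (simp add: cm_hat)
  moreover have "?f \<in> dual_closure \<gamma>"
    using assms by (intro dual_closure_lincomb cm_hat)
  ultimately show ?thesis
    unfolding cm_space_def by (intro image_eqI[where x = ?f]) simp_all
qed

lemma cm_space_zero [simp]: "0 \<in> cm_space \<gamma>"
proof -
  have "cm_map \<gamma> (blinfun_apply 0) = 0"
    by (simp add: cm_map_def)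
  then show ?thesis
    using functional_dual_closure[of 0]
    unfolding cm_space_def by (intro image_eqI[where x = "blinfun_apply 0"]) simp_all
qed

lemma cm_space_scaleR: "h \<in> cm_space \<gamma> \<Longrightarrow> a *\<^sub>R h \<in> cm_space \<gamma>"
  using cm_space_lincomb[of h 0 a 0] by simp

lemma cm_space_add: "h \<in> cm_space \<gamma> \<Longrightarrow> k \<in> cm_space \<gamma> \<Longrightarrow> h + k \<in> cm_space \<gamma>"
  using cm_space_lincomb[of h k 1 1] by simp

lemma cm_space_sum: "(\<And>i. i \<in> I \<Longrightarrow> h i \<in> cm_space \<gamma>) \<Longrightarrow> (\<Sum>i\<in>I. c i *\<^sub>R h i) \<in> cm_space \<gamma>"
  by (induction I rule: infinite_finite_induct) (auto intro: cm_space_add cm_space_scaleR)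

lemma cm_hat_lincomb:
  assumes "h \<in> cm_space \<gamma>" "k \<in> cm_space \<gamma>"
  shows "AE x in \<gamma>. cm_hat \<gamma> (a *\<^sub>R h + b *\<^sub>R k) x = a * cm_hat \<gamma> h x + b * cm_hat \<gamma> k x"
  by (rule cm_hat_eqI)
    (use assms in \<open>auto simp: cm_space_lincomb dual_closure_lincomb cm_hat L2_inner_lincomb_left
      cm_hat_L2 functional_L2 cm_hat_inner_functional blinfun.bilinear_simps\<close>)

lemma cm_inner_commute: "cm_inner \<gamma> h k = cm_inner \<gamma> k h"
  by (simp add: cm_inner_def L2_inner_commute)

lemma cm_inner_lincomb_left:
  assumes "h \<in> cm_space \<gamma>" "k \<in> cm_space \<gamma>" "l \<in> cm_space \<gamma>"
  shows "cm_inner \<gamma> (a *\<^sub>R h + b *\<^sub>R k) l = a * cm_inner \<gamma> h l + b * cm_inner \<gamma> k l"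
proof -
  have "cm_inner \<gamma> (a *\<^sub>R h + b *\<^sub>R k) l = L2_inner \<gamma> (\<lambda>x. a * cm_hat \<gamma> h x + b * cm_hat \<gamma> k x) (cm_hat \<gamma> l)"
    unfolding cm_inner_def
    using cm_hat_lincomb[OF assms(1,2)] assms
    by (intro L2_inner_cong_AE) (auto intro: cm_hat_L2 cm_space_lincomb L2_lincomb)
  then show ?thesis
    using assms by (simp add: L2_inner_lincomb_left cm_hat_L2 cm_inner_def)
qed

lemma cm_inner_lincomb_right:
  assumes "h \<in> cm_space \<gamma>" "k \<in> cm_space \<gamma>" "l \<in> cm_space \<gamma>"
  shows "cm_inner \<gamma> l (a *\<^sub>R h + b *\<^sub>R k) = a * cm_inner \<gamma> l h + b * cm_inner \<gamma> l k"
  using cm_inner_lincomb_left[OF assms] by (simp add: cm_inner_commute)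

lemma cm_inner_zero_right [simp]: "h \<in> cm_space \<gamma> \<Longrightarrow> cm_inner \<gamma> h 0 = 0"
  using cm_inner_lincomb_right[of h h h 0 0] by simp

lemma cm_inner_scaleR_left: "h \<in> cm_space \<gamma> \<Longrightarrow> l \<in> cm_space \<gamma> \<Longrightarrow> cm_inner \<gamma> (a *\<^sub>R h) l = a * cm_inner \<gamma> h l"
  using cm_inner_lincomb_left[of h h l a 0] by simp

lemma cm_norm_square: "(cm_norm \<gamma> h)\<^sup>2 = cm_inner \<gamma> h h"
  by (simp add: cm_norm_def cm_inner_def L2_inner_self_nonneg)

lemma cm_norm_square_lincomb:
  assumes "h \<in> cm_space \<gamma>" "k \<in> cm_space \<gamma>"
  shows "(cm_norm \<gamma> (a *\<^sub>R h + b *\<^sub>R k))\<^sup>2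
    = a\<^sup>2 * (cm_norm \<gamma> h)\<^sup>2 + 2 * a * b * cm_inner \<gamma> h k + b\<^sup>2 * (cm_norm \<gamma> k)\<^sup>2"
  using assms unfolding cm_norm_square
  by (simp add: cm_inner_lincomb_left cm_inner_lincomb_right cm_space_lincomb cm_inner_commute[of k h]
      power2_eq_square algebra_simps)

lemma cm_norm_square_scaleR: "h \<in> cm_space \<gamma> \<Longrightarrow> (cm_norm \<gamma> (a *\<^sub>R h))\<^sup>2 = a\<^sup>2 * (cm_norm \<gamma> h)\<^sup>2"
  using cm_norm_square_lincomb[of h h a 0] by simp

lemma cm_norm_square_lincomb_le:
  assumes "h \<in> cm_space \<gamma>" "k \<in> cm_space \<gamma>"
  shows "(cm_norm \<gamma> (a *\<^sub>R h + b *\<^sub>R k))\<^sup>2 \<le> 2 * a\<^sup>2 * (cm_norm \<gamma> h)\<^sup>2 + 2 * b\<^sup>2 * (cm_norm \<gamma> k)\<^sup>2"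
  using cm_norm_square_lincomb[OF assms, of a b] cm_norm_square_lincomb[OF assms, of a "- b"]
    zero_le_power2[of "cm_norm \<gamma> (a *\<^sub>R h + (- b) *\<^sub>R k)"]
  by (simp del: zero_le_power2)

text \<open>The functional \<open>\<xi> j\<close> agrees almost everywhere with the chosen preimage
  of \<open>Q (\<xi> j)\<close>, so the coordinates of \<open>h\<close> in the basis are values of
  continuous functionals.\<close>

lemma cm_inner_basis:
  assumes j: "j \<in> J" and h: "h \<in> cm_space \<gamma>"
  shows "cm_inner \<gamma> h (Q (\<xi> j)) = blinfun_apply (\<xi> j) h"
proof -
  have "AE x in \<gamma>. cm_hat \<gamma> (Q (\<xi> j)) x = blinfun_apply (\<xi> j) x"
    by (rule cm_hat_eqI) (auto simp: basis_mem j functional_dual_closure covariance)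
  then have "cm_inner \<gamma> h (Q (\<xi> j)) = L2_inner \<gamma> (cm_hat \<gamma> h) (blinfun_apply (\<xi> j))"
    unfolding cm_inner_def using h j
    by (intro L2_inner_cong_AE) (auto intro: cm_hat_L2 functional_L2 basis_mem)
  then show ?thesis
    using h by (simp add: cm_hat_inner_functional)
qed

lemma functional_basis: "i \<in> J \<Longrightarrow> j \<in> J \<Longrightarrow> blinfun_apply (\<xi> i) (Q (\<xi> j)) = (if i = j then 1 else 0)"
  using cm_inner_basis[of i "Q (\<xi> j)"] basis_orthonormal[of j i] basis_mem by auto

text \<open>Used twice: with the coordinates of \<open>h\<close> as \<open>c\<close> for Bessel's
  inequality, and with unknown \<open>c\<close> for the approximation in the basis property.\<close>

lemma cm_norm_square_diff_sum:
  assumes F: "finite F" "F \<subseteq> J" and h: "h \<in> cm_space \<gamma>"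
  shows "(cm_norm \<gamma> (h - (\<Sum>j\<in>F. c j *\<^sub>R Q (\<xi> j))))\<^sup>2
    = (cm_norm \<gamma> h)\<^sup>2 + (\<Sum>j\<in>F. (c j)\<^sup>2 - 2 * c j * blinfun_apply (\<xi> j) h)"
proof -
  let ?s = "\<Sum>j\<in>F. c j *\<^sub>R Q (\<xi> j)"
  have sum: "(\<Sum>j\<in>G. c j *\<^sub>R Q (\<xi> j)) \<in> cm_space \<gamma>" if "G \<subseteq> J" for G
    using that by (intro cm_space_sum basis_mem) auto
  have inner: "cm_inner \<gamma> l (\<Sum>j\<in>G. c j *\<^sub>R Q (\<xi> j)) = (\<Sum>j\<in>G. c j * blinfun_apply (\<xi> j) l)"
    if "finite G" "G \<subseteq> J" "l \<in> cm_space \<gamma>" for G l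
    using that
  proof (induction G rule: finite_induct)
    case (insert j G)
    then show ?case
      using cm_inner_lincomb_right[of "Q (\<xi> j)" "\<Sum>j\<in>G. c j *\<^sub>R Q (\<xi> j)" l "c j" 1] sum[of G]
      by (simp add: basis_mem cm_inner_basis)
  qed simp
  have s: "?s \<in> cm_space \<gamma>" by (rule sum[OF F(2)])
  have coord: "blinfun_apply (\<xi> j) ?s = c j" if "j \<in> F" for j
  proof -
    have "blinfun_apply (\<xi> j) (Q (\<xi> i)) = (if j = i then 1 else 0)" if "i \<in> F" for i
      using functional_basis[of j i] F \<open>j \<in> F\<close> that by blast
    then have "blinfun_apply (\<xi> j) ?s = (\<Sum>i\<in>F. c i * (if j = i then 1 else 0))"
      by (simp add: blinfun.sum_right blinfun.scaleR_right)
    also have "\<dots> = (\<Sum>i\<in>F. if j = i then c i else 0)"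
      by (intro sum.cong) auto
    finally show ?thesis
      using F that by simp
  qed
  have "(cm_norm \<gamma> (h - ?s))\<^sup>2 = (cm_norm \<gamma> h)\<^sup>2 - 2 * cm_inner \<gamma> h ?s + cm_inner \<gamma> ?s ?s"
    using cm_norm_square_lincomb[OF h s, of 1 "-1"] by (simp add: cm_norm_square)
  also have "\<dots> = (cm_norm \<gamma> h)\<^sup>2 - 2 * (\<Sum>j\<in>F. c j * blinfun_apply (\<xi> j) h) + (\<Sum>j\<in>F. c j * c j)"
    using inner[OF F h] inner[OF F s] coord by simp
  finally show ?thesis
    by (simp add: sum_subtractf sum_distrib_left power2_eq_square mult.assoc)
qed

text \<open>The basis property offers finite combinations with unknown coefficients; completing the
  square shows that the coordinates of \<open>h\<close> do at least as well, and Bessel's inequality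
  is the upper bound. The limit makes \<open>cm_norm\<close>, which is defined through a choice,
  measurable along measurable fields.\<close>

lemma parseval:
  assumes h: "h \<in> cm_space \<gamma>"
  shows "(\<lambda>n. \<Sum>j\<in>J \<inter> {..<n}. (blinfun_apply (\<xi> j) h)\<^sup>2) \<longlonglongrightarrow> (cm_norm \<gamma> h)\<^sup>2"
proof (rule LIMSEQ_I)
  let ?a = "\<lambda>j. (blinfun_apply (\<xi> j) h)\<^sup>2"
  have le: "(\<Sum>j\<in>F. ?a j) \<le> (cm_norm \<gamma> h)\<^sup>2" if "finite F" "F \<subseteq> J" for F
    using cm_norm_square_diff_sum[OF that h, of "\<lambda>j. blinfun_apply (\<xi> j) h"]
      zero_le_power2[of "cm_norm \<gamma> (h - (\<Sum>j\<in>F. blinfun_apply (\<xi> j) h *\<^sub>R Q (\<xi> j)))"]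
    by (simp add: power2_eq_square sum_subtractf sum_negf)
  fix e :: real assume e: "e > 0"
  then have "sqrt e > 0" by simp
  then obtain F c where F: "finite F" "F \<subseteq> J" and "cm_norm \<gamma> (h - (\<Sum>j\<in>F. c j *\<^sub>R Q (\<xi> j))) < sqrt e"
    using basis h unfolding wiener_basis_def cm_orthonormal_basis_def by blast
  moreover have "cm_norm \<gamma> k \<ge> 0" for k
    by (simp add: cm_norm_def cm_inner_def L2_inner_self_nonneg)
  ultimately have "(cm_norm \<gamma> (h - (\<Sum>j\<in>F. c j *\<^sub>R Q (\<xi> j))))\<^sup>2 < (sqrt e)\<^sup>2"
    by (intro power_strict_mono) auto
  then have "(cm_norm \<gamma> h)\<^sup>2 + (\<Sum>j\<in>F. (c j)\<^sup>2 - 2 * c j * blinfun_apply (\<xi> j) h) < e"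
    using e by (simp add: cm_norm_square_diff_sum[OF F h])
  moreover have "(\<Sum>j\<in>F. - ?a j) \<le> (\<Sum>j\<in>F. (c j)\<^sup>2 - 2 * c j * blinfun_apply (\<xi> j) h)"
  proof (rule sum_mono)
    fix j
    show "- ?a j \<le> (c j)\<^sup>2 - 2 * c j * blinfun_apply (\<xi> j) h"
      using zero_le_power2[of "c j - blinfun_apply (\<xi> j) h"] by (simp add: power2_eq_square algebra_simps)
  qed
  ultimately have F': "(cm_norm \<gamma> h)\<^sup>2 - e < (\<Sum>j\<in>F. ?a j)"
    by (simp add: sum_negf)
  obtain N where N: "\<And>j. j \<in> F \<Longrightarrow> j < N"
    using F(1) unfolding finite_nat_set_iff_bounded by blast
  show "\<exists>N. \<forall>n\<ge>N. norm ((\<Sum>j\<in>J \<inter> {..<n}. ?a j) - (cm_norm \<gamma> h)\<^sup>2) < e"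
  proof (intro exI[of _ N] allI impI)
    fix n assume "n \<ge> N"
    have "(\<Sum>j\<in>F. ?a j) \<le> (\<Sum>j\<in>J \<inter> {..<n}. ?a j)"
      by (rule sum_mono2) (use F N \<open>n \<ge> N\<close> in \<open>auto intro: less_le_trans\<close>)
    moreover have "(\<Sum>j\<in>J \<inter> {..<n}. ?a j) \<le> (cm_norm \<gamma> h)\<^sup>2"
      by (rule le) auto
    ultimately show "norm ((\<Sum>j\<in>J \<inter> {..<n}. ?a j) - (cm_norm \<gamma> h)\<^sup>2) < e"
      using F' by simp
  qed
qed

lemma cm_norm_square_measurable:
  assumes [measurable]: "F \<in> borel_measurable \<gamma>" and F: "\<And>x. F x \<in> cm_space \<gamma>"
  shows "(\<lambda>x. (cm_norm \<gamma> (F x))\<^sup>2) \<in> borel_measurable \<gamma>"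
proof (rule borel_measurable_LIMSEQ_real)
  show "(\<lambda>n. \<Sum>j\<in>J \<inter> {..<n}. (blinfun_apply (\<xi> j) (F x))\<^sup>2) \<longlonglongrightarrow> (cm_norm \<gamma> (F x))\<^sup>2" for x
    by (rule parseval[OF F])
  have "(\<lambda>x. blinfun_apply (\<xi> j) (F x)) \<in> borel_measurable \<gamma>" for j
    using measurable_compose[OF assms(1) borel_measurable_continuous_onI[OF continuous_functional]] .
  then show "(\<lambda>x. \<Sum>j\<in>J \<inter> {..<n}. (blinfun_apply (\<xi> j) (F x))\<^sup>2) \<in> borel_measurable \<gamma>" for n
    by (intro borel_measurable_sum borel_measurable_power)
qed

section \<open>Square-integrable fields\<close>

lemma L2_fieldD:
  assumes "F \<in> L2_field \<gamma>"
  shows "F \<in> borel_measurable \<gamma>" "\<And>x. F x \<in> cm_space \<gamma>" "integrable \<gamma> (\<lambda>x. (cm_norm \<gamma> (F x))\<^sup>2)"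
  using assms by (auto simp: L2_field_def)

lemma L2_field_bounded:
  assumes F: "F \<in> borel_measurable \<gamma>" "\<And>x. F x \<in> cm_space \<gamma>"
    and g: "integrable \<gamma> g" "\<And>x. (cm_norm \<gamma> (F x))\<^sup>2 \<le> g x"
  shows "F \<in> L2_field \<gamma>"
proof -
  have "integrable \<gamma> (\<lambda>x. (cm_norm \<gamma> (F x))\<^sup>2)"
    by (rule Bochner_Integration.integrable_bound[OF g(1) cm_norm_square_measurable[OF F]])
      (use g(2) in \<open>auto intro!: AE_I2 intro: order_trans[OF _ abs_ge_self]\<close>)
  then show ?thesis
    using F by (simp add: L2_field_def)
qed

lemma L2_field_lincomb:
  assumes F: "F \<in> L2_field \<gamma>" and G: "G \<in> L2_field \<gamma>"
  shows "(\<lambda>x. a *\<^sub>R F x + b *\<^sub>R G x) \<in> L2_field \<gamma>"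
proof (rule L2_field_bounded)
  show "(\<lambda>x. a *\<^sub>R F x + b *\<^sub>R G x) \<in> borel_measurable \<gamma>"
    using L2_fieldD(1)[OF F] L2_fieldD(1)[OF G] by simp
  show "integrable \<gamma> (\<lambda>x. 2 * a\<^sup>2 * (cm_norm \<gamma> (F x))\<^sup>2 + 2 * b\<^sup>2 * (cm_norm \<gamma> (G x))\<^sup>2)"
    using L2_fieldD(3)[OF F] L2_fieldD(3)[OF G] by simp
qed (auto intro: cm_space_lincomb cm_norm_square_lincomb_le L2_fieldD F G)

lemma L2_field_mult:
  assumes F: "F \<in> L2_field \<gamma>" and k: "k \<in> borel_measurable \<gamma>" "\<And>x. \<bar>k x\<bar> \<le> K"
  shows "(\<lambda>x. k x *\<^sub>R F x) \<in> L2_field \<gamma>"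
proof (rule L2_field_bounded)
  show "(\<lambda>x. k x *\<^sub>R F x) \<in> borel_measurable \<gamma>"
    using L2_fieldD(1)[OF F] k(1) by simp
  show "integrable \<gamma> (\<lambda>x. K\<^sup>2 * (cm_norm \<gamma> (F x))\<^sup>2)"
    using L2_fieldD(3)[OF F] by simp
  have "(k x)\<^sup>2 \<le> K\<^sup>2" for x
    using k(2)[of x] by (simp add: abs_le_square_iff[symmetric])
  then show "(cm_norm \<gamma> (k x *\<^sub>R F x))\<^sup>2 \<le> K\<^sup>2 * (cm_norm \<gamma> (F x))\<^sup>2" for x
    by (simp add: cm_norm_square_scaleR L2_fieldD(2)[OF F] mult_right_mono)
qed (auto intro: cm_space_scaleR L2_fieldD F)

text \<open>By polarization, measurability of the inner product also comes from that of
  norms.\<close>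

lemma integrable_cm_inner:
  assumes F: "F \<in> L2_field \<gamma>" and G: "G \<in> L2_field \<gamma>"
  shows "integrable \<gamma> (\<lambda>x. cm_inner \<gamma> (F x) (G x))"
proof -
  have eq: "cm_inner \<gamma> (F x) (G x) = ((cm_norm \<gamma> (1 *\<^sub>R F x + 1 *\<^sub>R G x))\<^sup>2 - (cm_norm \<gamma> (1 *\<^sub>R F x + (-1) *\<^sub>R G x))\<^sup>2) / 4" for x
    using cm_norm_square_lincomb[OF L2_fieldD(2)[OF F] L2_fieldD(2)[OF G], of 1 x 1 x]
      cm_norm_square_lincomb[OF L2_fieldD(2)[OF F] L2_fieldD(2)[OF G], of 1 x "-1" x]
    by simp
  show ?thesis
    unfolding eq
    by (intro Bochner_Integration.integrable_diff Bochner_Integration.integrable_divide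
        L2_fieldD(3)[OF L2_field_lincomb[OF F G]])
qed

end

section \<open>Cylindrical functions and the gradient\<close>

lemma C1b_local: "C1b m v \<Longrightarrow> (\<And>i. i < m \<Longrightarrow> y i = z i) \<Longrightarrow> v y = v z"
  unfolding C1b_def by blast

lemma C1b_partialE:
  assumes "C1b m v" "i < m"
  obtains d where "\<And>y. ((\<lambda>t. v (y(i := t))) has_real_derivative d y) (at (y i))"
    "continuous_on UNIV d" "bounded (range d)"
proof -
  have "\<exists>d. (\<forall>y. ((\<lambda>t. v (y(i := t))) has_real_derivative d y) (at (y i))) \<and>
        continuous_on UNIV d \<and> bounded (range d)"
    using assms by (simp add: C1b_def)
  then show thesis
    by (elim exE conjE) (rule that, auto)
qed

lemma C1b_mono:
  assumes v: "C1b m v" and "m \<le> m'"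
  shows "C1b m' v"
proof -
  have "\<exists>d. (\<forall>y. ((\<lambda>t. v (y(i := t))) has_real_derivative d y) (at (y i))) \<and>
        continuous_on UNIV d \<and> bounded (range d)" for i
  proof (cases "i < m")
    case True
    then show ?thesis using v by (simp add: C1b_def)
  next
    case False
    have "v (y(i := t)) = v y" for y t
      by (rule C1b_local[OF v]) (use False in auto)
    then show ?thesis
      by (intro exI[of _ "\<lambda>_. 0"]) auto
  qed
  then show ?thesis
    using assms unfolding C1b_def by auto
qed

lemma C1b_const: "C1b 0 (\<lambda>_. c)"
  by (simp add: C1b_def)

lemma C1b_lincomb:
  assumes v: "C1b m v" and w: "C1b m w"
  shows "C1b m (\<lambda>y. a * v y + b * w y)"
  unfolding C1b_def
proof (intro conjI allI impI)
  fix y z :: "nat \<Rightarrow> real" assume "\<forall>i<m. y i = z i"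
  then show "a * v y + b * w y = a * v z + b * w z"
    using C1b_local[OF v, of y z] C1b_local[OF w, of y z] by simp
next
  show "continuous_on UNIV (\<lambda>y. a * v y + b * w y)"
    using v w by (auto simp: C1b_def intro!: continuous_intros)
  have bdd: "bounded (range (\<lambda>y. a * p y + b * q y))"
    if pq: "bounded (range p)" "bounded (range q)" for p q :: "(nat \<Rightarrow> real) \<Rightarrow> real"
  proof -
    obtain A B where A: "\<And>y. \<bar>p y\<bar> \<le> A" and B: "\<And>y. \<bar>q y\<bar> \<le> B"
      using pq by (auto simp: bounded_iff)
    have "\<bar>a * p y + b * q y\<bar> \<le> \<bar>a\<bar> * A + \<bar>b\<bar> * B" for y
      by (rule order_trans[OF abs_triangle_ineq])
        (unfold abs_mult, intro add_mono mult_left_mono A B abs_ge_zero)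
    then show ?thesis
      by (auto simp: bounded_iff)
  qed
  show "bounded (range (\<lambda>y. a * v y + b * w y))"
    using v w by (intro bdd) (auto simp: C1b_def)
  fix i assume "i < m"
  obtain d where
    d: "\<And>y. ((\<lambda>t. v (y(i := t))) has_real_derivative d y) (at (y i))" "continuous_on UNIV d" "bounded (range d)"
    using C1b_partialE[OF v \<open>i < m\<close>] by blast
  obtain e where
    e: "\<And>y. ((\<lambda>t. w (y(i := t))) has_real_derivative e y) (at (y i))" "continuous_on UNIV e" "bounded (range e)"
    using C1b_partialE[OF w \<open>i < m\<close>] by blast
  show "\<exists>d. (\<forall>y. ((\<lambda>t. a * v (y(i := t)) + b * w (y(i := t))) has_real_derivative d y) (at (y i))) \<and>
      continuous_on UNIV d \<and> bounded (range d)"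
  proof (intro exI[of _ "\<lambda>y. a * d y + b * e y"] conjI allI)
    show "((\<lambda>t. a * v (y(i := t)) + b * w (y(i := t))) has_real_derivative a * d y + b * e y) (at (y i))" for y
      by (intro DERIV_add DERIV_cmult d e)
    show "continuous_on UNIV (\<lambda>y. a * d y + b * e y)"
      by (intro continuous_intros d e)
  qed (rule bdd[OF d(3) e(3)])
qed

text \<open>\<open>\<psi>\<close> itself may be unbounded, but it is bounded on the compact closure
  of the range of \<open>v\<close>.\<close>

lemma bounded_range_comp:
  fixes \<psi> :: "real \<Rightarrow> real"
  assumes "continuous_on UNIV \<psi>" "bounded (range v)"
  shows "bounded (range (\<lambda>y. \<psi> (v y)))"
proof -
  have "compact (\<psi> ` closure (range v))"
    using assms by (intro compact_continuous_image) (auto intro: continuous_on_subset simp: compact_closure)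
  moreover have "range (\<lambda>y. \<psi> (v y)) \<subseteq> \<psi> ` closure (range v)"
    using closure_subset[of "range v"] by auto
  ultimately show ?thesis
    using bounded_subset compact_imp_bounded by blast
qed

lemma bounded_range_mult:
  fixes f g :: "'b \<Rightarrow> real"
  assumes "bounded (range f)" "bounded (range g)"
  shows "bounded (range (\<lambda>y. f y * g y))"
proof -
  obtain A B where "\<And>y. \<bar>f y\<bar> \<le> A" "\<And>y. \<bar>g y\<bar> \<le> B"
    using assms by (auto simp: bounded_iff)
  then have "\<bar>f y * g y\<bar> \<le> A * B" for y
    unfolding abs_mult by (intro mult_mono) (auto intro: order_trans[OF abs_ge_zero])
  then show ?thesis
    by (auto simp: bounded_iff)
qed

lemma C1b_compose:
  assumes v: "C1b m v" and \<psi>: "\<And>t. (\<psi> has_real_derivative \<psi>' t) (at t)" and cont: "continuous_on UNIV \<psi>'"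
  shows "C1b m (\<lambda>y. \<psi> (v y))"
proof -
  have c\<psi>: "continuous_on UNIV \<psi>"
    using \<psi> DERIV_continuous continuous_at_imp_continuous_on by blast
  have cv: "continuous_on UNIV v" and bv: "bounded (range v)"
    using v by (auto simp: C1b_def)
  have comp: "continuous_on UNIV (\<lambda>y. g (v y))" if "continuous_on UNIV g" for g :: "real \<Rightarrow> real"
    by (rule continuous_on_compose2[OF that cv]) simp
  have "\<exists>d. (\<forall>y. ((\<lambda>t. \<psi> (v (y(i := t)))) has_real_derivative d y) (at (y i))) \<and>
      continuous_on UNIV d \<and> bounded (range d)" if i: "i < m" for i
  proof -
    obtain d where
      d: "\<And>y. ((\<lambda>t. v (y(i := t))) has_real_derivative d y) (at (y i))" "continuous_on UNIV d" "bounded (range d)"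
      using C1b_partialE[OF v i] by blast
    have "((\<lambda>t. \<psi> (v (y(i := t)))) has_real_derivative \<psi>' (v y) * d y) (at (y i))" for y
      by (rule DERIV_chain2[OF _ d(1)]) (simp add: \<psi>)
    moreover have "continuous_on UNIV (\<lambda>y. \<psi>' (v y) * d y)"
      by (intro continuous_on_mult comp cont d)
    moreover have "bounded (range (\<lambda>y. \<psi>' (v y) * d y))"
      by (rule bounded_range_mult[OF bounded_range_comp[OF cont bv] d(3)])
    ultimately show ?thesis
      by (intro exI[of _ "\<lambda>y. \<psi>' (v y) * d y"] conjI allI)
  qed
  moreover have "\<psi> (v y) = \<psi> (v z)" if "\<forall>i<m. y i = z i" for y z
    by (rule arg_cong[where f = \<psi>], rule C1b_local[OF v]) (use that in blast)
  ultimately show ?thesis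
    unfolding C1b_def using comp[OF c\<psi>] bounded_range_comp[OF c\<psi> bv] by (intro conjI allI impI) auto
qed

context wiener_space
begin

abbreviation coords :: "'a \<Rightarrow> nat \<Rightarrow> real" where
  "coords x \<equiv> \<lambda>i. blinfun_apply (\<xi> i) x"

abbreviation D :: "nat \<Rightarrow> ('a \<Rightarrow> real) \<Rightarrow> 'a \<Rightarrow> real" where
  "D j \<equiv> dir_deriv (Q (\<xi> j))"

abbreviation grad :: "('a \<Rightarrow> real) \<Rightarrow> 'a \<Rightarrow> 'a" where
  "grad \<equiv> cyl_gradient Q J \<xi>"

abbreviation has_grad :: "('a \<Rightarrow> real) \<Rightarrow> ('a \<Rightarrow> 'a) \<Rightarrow> bool" where
  "has_grad \<equiv> wiener_gradient \<gamma> Q J \<xi>"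

section \<open>Gradients of cylindrical functions\<close>

lemma continuous_coords: "continuous_on UNIV coords"
  by (intro continuous_on_coordinatewise_then_product continuous_functional)

lemma continuous_on_coords: "continuous_on UNIV v \<Longrightarrow> continuous_on UNIV (\<lambda>x. v (coords x))" for v :: "(nat \<Rightarrow> real) \<Rightarrow> real"
  by (rule continuous_on_compose2[OF _ continuous_coords]) auto

text \<open>By orthonormality a step along \<open>Q (\<xi> j)\<close> changes, among the first
  \<open>m\<close> coordinates, at most coordinate \<open>j\<close>. The directional derivative is
  thus a partial derivative of \<open>v\<close>, or 0 if \<open>v\<close> does not depend on that
  coordinate.\<close>

lemma cyl_partial:
  assumes v: "C1b m v" and m: "{..<m} \<subseteq> J" and j: "j \<in> J"
  shows "\<exists>d. (\<forall>x. ((\<lambda>t. v (coords (x + t *\<^sub>R Q (\<xi> j)))) has_real_derivative d x) (at 0)) \<and>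
    continuous_on UNIV d \<and> bounded (range d) \<and> (m \<le> j \<longrightarrow> d = (\<lambda>x. 0))"
proof -
  have loc: "v (coords (x + t *\<^sub>R Q (\<xi> j))) = v ((coords x)(j := coords x j + t))" for x t
  proof -
    have "blinfun_apply (\<xi> i) (x + t *\<^sub>R Q (\<xi> j)) = ((coords x)(j := coords x j + t)) i" if "i < m" for i
      using functional_basis[of i j] j m that by (auto simp: blinfun.bilinear_simps)
    then show ?thesis
      by (rule C1b_local[OF v])
  qed
  show ?thesis
  proof (cases "j < m")
    case True
    obtain d where
      d: "\<And>y. ((\<lambda>t. v (y(j := t))) has_real_derivative d y) (at (y j))" "continuous_on UNIV d" "bounded (range d)"
      using C1b_partialE[OF v True] by blast
    have "((\<lambda>t. v (coords (x + t *\<^sub>R Q (\<xi> j)))) has_real_derivative d (coords x)) (at 0)" for x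
    proof -
      have "((\<lambda>t. v ((coords x)(j := coords x j + t))) has_real_derivative d (coords x)) (at 0)"
        using d(1)[of "coords x"] DERIV_at_within_shift[of "\<lambda>t. v ((coords x)(j := t))" "d (coords x)" "coords x j" 0 UNIV]
        by (simp add: o_def)
      then show ?thesis by (simp add: loc)
    qed
    moreover have "bounded (range (\<lambda>x. d (coords x)))"
      by (rule bounded_subset[OF d(3)]) auto
    ultimately show ?thesis
      using True continuous_on_coords[OF d(2)] by (intro exI[of _ "\<lambda>x. d (coords x)"]) auto
  next
    case False
    have "v ((coords x)(j := coords x j + t)) = v (coords x)" for x t
      by (rule C1b_local[OF v]) (use False in auto)
    then show ?thesis
      by (intro exI[of _ "\<lambda>x. 0"]) (auto simp: loc)
  qed
qed

lemma cyl_D: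
  assumes v: "C1b m v" and m: "{..<m} \<subseteq> J" and j: "j \<in> J"
  shows "((\<lambda>t. v (coords (x + t *\<^sub>R Q (\<xi> j)))) has_real_derivative D j (\<lambda>x. v (coords x)) x) (at 0)"
    and "continuous_on UNIV (D j (\<lambda>x. v (coords x)))" "bounded (range (D j (\<lambda>x. v (coords x))))"
    and "m \<le> j \<Longrightarrow> D j (\<lambda>x. v (coords x)) x = 0"
proof -
  obtain d where d: "\<forall>x. ((\<lambda>t. v (coords (x + t *\<^sub>R Q (\<xi> j)))) has_real_derivative d x) (at 0)"
    "continuous_on UNIV d" "bounded (range d)" "m \<le> j \<longrightarrow> d = (\<lambda>x. 0)"
    using cyl_partial[OF assms] by (elim exE conjE)
  have "D j (\<lambda>x. v (coords x)) = d"
    unfolding dir_deriv_def by (rule ext, rule DERIV_imp_deriv, rule d(1)[rule_format])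
  then show "((\<lambda>t. v (coords (x + t *\<^sub>R Q (\<xi> j)))) has_real_derivative D j (\<lambda>x. v (coords x)) x) (at 0)"
    "continuous_on UNIV (D j (\<lambda>x. v (coords x)))" "bounded (range (D j (\<lambda>x. v (coords x))))"
    "m \<le> j \<Longrightarrow> D j (\<lambda>x. v (coords x)) x = 0"
    using d by auto
qed

lemma cyl_gradient_eq:
  assumes v: "C1b m v" and m: "{..<m} \<subseteq> J"
  shows "grad (\<lambda>x. v (coords x)) x = (\<Sum>j<m. D j (\<lambda>x. v (coords x)) x *\<^sub>R Q (\<xi> j))"
proof -
  have "grad (\<lambda>x. v (coords x)) x = (\<Sum>\<^sub>\<infinity>j\<in>{..<m}. D j (\<lambda>x. v (coords x)) x *\<^sub>R Q (\<xi> j))"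
    unfolding cyl_gradient_def
  proof (rule infsum_cong_neutral)
    fix j assume "j \<in> J - {..<m}"
    then show "D j (\<lambda>x. v (coords x)) x *\<^sub>R Q (\<xi> j) = 0"
      using cyl_D(4)[OF assms, of j x] by simp
  qed (use m in auto)
  then show ?thesis by simp
qed

lemma cyl_gradient_lincomb:
  assumes v: "C1b m v" and w: "C1b m w" and m: "{..<m} \<subseteq> J"
  shows "grad (\<lambda>x. a * v (coords x) + b * w (coords x)) x
    = a *\<^sub>R grad (\<lambda>x. v (coords x)) x + b *\<^sub>R grad (\<lambda>x. w (coords x)) x"
proof -
  have D: "D j (\<lambda>x. a * v (coords x) + b * w (coords x)) x = a * D j (\<lambda>x. v (coords x)) x + b * D j (\<lambda>x. w (coords x)) x"
    if "j \<in> J" for j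
    unfolding dir_deriv_def[of _ "\<lambda>x. a * v (coords x) + b * w (coords x)"]
    by (rule DERIV_imp_deriv, intro DERIV_add DERIV_cmult cyl_D(1)[OF v m that] cyl_D(1)[OF w m that])
  have "grad (\<lambda>x. a * v (coords x) + b * w (coords x)) x
      = (\<Sum>j<m. D j (\<lambda>x. a * v (coords x) + b * w (coords x)) x *\<^sub>R Q (\<xi> j))"
    by (rule cyl_gradient_eq[OF C1b_lincomb[OF v w] m])
  also have "\<dots> = (\<Sum>j<m. a *\<^sub>R (D j (\<lambda>x. v (coords x)) x *\<^sub>R Q (\<xi> j)) + b *\<^sub>R (D j (\<lambda>x. w (coords x)) x *\<^sub>R Q (\<xi> j)))"
    using m by (intro sum.cong refl) (auto simp: D scaleR_add_left)
  finally show ?thesis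
    by (simp add: cyl_gradient_eq[OF v m] cyl_gradient_eq[OF w m] sum.distrib scaleR_sum_right)
qed

lemma cyl_gradient_compose:
  assumes v: "C1b m v" and m: "{..<m} \<subseteq> J"
    and \<psi>: "\<And>t. (\<psi> has_real_derivative \<psi>' t) (at t)" and cont: "continuous_on UNIV \<psi>'"
  shows "grad (\<lambda>x. \<psi> (v (coords x))) x = \<psi>' (v (coords x)) *\<^sub>R grad (\<lambda>x. v (coords x)) x"
proof -
  have D: "D j (\<lambda>x. \<psi> (v (coords x))) x = \<psi>' (v (coords x)) * D j (\<lambda>x. v (coords x)) x" if "j \<in> J" for j
    unfolding dir_deriv_def[of _ "\<lambda>x. \<psi> (v (coords x))"]
    by (rule DERIV_imp_deriv, rule DERIV_chain2[OF _ cyl_D(1)[OF v m that]]) (simp add: \<psi>)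
  have "grad (\<lambda>x. \<psi> (v (coords x))) x = (\<Sum>j<m. D j (\<lambda>x. \<psi> (v (coords x))) x *\<^sub>R Q (\<xi> j))"
    by (rule cyl_gradient_eq[OF C1b_compose[OF v \<psi> cont] m])
  also have "\<dots> = (\<Sum>j<m. \<psi>' (v (coords x)) *\<^sub>R (D j (\<lambda>x. v (coords x)) x *\<^sub>R Q (\<xi> j)))"
    using m by (intro sum.cong refl) (auto simp: D)
  finally show ?thesis
    by (simp add: cyl_gradient_eq[OF v m] scaleR_sum_right)
qed

lemma L2_field_zero: "(\<lambda>x. 0) \<in> L2_field \<gamma>"
  by (auto simp: L2_field_def cm_norm_square)

lemma L2_field_const: "h \<in> cm_space \<gamma> \<Longrightarrow> (\<lambda>x. h) \<in> L2_field \<gamma>"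
  by (simp add: L2_field_def)

lemma L2_field_sum: "finite I \<Longrightarrow> (\<And>i. i \<in> I \<Longrightarrow> F i \<in> L2_field \<gamma>) \<Longrightarrow> (\<lambda>x. \<Sum>i\<in>I. F i x) \<in> L2_field \<gamma>"
proof (induction I rule: finite_induct)
  case (insert i I)
  then show ?case
    using L2_field_lincomb[of "F i" "\<lambda>x. \<Sum>i\<in>I. F i x" 1 1] by simp
qed (simp add: L2_field_zero)

lemma cyl_L2: 
  assumes "C1b m v"
  shows "(\<lambda>x. v (coords x)) \<in> L2 \<gamma>"
proof -
  have "continuous_on UNIV (\<lambda>x. v (coords x))"
    using assms by (intro continuous_on_coords) (simp add: C1b_def)
  then have m: "(\<lambda>x. v (coords x)) \<in> borel_measurable \<gamma>"
    by (rule borel_measurable_continuous)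
  obtain B where B: "\<And>y. \<bar>v y\<bar> \<le> B"
    using assms by (auto simp: C1b_def bounded_iff)
  have "(\<lambda>x. v (coords x) * 1) \<in> L2 \<gamma>"
    by (rule L2_bounded_mult[OF _ m B]) simp
  then show ?thesis by simp
qed

lemma cyl_gradient_L2_field:
  assumes v: "C1b m v" and m: "{..<m} \<subseteq> J"
  shows "grad (\<lambda>x. v (coords x)) \<in> L2_field \<gamma>"
proof -
  have "(\<lambda>x. \<Sum>j<m. D j (\<lambda>x. v (coords x)) x *\<^sub>R Q (\<xi> j)) \<in> L2_field \<gamma>"
  proof (rule L2_field_sum)
    fix j assume "j \<in> {..<m}"
    then have j: "j \<in> J" using m by auto
    obtain B where "\<And>x. \<bar>D j (\<lambda>x. v (coords x)) x\<bar> \<le> B"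
      using cyl_D(3)[OF assms j] by (auto simp: bounded_iff)
    then show "(\<lambda>x. D j (\<lambda>x. v (coords x)) x *\<^sub>R Q (\<xi> j)) \<in> L2_field \<gamma>"
      by (intro L2_field_mult[OF L2_field_const[OF basis_mem[OF j]]] borel_measurable_continuous cyl_D(2)[OF assms j])
  qed simp
  then show ?thesis
    unfolding cyl_gradient_eq[OF assms, abs_def] .
qed

lemma C1b_cylindricalE:
  assumes "C1b_cylindrical J \<xi> u"
  obtains m v where "{..<m} \<subseteq> J" "C1b m v" "u = (\<lambda>x. v (coords x))"
  using assms by (auto simp: C1b_cylindrical_def)

lemma C1b_cylindrical_pairE:
  assumes "C1b_cylindrical J \<xi> u" "C1b_cylindrical J \<xi> u'"
  obtains m v v' where "{..<m} \<subseteq> J" "C1b m v" "C1b m v'" "u = (\<lambda>x. v (coords x))" "u' = (\<lambda>x. v' (coords x))"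
proof -
  obtain m v where v: "{..<m} \<subseteq> J" "C1b m v" "u = (\<lambda>x. v (coords x))"
    using assms(1) by (rule C1b_cylindricalE)
  obtain m' v' where v': "{..<m'} \<subseteq> J" "C1b m' v'" "u' = (\<lambda>x. v' (coords x))"
    using assms(2) by (rule C1b_cylindricalE)
  have "{..<max m m'} \<subseteq> J"
    using v(1) v'(1) by (auto simp: max_def)
  then show thesis
    using that[OF _ C1b_mono[OF v(2)] C1b_mono[OF v'(2)] v(3) v'(3), of "max m m'"] by simp
qed

section \<open>Linearity and chain rule for the closed gradient\<close>

lemma wiener_gradient_lincomb:
  assumes "has_grad u F" "has_grad w G"
  shows "has_grad (\<lambda>x. a * u x + b * w x) (\<lambda>x. a *\<^sub>R F x + b *\<^sub>R G x)"
proof -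
  obtain U where U: "\<And>n. C1b_cylindrical J \<xi> (U n)" and Ul: "(\<lambda>n. \<integral>x. (U n x - u x)\<^sup>2 \<partial>\<gamma>) \<longlonglongrightarrow> 0"
    and Ug: "(\<lambda>n. \<integral>x. (cm_norm \<gamma> (grad (U n) x - F x))\<^sup>2 \<partial>\<gamma>) \<longlonglongrightarrow> 0"
    and u: "u \<in> L2 \<gamma>" and F: "F \<in> L2_field \<gamma>"
    using assms(1) by (auto simp: wiener_gradient_def)
  obtain W where W: "\<And>n. C1b_cylindrical J \<xi> (W n)" and Wl: "(\<lambda>n. \<integral>x. (W n x - w x)\<^sup>2 \<partial>\<gamma>) \<longlonglongrightarrow> 0"
    and Wg: "(\<lambda>n. \<integral>x. (cm_norm \<gamma> (grad (W n) x - G x))\<^sup>2 \<partial>\<gamma>) \<longlonglongrightarrow> 0"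
    and w: "w \<in> L2 \<gamma>" and G: "G \<in> L2_field \<gamma>"
    using assms(2) by (auto simp: wiener_gradient_def)
  define V where "V n x = a * U n x + b * W n x" for n x
  have V: "C1b_cylindrical J \<xi> (V n)"
    and Vg: "grad (V n) x = a *\<^sub>R grad (U n) x + b *\<^sub>R grad (W n) x"
    and UL: "U n \<in> L2 \<gamma>" "W n \<in> L2 \<gamma>"
    and UF: "grad (U n) \<in> L2_field \<gamma>" "grad (W n) \<in> L2_field \<gamma>" for n x
  proof -
    obtain m p q where m: "{..<m} \<subseteq> J" and p: "C1b m p" "U n = (\<lambda>x. p (coords x))"
      and q: "C1b m q" "W n = (\<lambda>x. q (coords x))"
      using U[of n] W[of n] by (rule C1b_cylindrical_pairE)
    have Vn: "V n = (\<lambda>x. a * p (coords x) + b * q (coords x))"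
      by (simp add: V_def[abs_def] p q)
    show "C1b_cylindrical J \<xi> (V n)"
      unfolding C1b_cylindrical_def Vn using m C1b_lincomb[OF p(1) q(1), of a b] by blast
    show "grad (V n) x = a *\<^sub>R grad (U n) x + b *\<^sub>R grad (W n) x"
      unfolding Vn p q by (rule cyl_gradient_lincomb[OF p(1) q(1) m])
    show "U n \<in> L2 \<gamma>" "W n \<in> L2 \<gamma>"
      unfolding p q by (rule cyl_L2[OF p(1)], rule cyl_L2[OF q(1)])
    show "grad (U n) \<in> L2_field \<gamma>" "grad (W n) \<in> L2_field \<gamma>"
      unfolding p q by (rule cyl_gradient_L2_field[OF p(1) m], rule cyl_gradient_L2_field[OF q(1) m])
  qed
  have "(\<lambda>n. \<integral>x. (V n x - (a * u x + b * w x))\<^sup>2 \<partial>\<gamma>) \<longlonglongrightarrow> 0"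
    unfolding V_def by (rule L2_tendsto_lincomb[OF UL(1) u Ul UL(2) w Wl])
  moreover have "(\<lambda>n. \<integral>x. (cm_norm \<gamma> (grad (V n) x - (a *\<^sub>R F x + b *\<^sub>R G x)))\<^sup>2 \<partial>\<gamma>) \<longlonglongrightarrow> 0"
  proof (rule tendsto_zero_if_le_lincomb[OF _ _ Ug Wg])
    fix n
    let ?P = "\<lambda>x. grad (U n) x - F x" and ?R = "\<lambda>x. grad (W n) x - G x"
    have P: "?P \<in> L2_field \<gamma>" and R: "?R \<in> L2_field \<gamma>"
      using L2_field_lincomb[OF UF(1)[of n] F, of 1 "-1"] L2_field_lincomb[OF UF(2)[of n] G, of 1 "-1"] by simp_all
    have "(\<integral>x. (cm_norm \<gamma> (grad (V n) x - (a *\<^sub>R F x + b *\<^sub>R G x)))\<^sup>2 \<partial>\<gamma>)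
        \<le> (\<integral>x. 2 * a\<^sup>2 * (cm_norm \<gamma> (?P x))\<^sup>2 + 2 * b\<^sup>2 * (cm_norm \<gamma> (?R x))\<^sup>2 \<partial>\<gamma>)"
    proof (rule integral_mono')
      show "integrable \<gamma> (\<lambda>x. 2 * a\<^sup>2 * (cm_norm \<gamma> (?P x))\<^sup>2 + 2 * b\<^sup>2 * (cm_norm \<gamma> (?R x))\<^sup>2)"
        using L2_fieldD(3)[OF P] L2_fieldD(3)[OF R] by simp
      fix x
      have "grad (V n) x - (a *\<^sub>R F x + b *\<^sub>R G x) = a *\<^sub>R ?P x + b *\<^sub>R ?R x"
        by (simp add: Vg algebra_simps)
      then show "(cm_norm \<gamma> (grad (V n) x - (a *\<^sub>R F x + b *\<^sub>R G x)))\<^sup>2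
          \<le> 2 * a\<^sup>2 * (cm_norm \<gamma> (?P x))\<^sup>2 + 2 * b\<^sup>2 * (cm_norm \<gamma> (?R x))\<^sup>2"
        using cm_norm_square_lincomb_le[OF L2_fieldD(2)[OF P, of x] L2_fieldD(2)[OF R, of x]] by simp
    qed simp
    then show "(\<integral>x. (cm_norm \<gamma> (grad (V n) x - (a *\<^sub>R F x + b *\<^sub>R G x)))\<^sup>2 \<partial>\<gamma>)
      \<le> (2 * a\<^sup>2) * (\<integral>x. (cm_norm \<gamma> (?P x))\<^sup>2 \<partial>\<gamma>) + (2 * b\<^sup>2) * (\<integral>x. (cm_norm \<gamma> (?R x))\<^sup>2 \<partial>\<gamma>)"
      using L2_fieldD(3)[OF P] L2_fieldD(3)[OF R] by simp
  qed simp
  ultimately show ?thesis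
    unfolding wiener_gradient_def using V L2_lincomb[OF u w] L2_field_lincomb[OF F G] by blast
qed

lemma wiener_gradient_const: "has_grad (\<lambda>x. c) (\<lambda>x. 0)"
proof -
  have "C1b_cylindrical J \<xi> (\<lambda>x. c)"
    unfolding C1b_cylindrical_def using C1b_const[of c] by (intro exI[of _ 0] exI[of _ "\<lambda>_. c"]) auto
  moreover have "grad (\<lambda>x. c) x = 0" for x
    using cyl_gradient_eq[OF C1b_const[of c]] by simp
  ultimately show ?thesis
    by (auto simp: wiener_gradient_def L2_field_zero cm_norm_square intro!: exI[of _ "\<lambda>_ _. c"])
qed

text \<open>The functions \<open>\<psi> (U n x)\<close> are again cylindrical. Their gradient error
  splits into \<open>\<psi>' (U n x)\<close> times the error for \<open>U n\<close>, controlled by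
  \<open>L\<close>, and \<open>\<psi>' (U n x) - \<psi>' (u x)\<close> times \<open>F x\<close>. The
  second part requires pointwise convergence of \<open>U n\<close>, hence a subsequence, and tends
  to 0 by dominated convergence since \<open>\<psi>'\<close> is bounded and continuous.\<close>

lemma wiener_gradient_chain:
  assumes u: "has_grad u F"
    and \<psi>: "\<And>t. (\<psi> has_real_derivative \<psi>' t) (at t)" and cont: "continuous_on UNIV \<psi>'"
    and L: "\<And>t. \<bar>\<psi>' t\<bar> \<le> L"
  shows "has_grad (\<lambda>x. \<psi> (u x)) (\<lambda>x. \<psi>' (u x) *\<^sub>R F x)"
proof -
  obtain U0 where U0: "\<And>n. C1b_cylindrical J \<xi> (U0 n)" and U0l: "(\<lambda>n. \<integral>x. (U0 n x - u x)\<^sup>2 \<partial>\<gamma>) \<longlonglongrightarrow> 0"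
    and U0g: "(\<lambda>n. \<integral>x. (cm_norm \<gamma> (grad (U0 n) x - F x))\<^sup>2 \<partial>\<gamma>) \<longlonglongrightarrow> 0"
    and uL: "u \<in> L2 \<gamma>" and F: "F \<in> L2_field \<gamma>"
    using u by (auto simp: wiener_gradient_def)
  have U0L: "U0 n \<in> L2 \<gamma>" for n
    by (rule C1b_cylindricalE[OF U0[of n]]) (simp add: cyl_L2)
  have sq: "integrable \<gamma> (\<lambda>x. (U0 n x - u x)\<^sup>2)" for n
    by (intro L2_integrable_square L2_diff U0L uL)
  \<comment> \<open>L2 convergence is L1 convergence of the squared differences, to which the
    subsequence theorem applies.\<close>
  have "\<exists>r :: nat \<Rightarrow> nat. strict_mono r \<and> (AE x in \<gamma>. (\<lambda>n. (U0 (r n) x - u x)\<^sup>2) \<longlonglongrightarrow> 0)"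
    by (rule tendsto_L1_AE_subseq[OF sq]) (use U0l in simp)
  then obtain r :: "nat \<Rightarrow> nat" where r: "strict_mono r"
    and sq_ae: "AE x in \<gamma>. (\<lambda>n. (U0 (r n) x - u x)\<^sup>2) \<longlonglongrightarrow> 0"
    by blast
  from sq_ae have ae: "AE x in \<gamma>. (\<lambda>n. U0 (r n) x) \<longlonglongrightarrow> u x"
    by eventually_elim (simp add: LIM_zero_iff)
  define U where "U n = U0 (r n)" for n
  have U: "C1b_cylindrical J \<xi> (U n)" for n by (simp add: U_def U0)
  have UL: "U n \<in> L2 \<gamma>" for n by (simp add: U_def U0L)
  have Ul: "(\<lambda>n. \<integral>x. (U n x - u x)\<^sup>2 \<partial>\<gamma>) \<longlonglongrightarrow> 0"
    using LIMSEQ_subseq_LIMSEQ[OF U0l r] by (simp add: U_def o_def)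
  have Ug: "(\<lambda>n. \<integral>x. (cm_norm \<gamma> (grad (U n) x - F x))\<^sup>2 \<partial>\<gamma>) \<longlonglongrightarrow> 0"
    using LIMSEQ_subseq_LIMSEQ[OF U0g r] by (simp add: U_def o_def)
  define V where "V n x = \<psi> (U n x)" for n x
  have V: "C1b_cylindrical J \<xi> (V n)"
    and Vg: "grad (V n) x = \<psi>' (U n x) *\<^sub>R grad (U n) x"
    and UF: "grad (U n) \<in> L2_field \<gamma>"
    and VF: "grad (V n) \<in> L2_field \<gamma>"
    and VL: "V n \<in> L2 \<gamma>" for n x
  proof -
    obtain m p where m: "{..<m} \<subseteq> J" and p: "C1b m p" "U n = (\<lambda>x. p (coords x))"
      using U[of n] by (rule C1b_cylindricalE)
    have Vn: "V n = (\<lambda>x. \<psi> (p (coords x)))"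
      by (simp add: V_def[abs_def] p)
    note \<psi>p = C1b_compose[OF p(1) \<psi> cont]
    show "C1b_cylindrical J \<xi> (V n)"
      unfolding C1b_cylindrical_def Vn using m \<psi>p by blast
    show "grad (V n) x = \<psi>' (U n x) *\<^sub>R grad (U n) x"
      unfolding Vn p by (rule cyl_gradient_compose[OF p(1) m \<psi> cont])
    show "grad (U n) \<in> L2_field \<gamma>"
      unfolding p by (rule cyl_gradient_L2_field[OF p(1) m])
    show "grad (V n) \<in> L2_field \<gamma>"
      unfolding Vn by (rule cyl_gradient_L2_field[OF \<psi>p m])
    show "V n \<in> L2 \<gamma>"
      unfolding Vn by (rule cyl_L2[OF \<psi>p])
  qed
  have "continuous_on UNIV \<psi>"
    using \<psi> DERIV_continuous continuous_at_imp_continuous_on by blast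
  then have [measurable]: "\<psi> \<in> borel_measurable borel"
    by (rule borel_measurable_continuous_onI)
  have [measurable]: "\<psi>' \<in> borel_measurable borel"
    by (rule borel_measurable_continuous_onI[OF cont])
  have [measurable]: "u \<in> borel_measurable \<gamma>" "U n \<in> borel_measurable \<gamma>" for n
    using uL UL by (auto intro: L2_measurable)
  have lip: "\<bar>\<psi> s - \<psi> t\<bar> \<le> L * \<bar>s - t\<bar>" for s t
  proof -
    have "norm (\<psi> s - \<psi> t) \<le> L * norm (s - t)"
      by (rule field_differentiable_bound[of UNIV \<psi> \<psi>'])
        (use \<psi> L in \<open>auto simp: has_field_derivative_at_within\<close>)
    then show ?thesis by simp
  qed
  then have lip2: "(\<psi> s - \<psi> t)\<^sup>2 \<le> L\<^sup>2 * (s - t)\<^sup>2" for s t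
    using power_mono[OF lip[of s t] abs_ge_zero, of 2] by (simp add: power_mult_distrib)
  have \<psi>uL: "(\<lambda>x. \<psi> (u x)) \<in> L2 \<gamma>"
  proof -
    have "(\<lambda>x. \<psi> (u x) - \<psi> 0) \<in> L2 \<gamma>"
    proof -
      have "integrable \<gamma> (\<lambda>x. (\<psi> (u x) - \<psi> 0)\<^sup>2)"
        by (rule Bochner_Integration.integrable_bound[of _ "\<lambda>x. L\<^sup>2 * (u x)\<^sup>2"])
          (use lip2[of _ 0] in \<open>auto intro: L2_integrable_square uL\<close>)
      then show ?thesis by (simp add: L2_def)
    qed
    from L2_add[OF this L2_const[of "\<psi> 0"]] show ?thesis by simp
  qed
  have \<psi>F: "(\<lambda>x. \<psi>' (u x) *\<^sub>R F x) \<in> L2_field \<gamma>"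
    by (rule L2_field_mult[OF F _ L]) simp
  have lim1: "(\<lambda>n. \<integral>x. (V n x - \<psi> (u x))\<^sup>2 \<partial>\<gamma>) \<longlonglongrightarrow> 0"
  proof (rule tendsto_zero_if_le_lincomb[OF _ _ Ul tendsto_const])
    have "(\<integral>x. (V n x - \<psi> (u x))\<^sup>2 \<partial>\<gamma>) \<le> (\<integral>x. L\<^sup>2 * (U n x - u x)\<^sup>2 \<partial>\<gamma>)" for n
      by (rule integral_mono')
        (use lip2 UL uL in \<open>auto simp: V_def intro!: L2_integrable_square L2_diff\<close>)
    then show "(\<integral>x. (V n x - \<psi> (u x))\<^sup>2 \<partial>\<gamma>) \<le> L\<^sup>2 * (\<integral>x. (U n x - u x)\<^sup>2 \<partial>\<gamma>) + 0 * 0" for n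
      by simp
  qed simp
  have dom: "(\<lambda>n. \<integral>x. (\<psi>' (U n x) - \<psi>' (u x))\<^sup>2 * (cm_norm \<gamma> (F x))\<^sup>2 \<partial>\<gamma>) \<longlonglongrightarrow> (\<integral>x. 0 \<partial>\<gamma>)"
  proof (rule integral_dominated_convergence[where w = "\<lambda>x. (2 * L)\<^sup>2 * (cm_norm \<gamma> (F x))\<^sup>2"])
    note [measurable] = borel_measurable_integrable[OF L2_fieldD(3)[OF F]]
    show "(\<lambda>x. (\<psi>' (U n x) - \<psi>' (u x))\<^sup>2 * (cm_norm \<gamma> (F x))\<^sup>2) \<in> borel_measurable \<gamma>" for n
      by measurable
    show "integrable \<gamma> (\<lambda>x. (2 * L)\<^sup>2 * (cm_norm \<gamma> (F x))\<^sup>2)"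
      using L2_fieldD(3)[OF F] by simp
    have "(\<psi>' s - \<psi>' t)\<^sup>2 \<le> (2 * L)\<^sup>2" for s t
    proof -
      have "\<bar>\<psi>' s - \<psi>' t\<bar> \<le> \<bar>2 * L\<bar>"
        using L[of s] L[of t] by linarith
      then show ?thesis by (simp only: abs_le_square_iff)
    qed
    then show "AE x in \<gamma>. norm ((\<psi>' (U n x) - \<psi>' (u x))\<^sup>2 * (cm_norm \<gamma> (F x))\<^sup>2)
        \<le> (2 * L)\<^sup>2 * (cm_norm \<gamma> (F x))\<^sup>2" for n
      by (simp only: real_norm_def abs_mult abs_power2) (intro AE_I2 mult_right_mono, auto)
    show "AE x in \<gamma>. (\<lambda>n. (\<psi>' (U n x) - \<psi>' (u x))\<^sup>2 * (cm_norm \<gamma> (F x))\<^sup>2) \<longlonglongrightarrow> 0"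
      using ae
    proof eventually_elim
      case (elim x)
      have "isCont \<psi>' (u x)"
        using cont by (simp add: continuous_on_eq_continuous_at)
      then have "(\<lambda>n. \<psi>' (U n x)) \<longlonglongrightarrow> \<psi>' (u x)"
        using elim unfolding U_def by (rule isCont_tendsto_compose)
      then have "(\<lambda>n. (\<psi>' (U n x) - \<psi>' (u x))\<^sup>2 * (cm_norm \<gamma> (F x))\<^sup>2)
          \<longlonglongrightarrow> (\<psi>' (u x) - \<psi>' (u x))\<^sup>2 * (cm_norm \<gamma> (F x))\<^sup>2"
        by (intro tendsto_intros)
      then show ?case by simp
    qed
  qed auto
  have lim2: "(\<lambda>n. \<integral>x. (cm_norm \<gamma> (grad (V n) x - \<psi>' (u x) *\<^sub>R F x))\<^sup>2 \<partial>\<gamma>) \<longlonglongrightarrow> 0"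
  proof (rule tendsto_zero_if_le_lincomb[OF _ _ Ug dom[unfolded Bochner_Integration.integral_zero]])
    fix n
    let ?P = "\<lambda>x. grad (U n) x - F x"
    have P: "?P \<in> L2_field \<gamma>"
      using L2_field_lincomb[OF UF[of n] F, of 1 "-1"] by simp
    have i2: "integrable \<gamma> (\<lambda>x. (\<psi>' (U n x) - \<psi>' (u x))\<^sup>2 * (cm_norm \<gamma> (F x))\<^sup>2)"
    proof -
      have "\<bar>\<psi>' (U n x) - \<psi>' (u x)\<bar> \<le> 2 * L" for x
        using L[of "U n x"] L[of "u x"] by linarith
      then have "(\<lambda>x. (\<psi>' (U n x) - \<psi>' (u x)) *\<^sub>R F x) \<in> L2_field \<gamma>"
        by (intro L2_field_mult[OF F]) auto
      from L2_fieldD(3)[OF this] show ?thesis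
        by (simp add: cm_norm_square_scaleR L2_fieldD(2)[OF F])
    qed
    have "(\<integral>x. (cm_norm \<gamma> (grad (V n) x - \<psi>' (u x) *\<^sub>R F x))\<^sup>2 \<partial>\<gamma>)
        \<le> (\<integral>x. 2 * L\<^sup>2 * (cm_norm \<gamma> (?P x))\<^sup>2 + 2 * ((\<psi>' (U n x) - \<psi>' (u x))\<^sup>2 * (cm_norm \<gamma> (F x))\<^sup>2) \<partial>\<gamma>)"
    proof (rule integral_mono')
      show "integrable \<gamma> (\<lambda>x. 2 * L\<^sup>2 * (cm_norm \<gamma> (?P x))\<^sup>2 + 2 * ((\<psi>' (U n x) - \<psi>' (u x))\<^sup>2 * (cm_norm \<gamma> (F x))\<^sup>2))"
        using L2_fieldD(3)[OF P] i2 by simp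
      fix x
      have "grad (V n) x - \<psi>' (u x) *\<^sub>R F x
          = \<psi>' (U n x) *\<^sub>R ?P x + (\<psi>' (U n x) - \<psi>' (u x)) *\<^sub>R F x"
        by (simp add: Vg algebra_simps)
      then have "(cm_norm \<gamma> (grad (V n) x - \<psi>' (u x) *\<^sub>R F x))\<^sup>2
          \<le> 2 * (\<psi>' (U n x))\<^sup>2 * (cm_norm \<gamma> (?P x))\<^sup>2 + 2 * (\<psi>' (U n x) - \<psi>' (u x))\<^sup>2 * (cm_norm \<gamma> (F x))\<^sup>2"
        using cm_norm_square_lincomb_le[OF L2_fieldD(2)[OF P, of x] L2_fieldD(2)[OF F, of x]] by simp
      moreover have "(\<psi>' (U n x))\<^sup>2 * (cm_norm \<gamma> (?P x))\<^sup>2 \<le> L\<^sup>2 * (cm_norm \<gamma> (?P x))\<^sup>2"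
        using power_mono[OF L[of "U n x"] abs_ge_zero, of 2] by (intro mult_right_mono) auto
      ultimately show "(cm_norm \<gamma> (grad (V n) x - \<psi>' (u x) *\<^sub>R F x))\<^sup>2
          \<le> 2 * L\<^sup>2 * (cm_norm \<gamma> (?P x))\<^sup>2 + 2 * ((\<psi>' (U n x) - \<psi>' (u x))\<^sup>2 * (cm_norm \<gamma> (F x))\<^sup>2)"
        by linarith
    qed simp
    then show "(\<integral>x. (cm_norm \<gamma> (grad (V n) x - \<psi>' (u x) *\<^sub>R F x))\<^sup>2 \<partial>\<gamma>)
      \<le> (2 * L\<^sup>2) * (\<integral>x. (cm_norm \<gamma> (?P x))\<^sup>2 \<partial>\<gamma>)
        + 2 * (\<integral>x. (\<psi>' (U n x) - \<psi>' (u x))\<^sup>2 * (cm_norm \<gamma> (F x))\<^sup>2 \<partial>\<gamma>)"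
      using L2_fieldD(3)[OF P] i2 by simp
  qed simp
  show ?thesis
    unfolding wiener_gradient_def using \<psi>uL \<psi>F V lim1 lim2 by blast
qed

end

section \<open>The resolvent of the Ornstein-Uhlenbeck operator\<close>

text \<open>A gradient \<open>F\<close> of the zero function pairs with itself to 0, so at some
  point \<open>x\<close> the chosen preimage of \<open>F x\<close> vanishes almost everywhere. Its
  image \<open>F x\<close> under \<open>cm_map\<close> is then 0, and the preimage in question is
  \<open>cm_hat \<gamma> 0\<close>. Linearity of \<open>cm_inner\<close> rests on this conclusion
  and must be avoided here.\<close>

lemma cm_hat_zero_if_ornstein_uhlenbeck_zero:
  assumes "prob_space \<gamma>" and ou: "ornstein_uhlenbeck \<gamma> Q J \<xi> (\<lambda>x. 0) g"
  shows "AE x in \<gamma>. cm_hat \<gamma> 0 x = 0"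
proof -
  interpret prob_space \<gamma> by fact
  obtain F where F: "wiener_gradient \<gamma> Q J \<xi> (\<lambda>x. 0) F" and div: "wiener_divergence \<gamma> Q J \<xi> F g"
    using ou by (auto simp: ornstein_uhlenbeck_def)
  have fld: "F x \<in> cm_space \<gamma>" "integrable \<gamma> (\<lambda>x. (cm_norm \<gamma> (F x))\<^sup>2)" for x
    using F by (auto simp: wiener_gradient_def L2_field_def)
  have sq: "(cm_norm \<gamma> h)\<^sup>2 = cm_inner \<gamma> h h" for h
    by (simp add: cm_norm_def cm_inner_def L2_inner_self_nonneg)
  have "(\<integral>x. (cm_norm \<gamma> (F x))\<^sup>2 \<partial>\<gamma>) = 0"
    using div F by (auto simp: wiener_divergence_def sq)
  then have "AE x in \<gamma>. (cm_norm \<gamma> (F x))\<^sup>2 = 0"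
    using integral_nonneg_eq_0_iff_AE[OF fld(2)] by simp
  then obtain x where x: "cm_inner \<gamma> (F x) (F x) = 0"
    unfolding sq using eventually_happens'[OF ae_filter_bot] by blast
  have "\<exists>f. f \<in> dual_closure \<gamma> \<and> cm_map \<gamma> f = F x"
    using fld(1)[of x] by (auto simp: cm_space_def)
  from someI_ex[OF this] have hat: "cm_hat \<gamma> (F x) \<in> dual_closure \<gamma>" "cm_map \<gamma> (cm_hat \<gamma> (F x)) = F x"
    by (simp_all add: cm_hat_def)
  have L: "cm_hat \<gamma> (F x) \<in> L2 \<gamma>"
    using hat(1) by (simp add: dual_closure_def)
  have ae: "AE y in \<gamma>. cm_hat \<gamma> (F x) y = 0"
    using x L2_inner_self_eq_0[OF L] by (simp add: cm_inner_def)
  then have "AE y in \<gamma>. cm_hat \<gamma> (F x) y *\<^sub>R y = 0"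
    by eventually_elim simp
  then have "cm_map \<gamma> (cm_hat \<gamma> (F x)) = 0"
    unfolding cm_map_def by (rule integral_eq_zero_AE)
  then show ?thesis
    using ae hat(2) by simp
qed

section \<open>A continuously differentiable test function\<close>

definition neg_sq :: "real \<Rightarrow> real" where
  "neg_sq t = (min t 0)\<^sup>2"

text \<open>The first-order remainder is at most \<open>(s - t)\<^sup>2\<close> for all signs of
  \<open>s\<close> and \<open>t\<close>, which avoids one-sided derivatives at 0.\<close>

lemma has_derivative_neg_sq: "(neg_sq has_real_derivative 2 * min t 0) (at t)"
proof -
  have quad: "\<bar>neg_sq s - neg_sq t - 2 * min t 0 * (s - t)\<bar> \<le> (s - t)\<^sup>2" for s
  proof -
    consider "s \<le> 0" "t \<le> 0" | "0 \<le> s" "t \<le> 0" | "s \<le> 0" "0 \<le> t" | "0 \<le> s" "0 \<le> t" by linarith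
    then show ?thesis
    proof cases
      case 1
      then have "neg_sq s - neg_sq t - 2 * min t 0 * (s - t) = (s - t)\<^sup>2"
        by (simp add: neg_sq_def power2_eq_square algebra_simps)
      then show ?thesis by simp
    next
      case 2
      have "s * t \<le> 0"
        using 2 by (simp add: mult_nonneg_nonpos)
      moreover have "(s - t)\<^sup>2 = s * s - 2 * (s * t) + t * t" "0 \<le> s * s" "0 \<le> t * t"
        by (simp_all add: power2_eq_square algebra_simps)
      ultimately have "0 \<le> t * t - 2 * (s * t)" "t * t - 2 * (s * t) \<le> (s - t)\<^sup>2"
        by linarith+
      moreover have "neg_sq s - neg_sq t - 2 * min t 0 * (s - t) = t * t - 2 * (s * t)"
        using 2 by (simp add: neg_sq_def power2_eq_square algebra_simps)
      ultimately show ?thesis by simp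
    next
      case 3
      then have "s\<^sup>2 \<le> (s - t)\<^sup>2"
        by (simp add: abs_le_square_iff[symmetric])
      then show ?thesis using 3 by (simp add: neg_sq_def)
    qed (simp add: neg_sq_def)
  qed
  have "((\<lambda>h. (neg_sq (t + h) - neg_sq t) / h - 2 * min t 0) \<longlongrightarrow> 0) (at 0)"
  proof (rule Lim_null_comparison)
    show "\<forall>\<^sub>F h in at 0. norm ((neg_sq (t + h) - neg_sq t) / h - 2 * min t 0) \<le> \<bar>h\<bar>"
    proof (rule eventually_at_ball'[of 1, THEN eventually_mono])
      fix h :: real assume "h \<in> ball 0 1 \<and> h \<noteq> 0 \<and> h \<in> UNIV"
      then have "h \<noteq> 0" by simp
      then have "(neg_sq (t + h) - neg_sq t) / h - 2 * min t 0 = (neg_sq (t + h) - neg_sq t - 2 * min t 0 * h) / h"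
        by (simp add: diff_divide_distrib)
      moreover have "\<bar>neg_sq (t + h) - neg_sq t - 2 * min t 0 * h\<bar> / \<bar>h\<bar> \<le> h\<^sup>2 / \<bar>h\<bar>"
        using quad[of "t + h"] by (intro divide_right_mono) auto
      moreover have "h\<^sup>2 / \<bar>h\<bar> = \<bar>h\<bar>"
        by (simp add: power2_eq_square abs_if)
      ultimately show "norm ((neg_sq (t + h) - neg_sq t) / h - 2 * min t 0) \<le> \<bar>h\<bar>"
        by (simp add: abs_divide)
    qed simp
    show "((\<lambda>h. \<bar>h\<bar>) \<longlongrightarrow> 0) (at (0::real))"
      using tendsto_rabs[OF tendsto_ident_at[of "0::real" UNIV]] by simp
  qed
  then show ?thesis
    unfolding DERIV_def by (rule LIM_zero_cancel)
qed

text \<open>A substitute for \<open>min t 0\<close> with the same sign that is continuously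
  differentiable with bounded derivative, as \<open>wiener_gradient_chain\<close> requires:
  \<open>min t 0\<close> has a corner at 0, and the derivative of \<open>- neg_sq t\<close> is
  unbounded.\<close>

definition neg_cutoff :: "real \<Rightarrow> real" where
  "neg_cutoff t = - neg_sq t / (1 + neg_sq t)"

definition neg_cutoff' :: "real \<Rightarrow> real" where
  "neg_cutoff' t = - (2 * min t 0) / (1 + neg_sq t)\<^sup>2"

lemma neg_sq_nonneg: "0 \<le> neg_sq t"
  by (simp add: neg_sq_def)

lemma has_derivative_neg_cutoff: "(neg_cutoff has_real_derivative neg_cutoff' t) (at t)"
proof -
  have nz: "1 + neg_sq t \<noteq> 0"
    using neg_sq_nonneg[of t] by simp
  have "((\<lambda>t. - neg_sq t / (1 + neg_sq t)) has_real_derivative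
      (- (2 * min t 0) * (1 + neg_sq t) - (- neg_sq t) * (0 + 2 * min t 0)) / ((1 + neg_sq t) * (1 + neg_sq t))) (at t)"
    by (intro DERIV_divide DERIV_minus DERIV_add DERIV_const has_derivative_neg_sq nz)
  moreover have "(- (2 * min t 0) * (1 + neg_sq t) - (- neg_sq t) * (0 + 2 * min t 0)) / ((1 + neg_sq t) * (1 + neg_sq t)) = neg_cutoff' t"
    by (simp add: neg_cutoff'_def power2_eq_square algebra_simps)
  ultimately show ?thesis
    by (simp add: neg_cutoff_def[abs_def])
qed

lemma continuous_neg_cutoff': "continuous_on UNIV neg_cutoff'"
proof -
  have "continuous_on UNIV neg_sq"
    unfolding neg_sq_def[abs_def] by (intro continuous_intros)
  moreover have "(1 + neg_sq t)\<^sup>2 \<noteq> 0" for t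
    using neg_sq_nonneg[of t] by simp
  ultimately show ?thesis
    unfolding neg_cutoff'_def[abs_def] by (intro continuous_intros) auto
qed

text \<open>With \<open>m = min t 0\<close>, the numerator \<open>- 2 * m\<close> is at most
  \<open>1 + m\<^sup>2\<close> because \<open>(m + 1)\<^sup>2\<close> is nonnegative, and
  \<open>1 + m\<^sup>2\<close> is at most its own square.\<close>

lemma neg_cutoff'_bounds: "0 \<le> neg_cutoff' t" "neg_cutoff' t \<le> 1"
proof -
  have "- (2 * min t 0) \<le> 1 + neg_sq t"
    using zero_le_power2[of "min t 0 + 1"] by (simp add: neg_sq_def power2_eq_square algebra_simps)
  also have "\<dots> \<le> (1 + neg_sq t)\<^sup>2"
    using neg_sq_nonneg[of t] by (simp add: power2_eq_square algebra_simps)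
  finally have "- (2 * min t 0) \<le> (1 + neg_sq t)\<^sup>2" .
  moreover have "0 < (1 + neg_sq t)\<^sup>2"
    using neg_sq_nonneg[of t] by simp
  ultimately show "neg_cutoff' t \<le> 1"
    unfolding neg_cutoff'_def by (simp only: divide_le_eq_1_pos)
  show "0 \<le> neg_cutoff' t"
    unfolding neg_cutoff'_def by (rule divide_nonneg_nonneg) auto
qed

lemma neg_cutoff_nonpos: "neg_cutoff t \<le> 0"
  using neg_sq_nonneg[of t] by (simp add: neg_cutoff_def)

lemma neg_cutoff_mult_self: "0 \<le> neg_cutoff t * t" "neg_cutoff t * t = 0 \<Longrightarrow> 0 \<le> t"
proof -
  have pos: "0 < neg_cutoff t * t" if "t < 0"
  proof -
    have "0 < neg_sq t" using that by (simp add: neg_sq_def)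
    then have "neg_cutoff t < 0" by (simp add: neg_cutoff_def)
    then show ?thesis using that by (rule mult_neg_neg)
  qed
  have "neg_cutoff t = 0" if "0 \<le> t"
    using that by (simp add: neg_cutoff_def neg_sq_def)
  then show "0 \<le> neg_cutoff t * t"
    using pos by (cases "0 \<le> t") auto
  show "neg_cutoff t * t = 0 \<Longrightarrow> 0 \<le> t"
    using pos by (cases "0 \<le> t") auto
qed

context wiener_space
begin

section \<open>Energy inequality and positivity of the resolvents\<close>

abbreviation OU :: "('a \<Rightarrow> real) \<Rightarrow> ('a \<Rightarrow> real) \<Rightarrow> bool" where
  "OU \<equiv> ornstein_uhlenbeck \<gamma> Q J \<xi>"

lemma OU_L2: "OU u g \<Longrightarrow> u \<in> L2 \<gamma>" "OU u g \<Longrightarrow> g \<in> L2 \<gamma>"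
  by (auto simp: ornstein_uhlenbeck_def wiener_gradient_def wiener_divergence_def)

text \<open>Integration by parts: the pairing of \<open>\<psi> (u x)\<close> with \<open>g\<close>
  is minus the integral of \<open>\<psi>' (u x)\<close> times the squared norm of the
  gradient.\<close>

lemma OU_energy:
  assumes ou: "OU u g"
    and \<psi>: "\<And>t. (\<psi> has_real_derivative \<psi>' t) (at t)" and cont: "continuous_on UNIV \<psi>'"
    and \<psi>0: "\<And>t. 0 \<le> \<psi>' t" and L: "\<And>t. \<psi>' t \<le> L"
  shows "(\<lambda>x. \<psi> (u x)) \<in> L2 \<gamma>" "L2_inner \<gamma> (\<lambda>x. \<psi> (u x)) g \<le> 0"
proof -
  obtain F where F: "has_grad u F" and div: "wiener_divergence \<gamma> Q J \<xi> F g"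
    using ou by (auto simp: ornstein_uhlenbeck_def)
  have "\<bar>\<psi>' t\<bar> \<le> L" for t
    using \<psi>0[of t] L[of t] by simp
  note chain = wiener_gradient_chain[OF F \<psi> cont this]
  then show "(\<lambda>x. \<psi> (u x)) \<in> L2 \<gamma>"
    by (simp add: wiener_gradient_def)
  have mem: "F x \<in> cm_space \<gamma>" for x
    using F by (auto simp: wiener_gradient_def L2_field_def)
  have "0 \<le> (\<integral>x. cm_inner \<gamma> (\<psi>' (u x) *\<^sub>R F x) (F x) \<partial>\<gamma>)"
    by (intro Bochner_Integration.integral_nonneg)
      (simp add: cm_inner_scaleR_left mem \<psi>0 cm_norm_square[symmetric])
  also have "\<dots> = - L2_inner \<gamma> (\<lambda>x. \<psi> (u x)) g"
    using div chain by (auto simp: wiener_divergence_def)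
  finally show "L2_inner \<gamma> (\<lambda>x. \<psi> (u x)) g \<le> 0"
    by simp
qed

lemma OU_const: "OU (\<lambda>x. c) (\<lambda>x. 0)"
proof -
  have "wiener_divergence \<gamma> Q J \<xi> (\<lambda>x. 0) (\<lambda>x. 0)"
    by (auto simp: wiener_divergence_def L2_field_zero L2_inner_commute[of \<gamma> _ "\<lambda>x. 0"]
        wiener_gradient_def L2_field_def)
  then show ?thesis
    using wiener_gradient_const[of c] by (auto simp: ornstein_uhlenbeck_def)
qed

lemma OU_lincomb:
  assumes "OU u f" "OU w g"
  shows "OU (\<lambda>x. a * u x + b * w x) (\<lambda>x. a * f x + b * g x)"
proof -
  obtain F where F: "has_grad u F" and divF: "wiener_divergence \<gamma> Q J \<xi> F f"
    using assms(1) by (auto simp: ornstein_uhlenbeck_def)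
  obtain G where G: "has_grad w G" and divG: "wiener_divergence \<gamma> Q J \<xi> G g"
    using assms(2) by (auto simp: ornstein_uhlenbeck_def)
  have Ff: "F \<in> L2_field \<gamma>" and Gf: "G \<in> L2_field \<gamma>"
    using F G by (auto simp: wiener_gradient_def)
  have L: "f \<in> L2 \<gamma>" "g \<in> L2 \<gamma>"
    using assms by (auto intro: OU_L2)
  have "wiener_divergence \<gamma> Q J \<xi> (\<lambda>x. a *\<^sub>R F x + b *\<^sub>R G x) (\<lambda>x. a * f x + b * g x)"
    unfolding wiener_divergence_def
  proof (intro conjI allI impI)
    show "(\<lambda>x. a *\<^sub>R F x + b *\<^sub>R G x) \<in> L2_field \<gamma>" by (rule L2_field_lincomb[OF Ff Gf])
    show "(\<lambda>x. a * f x + b * g x) \<in> L2 \<gamma>" by (rule L2_lincomb[OF L])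
    fix p P assume P: "has_grad p P"
    then have p: "p \<in> L2 \<gamma>" and Pf: "P \<in> L2_field \<gamma>"
      by (auto simp: wiener_gradient_def)
    have "(\<integral>x. cm_inner \<gamma> (P x) (a *\<^sub>R F x + b *\<^sub>R G x) \<partial>\<gamma>)
        = (\<integral>x. a * cm_inner \<gamma> (P x) (F x) + b * cm_inner \<gamma> (P x) (G x) \<partial>\<gamma>)"
      by (simp add: cm_inner_lincomb_right L2_fieldD(2)[OF Ff] L2_fieldD(2)[OF Gf] L2_fieldD(2)[OF Pf])
    also have "\<dots> = a * (\<integral>x. cm_inner \<gamma> (P x) (F x) \<partial>\<gamma>) + b * (\<integral>x. cm_inner \<gamma> (P x) (G x) \<partial>\<gamma>)"
      using integrable_cm_inner[OF Pf Ff] integrable_cm_inner[OF Pf Gf] by simp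
    also have "\<dots> = a * (- L2_inner \<gamma> p f) + b * (- L2_inner \<gamma> p g)"
      using divF divG P by (auto simp: wiener_divergence_def)
    finally show "(\<integral>x. cm_inner \<gamma> (P x) (a *\<^sub>R F x + b *\<^sub>R G x) \<partial>\<gamma>) = - L2_inner \<gamma> p (\<lambda>x. a * f x + b * g x)"
      using p L by (simp add: L2_inner_lincomb_right)
  qed
  then show ?thesis
    using wiener_gradient_lincomb[OF F G, of a b] by (auto simp: ornstein_uhlenbeck_def)
qed

text \<open>Testing \<open>z - \<Delta>\<^sub>\<gamma> z / l = f\<close> with \<open>\<psi> (z)\<close>, where \<open>\<psi>\<close> is nondecreasing, negative on the
  negative half-line and zero elsewhere, gives \<open>\<integral> \<psi> (z) z \<le> \<integral> \<psi> (z) f \<le> 0\<close>.\<close>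

lemma resolvent_nonneg:
  assumes l: "l > 0" and z: "OU z (\<lambda>x. - (l * (f x - z x)))" and f: "AE x in \<gamma>. 0 \<le> f x"
  shows "AE x in \<gamma>. 0 \<le> z x"
proof -
  let ?\<psi>z = "\<lambda>x. neg_cutoff (z x)" and ?g = "\<lambda>x. - (l * (f x - z x))"
  note energy = OU_energy[OF z has_derivative_neg_cutoff continuous_neg_cutoff' neg_cutoff'_bounds]
  have i: "integrable \<gamma> (\<lambda>x. ?\<psi>z x * ?g x)"
    by (rule L2_integrable_mult[OF energy(1) OU_L2(2)[OF z]])
  have lower: "AE x in \<gamma>. l * (?\<psi>z x * z x) \<le> ?\<psi>z x * ?g x"
    using f
  proof eventually_elim
    case (elim x)
    have "0 \<le> l * (f x * - ?\<psi>z x)"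
      using l elim neg_cutoff_nonpos[of "z x"] by (intro mult_nonneg_nonneg) auto
    then show ?case by (simp add: algebra_simps)
  qed
  then have nn: "AE x in \<gamma>. 0 \<le> ?\<psi>z x * ?g x"
  proof eventually_elim
    case (elim x)
    have "0 \<le> l * (?\<psi>z x * z x)"
      using l neg_cutoff_mult_self(1)[of "z x"] by simp
    then show ?case using elim by linarith
  qed
  have "(\<integral>x. ?\<psi>z x * ?g x \<partial>\<gamma>) = 0"
    using energy(2) integral_nonneg_AE[OF nn] by (simp add: L2_inner_def)
  then have "AE x in \<gamma>. ?\<psi>z x * ?g x = 0"
    using integral_nonneg_eq_0_iff_AE[OF i nn] by simp
  then show ?thesis
    using lower
  proof eventually_elim
    case (elim x)
    then have "l * (?\<psi>z x * z x) \<le> l * 0"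
      by (simp only: mult_zero_right)
    then have "?\<psi>z x * z x \<le> 0"
      by (simp only: mult_le_cancel_left_pos[OF l])
    then show ?case
      using neg_cutoff_mult_self[of "z x"] by simp
  qed
qed

text \<open>By linearity, and since constants are mapped to 0, \<open>p - b * q - a\<close> solves
  the resolvent equation with right-hand side \<open>f - b * h - a\<close>, so
  \<open>resolvent_nonneg\<close> applies. The factor \<open>b\<close> may have either sign, as
  slopes of tangents do.\<close>

lemma resolvent_affine_mono:
  assumes l: "l > 0" and p: "OU p (\<lambda>x. - (l * (f x - p x)))" and q: "OU q (\<lambda>x. - (l * (h x - q x)))"
    and le: "AE x in \<gamma>. a + b * h x \<le> f x"
  shows "AE x in \<gamma>. a + b * q x \<le> p x"
proof -
  \<comment> \<open>The trivial coefficients bring \<open>p - b * q - a\<close> into the shape of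
    \<open>OU_lincomb\<close>.\<close>
  let ?z = "\<lambda>x. 1 * (1 * p x + (- b) * q x) + (- 1) * a"
  have "OU ?z (\<lambda>x. 1 * (1 * (- (l * (f x - p x))) + (- b) * (- (l * (h x - q x)))) + (- 1) * 0)"
    by (intro OU_lincomb p q OU_const)
  moreover have "(\<lambda>x. 1 * (1 * (- (l * (f x - p x))) + (- b) * (- (l * (h x - q x)))) + (- 1) * 0)
      = (\<lambda>x. - (l * ((f x - b * h x - a) - ?z x)))"
    by (simp add: fun_eq_iff algebra_simps)
  ultimately have z: "OU ?z (\<lambda>x. - (l * ((f x - b * h x - a) - ?z x)))"
    by (simp only:)
  have "AE x in \<gamma>. 0 \<le> f x - b * h x - a"
    using le by eventually_elim simp
  from resolvent_nonneg[OF l z this] show ?thesis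
    by eventually_elim simp
qed

text \<open>The exceptional null set of a tangent inequality depends on \<open>a\<close>, so only
  countably many tangents can be used at once. Continuity in \<open>a\<close> then admits
  \<open>a = u x\<close> at each remaining point, where the tangent inequality is the claim
  rearranged.\<close>

lemma resolvent_convex:
  assumes l: "l > 0" and convex: "convex_on UNIV \<phi>"
    and \<phi>: "\<And>t. (\<phi> has_real_derivative \<phi>' t) (at t)" and cont: "continuous_on UNIV \<phi>'"
    and q: "OU q (\<lambda>x. - (l * (u x - q x)))" and p: "OU p (\<lambda>x. - (l * (\<phi> (u x) - p x)))"
  shows "AE x in \<gamma>. \<phi> (u x) - p x \<le> \<phi>' (u x) * (u x - q x)"
proof -
  have tangent: "\<phi> a - \<phi>' a * a + \<phi>' a * t \<le> \<phi> t" for a t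
    using convex_on_imp_above_tangent[OF convex, of a t "\<phi>' a"] \<phi>[of a] by (simp add: algebra_simps)
  have "AE x in \<gamma>. \<phi> a - \<phi>' a * a + \<phi>' a * q x \<le> p x" for a
    by (rule resolvent_affine_mono[OF l p q]) (simp add: tangent)
  then have "AE x in \<gamma>. \<forall>a\<in>\<rat>. \<phi> a - \<phi>' a * a + \<phi>' a * q x \<le> p x"
    by (subst AE_ball_countable) (auto simp: countable_rat)
  then show ?thesis
  proof eventually_elim
    case (elim x)
    let ?P = "\<lambda>a. \<phi> a - \<phi>' a * a + \<phi>' a * q x"
    have "continuous_on UNIV \<phi>"
      using \<phi> DERIV_continuous continuous_at_imp_continuous_on by blast
    then have "continuous_on (closure \<rat>) ?P"
      using cont by (intro continuous_intros) (auto intro: continuous_on_subset)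
    then have "?P (u x) \<le> p x"
      by (rule continuous_le_on_closure) (use elim in \<open>auto simp: Rats_closure_real\<close>)
    then show ?case by (simp add: algebra_simps)
  qed
qed

end

section \<open>Fractional powers of the Ornstein-Uhlenbeck operator\<close>

lemma spectral_family_fractional_power:
  assumes "prob_space M" "fractional_power M A s u w"
  obtains E where "spectral_family M E" "\<And>u g. A u g \<longleftrightarrow> spectral_integral M E (\<lambda>t. t) u g"
    "spectral_integral M E (\<lambda>t. t powr s) u w"
  using assms
  by (auto simp: fractional_power_def spectral_measure_of_def spectral_family_def spectral_family_axioms_def)

text \<open>The hypothesis on \<open>u\<close> includes a spectral measure, and its spectral
  integral is defined at 0. The graph of the Ornstein-Uhlenbeck operator thus contains a pair with
  first component 0, which is what \<open>cm_hat_zero_if_ornstein_uhlenbeck_zero\<close> asks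
  for.\<close>

lemma wiener_space_if_frac_ornstein_uhlenbeck:
  assumes wiener: "abstract_wiener_space \<gamma>" and basis: "wiener_basis \<gamma> Q J \<xi>"
    and frac: "frac_ornstein_uhlenbeck \<gamma> Q J \<xi> s u v"
  shows "wiener_space \<gamma> Q J \<xi>"
proof -
  have prob: "prob_space \<gamma>"
    using wiener by (simp add: abstract_wiener_space_def centred_gaussian_measure_def)
  obtain E where "spectral_family \<gamma> E"
    and A: "\<And>u g. ornstein_uhlenbeck \<gamma> Q J \<xi> u (\<lambda>x. - g x) \<longleftrightarrow> spectral_integral \<gamma> E (\<lambda>t. t) u g"
    using spectral_family_fractional_power[OF prob frac[unfolded frac_ornstein_uhlenbeck_def]] by metis
  interpret spectral_family \<gamma> E by fact
  have "ornstein_uhlenbeck \<gamma> Q J \<xi> (\<lambda>x. 0) (\<lambda>x. - 0)"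
    using A[of "\<lambda>x. 0" "\<lambda>x. 0"] spectral_integral_zero[of "\<lambda>t. t"] by simp
  then have "AE x in \<gamma>. cm_hat \<gamma> 0 x = 0"
    by (rule cm_hat_zero_if_ornstein_uhlenbeck_zero[OF prob])
  then show ?thesis
    using wiener basis by (simp add: wiener_space_def)
qed

context wiener_space
begin

text \<open>The spectral measure stays inside the proof: the approximants are expressed by solutions
  of the resolvent equation in the graph \<open>OU\<close>. The numbers \<open>c\<close>,
  \<open>l\<close>, \<open>N\<close> are parameters so that the same sums serve for \<open>u\<close>
  and for \<open>\<phi> \<circ> u\<close>.\<close>

lemma frac_OU_resolvent_approximation:
  fixes c l :: "nat \<Rightarrow> nat \<Rightarrow> real" and N :: "nat \<Rightarrow> nat"
  assumes frac: "frac_ornstein_uhlenbeck \<gamma> Q J \<xi> s u v" and s: "s > 0"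
    and c: "\<And>n i. 0 \<le> c n i" and l: "\<And>n i. 0 < l n i"
    and le: "\<And>t n. 0 \<le> t \<Longrightarrow> (\<Sum>i<N n. c n i * (t / (l n i + t))) \<le> t powr s"
    and lim: "\<And>t. 0 \<le> t \<Longrightarrow> (\<lambda>n. \<Sum>i<N n. c n i * (t / (l n i + t))) \<longlonglongrightarrow> t powr s"
  obtains p where "\<And>n i. OU (p n i) (\<lambda>x. - (l n i * (u x - p n i x)))" "u \<in> L2 \<gamma>" "v \<in> L2 \<gamma>"
    "\<And>h. h \<in> L2 \<gamma> \<Longrightarrow>
      (\<lambda>n. L2_inner \<gamma> (\<lambda>x. \<Sum>i<N n. c n i * (u x - p n i x)) h) \<longlonglongrightarrow> L2_inner \<gamma> v h"
proof -
  obtain E where "spectral_family \<gamma> E"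
    and A: "\<And>u g. OU u (\<lambda>x. - g x) \<longleftrightarrow> spectral_integral \<gamma> E (\<lambda>t. t) u g"
    and v: "spectral_integral \<gamma> E (\<lambda>t. t powr s) u v"
    using spectral_family_fractional_power[OF prob_space_axioms frac[unfolded frac_ornstein_uhlenbeck_def]] by metis
  interpret spectral_family \<gamma> E by fact
  \<comment> \<open>The energy inequality with the identity as \<open>\<psi>\<close>.\<close>
  have pos: "0 \<le> L2_inner \<gamma> q p" if "spectral_integral \<gamma> E (\<lambda>t. t) p q" for p q
  proof -
    have ou: "OU p (\<lambda>x. - q x)"
      using that A by blast
    have "L2_inner \<gamma> p (\<lambda>x. (- 1) * q x) \<le> 0"
      using OU_energy(2)[OF ou, of "\<lambda>t. t" "\<lambda>t. 1" 1] by (simp add: continuous_on_const)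
    then show ?thesis
      unfolding L2_inner_scale_right by (simp add: L2_inner_commute)
  qed
  interpret nonneg_spectral_family \<gamma> E
    by unfold_locales (rule nonneg_support[OF pos])
  have L: "u \<in> L2 \<gamma>" "v \<in> L2 \<gamma>"
    using v by (auto simp: spectral_integral_iff spectral_domain_L2)
  have "\<exists>p. spectral_integral \<gamma> E (\<lambda>t. t) p (\<lambda>x. l n i * (u x - p x)) \<and>
    represents (resolvent_defect (l n i)) u (\<lambda>x. u x - p x)" for n i
    by (rule resolvent_exists[OF L(1) l])
  then obtain p where p: "\<And>n i. spectral_integral \<gamma> E (\<lambda>t. t) (p n i) (\<lambda>x. l n i * (u x - p n i x))"
    and rep: "\<And>n i. represents (resolvent_defect (l n i)) u (\<lambda>x. u x - p n i x)"
    by metis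
  define G where "G n t = (\<Sum>i<N n. c n i * resolvent_defect (l n i) t)" for n t
  have Gpos: "G n t = (\<Sum>i<N n. c n i * (t / (l n i + t)))" if "0 \<le> t" for n t
    using that by (simp add: G_def resolvent_defect_def)
  have weak: "(\<lambda>n. L2_inner \<gamma> (\<lambda>x. \<Sum>i<N n. c n i * (u x - p n i x)) h) \<longlonglongrightarrow> L2_inner \<gamma> v h"
    if h: "h \<in> L2 \<gamma>" for h
  proof (rule fractional_power_weak_limit[OF s v h, of G])
    show "G n \<in> borel_measurable borel" for n
      unfolding G_def[abs_def] by measurable
    show "\<bar>G n t\<bar> \<le> (\<Sum>i<N n. c n i)" for n t
    proof -
      have "0 \<le> c n i * resolvent_defect (l n i) t" "c n i * resolvent_defect (l n i) t \<le> c n i" for i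
        using c[of n i] resolvent_defect_bounds[OF l, of n i t] by (auto simp: mult_left_le)
      then have "0 \<le> G n t" "G n t \<le> (\<Sum>i<N n. c n i)"
        unfolding G_def by (auto intro: sum_nonneg sum_mono)
      then show ?thesis by simp
    qed
    show "G n t = 0" if "t < 0" for n t
      using that by (simp add: G_def resolvent_defect_def)
    show "0 \<le> G n t" for n t
      unfolding G_def using c resolvent_defect_bounds(1)[OF l] by (intro sum_nonneg mult_nonneg_nonneg)
    show "G n t \<le> t powr s" if "0 \<le> t" for n t
      using le[OF that] by (simp add: Gpos that)
    show "(\<lambda>n. G n t) \<longlonglongrightarrow> t powr s" if "0 \<le> t" for t
      using lim[OF that] by (simp add: Gpos that)
    show "represents (G n) u (\<lambda>x. \<Sum>i<N n. c n i * (u x - p n i x))" for n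
      unfolding G_def[abs_def]
    proof (rule represents_sum[where g = "\<lambda>i. resolvent_defect (l n i)" and w = "\<lambda>i x. u x - p n i x", OF L(1) finite_lessThan])
      show "\<bar>resolvent_defect (l n i) t\<bar> \<le> 1" for i t
        using resolvent_defect_bounds[OF l, of n i t] by simp
    qed (simp, rule rep)
  qed
  have "OU (p n i) (\<lambda>x. - (l n i * (u x - p n i x)))" for n i
    using A[of "p n i" "\<lambda>x. l n i * (u x - p n i x)"] p[of n i] by simp
  then show thesis
    by (rule that[OF _ L weak])
qed

end

theorem mainTheorem4:
  fixes \<gamma> :: "'a::{banach, second_countable_topology} measure"
    and Q :: "('a \<Rightarrow>\<^sub>L real) \<Rightarrow> 'a"
    and J :: "nat set"
    and \<xi> :: "nat \<Rightarrow> 'a \<Rightarrow>\<^sub>L real"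
    and s :: real
    and \<phi> \<phi>' \<phi>'' :: "real \<Rightarrow> real"
    and u v w :: "'a \<Rightarrow> real"
  assumes "abstract_wiener_space \<gamma>"
    and "wiener_basis \<gamma> Q J \<xi>"
    and "0 < s" and "s < 1"
    and "convex_on UNIV \<phi>"
    and "\<And>t. (\<phi> has_real_derivative \<phi>' t) (at t)"
    and "\<And>t. (\<phi>' has_real_derivative \<phi>'' t) (at t)"
    and "continuous_on UNIV \<phi>''"
    and "frac_ornstein_uhlenbeck \<gamma> Q J \<xi> s u v"
    and "frac_ornstein_uhlenbeck \<gamma> Q J \<xi> s (\<phi> \<circ> u) w"
  shows "AE x in \<gamma>. w x \<le> \<phi>' (u x) * v x"
proof -
  interpret wiener_space \<gamma> Q J \<xi>
    by (rule wiener_space_if_frac_ornstein_uhlenbeck[OF assms(1,2,9)])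
  have cont: "continuous_on UNIV \<phi>'"
    using assms(7) DERIV_continuous continuous_at_imp_continuous_on by blast
  then have [measurable]: "\<phi>' \<in> borel_measurable borel"
    by (rule borel_measurable_continuous_onI)
  obtain c l :: "nat \<Rightarrow> nat \<Rightarrow> real" and N :: "nat \<Rightarrow> nat" where
    "\<forall>n i. 0 \<le> c n i" "\<forall>n i. 0 < l n i"
    and approx: "\<forall>t\<ge>0. (\<forall>n. (\<Sum>i<N n. c n i * (t / (l n i + t))) \<le> t powr s) \<and>
      (\<lambda>n. \<Sum>i<N n. c n i * (t / (l n i + t))) \<longlonglongrightarrow> t powr s"
    using powr_eq_limit_of_resolvent_sums[OF assms(3,4)] by (elim exE conjE)
  then have c: "\<And>n i. 0 \<le> c n i" and l: "\<And>n i. 0 < l n i"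
    by auto
  have le: "(\<Sum>i<N n. c n i * (t / (l n i + t))) \<le> t powr s"
    and lim: "(\<lambda>n. \<Sum>i<N n. c n i * (t / (l n i + t))) \<longlonglongrightarrow> t powr s" if "0 \<le> t" for t n
    using approx that by auto
  obtain q where q: "\<And>n i. OU (q n i) (\<lambda>x. - (l n i * (u x - q n i x)))"
    and uL: "u \<in> L2 \<gamma>" and vL: "v \<in> L2 \<gamma>"
    and v: "\<And>h. h \<in> L2 \<gamma> \<Longrightarrow>
      (\<lambda>n. L2_inner \<gamma> (\<lambda>x. \<Sum>i<N n. c n i * (u x - q n i x)) h) \<longlonglongrightarrow> L2_inner \<gamma> v h"
    by (rule frac_OU_resolvent_approximation[OF assms(9,3) c l le lim]) (assumption, assumption, rule that, assumption+)
  obtain p where p: "\<And>n i. OU (p n i) (\<lambda>x. - (l n i * ((\<phi> \<circ> u) x - p n i x)))"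
    and \<phi>uL: "\<phi> \<circ> u \<in> L2 \<gamma>" and wL: "w \<in> L2 \<gamma>"
    and w: "\<And>h. h \<in> L2 \<gamma> \<Longrightarrow>
      (\<lambda>n. L2_inner \<gamma> (\<lambda>x. \<Sum>i<N n. c n i * ((\<phi> \<circ> u) x - p n i x)) h) \<longlonglongrightarrow> L2_inner \<gamma> w h"
    by (rule frac_OU_resolvent_approximation[OF assms(10,3) c l le lim]) (assumption, assumption, rule that, assumption+)
  define S where "S n x = (\<Sum>i<N n. c n i * (u x - q n i x))" for n x
  define T where "T n x = (\<Sum>i<N n. c n i * ((\<phi> \<circ> u) x - p n i x))" for n x
  have SL: "S n \<in> L2 \<gamma>" and TL: "T n \<in> L2 \<gamma>" for n
    unfolding S_def[abs_def] T_def[abs_def]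
    using OU_L2(1)[OF q] OU_L2(1)[OF p] uL \<phi>uL by (auto simp: o_def intro!: L2_sum L2_scale L2_diff)
  have TS: "AE x in \<gamma>. T n x \<le> \<phi>' (u x) * S n x" for n
  proof -
    have "AE x in \<gamma>. \<phi> (u x) - p n i x \<le> \<phi>' (u x) * (u x - q n i x)" for i
      using p[of n i] by (intro resolvent_convex[OF l[of n i] assms(5,6) cont q]) simp
    then have "AE x in \<gamma>. \<forall>i. \<phi> (u x) - p n i x \<le> \<phi>' (u x) * (u x - q n i x)"
      unfolding AE_all_countable by blast
    then show ?thesis
    proof eventually_elim
      case (elim x)
      have "T n x \<le> (\<Sum>i<N n. c n i * (\<phi>' (u x) * (u x - q n i x)))"
        unfolding T_def using elim c by (intro sum_mono mult_left_mono) auto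
      also have "\<dots> = \<phi>' (u x) * S n x"
        unfolding S_def sum_distrib_left by (intro sum.cong) (auto simp: algebra_simps)
      finally show ?case .
    qed
  qed
  note [measurable] = L2_measurable[OF uL] L2_measurable[OF vL] L2_measurable[OF wL]
  \<comment> \<open>The set where the claim fails is cut to
    \<open>\<bar>\<phi>' (u x)\<bar> \<le> real k\<close>. This makes \<open>\<phi>' (u x)\<close>
    times its indicator bounded, hence an admissible test function for the weak limit of
    \<open>S n\<close>.\<close>
  have "AE x in \<gamma>. \<not> (\<bar>\<phi>' (u x)\<bar> \<le> real k \<and> \<phi>' (u x) * v x < w x)" for k
  proof -
    define h :: "'a \<Rightarrow> real" where
      "h x = (if \<bar>\<phi>' (u x)\<bar> \<le> real k \<and> \<phi>' (u x) * v x < w x then 1 else 0)" for x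
    have [measurable]: "h \<in> borel_measurable \<gamma>"
      unfolding h_def[abs_def] by measurable
    have hb: "\<bar>h x\<bar> \<le> 1" "\<bar>\<phi>' (u x) * h x\<bar> \<le> real k" for x
      by (simp_all add: h_def)
    have hL: "h \<in> L2 \<gamma>"
      using L2_bounded_mult[where k = h, OF L2_const[of 1] _ hb(1)] by simp
    have \<phi>hL: "(\<lambda>x. \<phi>' (u x) * h x) \<in> L2 \<gamma>"
      using L2_bounded_mult[where k = "\<lambda>x. \<phi>' (u x) * h x", OF L2_const[of 1] _ hb(2)] by simp
    have le_n: "L2_inner \<gamma> (T n) h \<le> L2_inner \<gamma> (S n) (\<lambda>x. \<phi>' (u x) * h x)" for n
      unfolding L2_inner_def
    proof (rule integral_mono_AE)
      show "AE x in \<gamma>. T n x * h x \<le> S n x * (\<phi>' (u x) * h x)"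
        using TS[of n] by eventually_elim (simp add: h_def mult.commute)
    qed (intro L2_integrable_mult TL SL hL \<phi>hL)+
    \<comment> \<open>With \<open>\<phi>' (u x)\<close> moved into the test function, both sides are
      limits of pairings with a function independent of \<open>n\<close>.\<close>
    have "L2_inner \<gamma> w h \<le> L2_inner \<gamma> v (\<lambda>x. \<phi>' (u x) * h x)"
      using w[OF hL] v[OF \<phi>hL] le_n unfolding S_def T_def by (intro LIMSEQ_le) auto
    moreover have iw: "integrable \<gamma> (\<lambda>x. w x * h x)" and iv: "integrable \<gamma> (\<lambda>x. v x * (\<phi>' (u x) * h x))"
      by (intro L2_integrable_mult wL vL hL \<phi>hL)+
    ultimately have "(\<integral>x. w x * h x - v x * (\<phi>' (u x) * h x) \<partial>\<gamma>) \<le> 0"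
      by (simp add: L2_inner_def)
    \<comment> \<open>Where \<open>h\<close> is 1 the integrand is even strictly positive, so an
      integral that is at most 0 makes that set null.\<close>
    moreover have nn: "0 \<le> w x * h x - v x * (\<phi>' (u x) * h x)" for x
      by (simp add: h_def mult.commute)
    ultimately have "(\<integral>x. w x * h x - v x * (\<phi>' (u x) * h x) \<partial>\<gamma>) = 0"
      by (intro antisym Bochner_Integration.integral_nonneg)
    then have "AE x in \<gamma>. w x * h x - v x * (\<phi>' (u x) * h x) = 0"
      using integral_nonneg_eq_0_iff_AE[OF Bochner_Integration.integrable_diff[OF iw iv]] nn by simp
    then show ?thesis
      by eventually_elim (auto simp: h_def mult.commute)
  qed
  then have "AE x in \<gamma>. \<forall>k. \<not> (\<bar>\<phi>' (u x)\<bar> \<le> real k \<and> \<phi>' (u x) * v x < w x)"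
    unfolding AE_all_countable by blast
  then show ?thesis
  proof eventually_elim
    case (elim x)
    obtain k where "\<bar>\<phi>' (u x)\<bar> \<le> real k"
      using real_arch_simple by blast
    then show ?case
      using elim[THEN spec, of k] by (simp add: not_less)
  qed
qed

end
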